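(* Let $n\ge 6$ and let $Z\in\mathrm{Mat}_{6,n}^{>0}$. Then $\tilde Z$ maps the $(2,n)$-BCFW cells $\mathcal C_{n,2,4}$ of $\mathrm{Gr}_{2,n}^{\ge0}$ injectively into the amplituhedron $\mathcal A_{n,2,4}(Z)$ (that is, the restriction of $\tilde Z$ to each cell in $\mathcal C_{n,2,4}$ is injective), and the images under $\tilde Z$ of distinct cells of $\mathcal C_{n,2,4}$ are pairwise disjoint.
   Context: $\mathrm{Gr}_{k,n}$ is the real Grassmannian of $k$-dimensional subspaces of $\mathbb R^n$ (row spans of $k\times n$ matrices); $\mathrm{Gr}_{k,n}^{\ge 0}$ is the set of $V$ representable by a matrix all of whose $k\times k$ minors are nonnegative. $[n]=\{1,\dots,n\}$. **Amplituhedron.** For $a\le b$, $\mathrm{Mat}_{a,b}^{>0}$ is the set of real $a\times b$ matrices with all $a\times a$ minors positive. For $Z\in\mathrm{Mat}_{k+m,n}^{>0}$ ($k+m\le n$), viewed as a linear map $\mathbb R^n\to\mathbb R^{k+m}$, the map $\tilde Z:\mathrm{Gr}_{k,n}^{\ge0}\to\mathrm{Gr}_{k,k+m}$ is $\tilde Z(V)=\{Z(v):v\in V\}$ (known to be well defined, i.e. the image has dimension $k$). The amplituhedron is $\mathcal A_{n,k,m}(Z)=\tilde Z(\mathrm{Gr}_{k,n}^{\ge0})$. **Decorated permutations and positroid cells.** A decorated permutation of $[n]$ is a permutation of $[n]$ with each fixed point colored black or white. For $V\in\mathrm{Gr}_{k,n}^{\ge 0}$ represented by a matrix with columns $v_1,\dots,v_n$,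 put $v_{j+n}=v_j$; the decorated permutation $\pi_V$ sends $i$ to the residue in $[n]$ mod $n$ of the smallest $j\ge i$ with $v_i\in\mathrm{span}(v_{i+1},\dots,v_j)$ (so $j=i$ iff $v_i=0$); a fixed point $i$ is black if $j=i$ and white if $j=i+n$. The positroid cell of $\pi$ is $S_\pi=\{V:\pi_V=\pi\}$. **Plabic graphs.** A plabic graph is a planar graph in a disk with boundary vertices $1,\dots,n$ in clockwise order, each incident to a single edge, and internal vertices colored black or white. Its permutation $\pi_G$: from boundary vertex $i$ follow edges, turning maximally right at black and maximally left at white internal vertices, ending at boundary vertex $\pi_G(i)$. *Blowing up at $i$*: let boundary vertex $i$ be adjacent to an internal vertex $v$ of degree $3$, whose edges in clockwise order are (the edge to $i$), $e$, $f$. Replace $v$ by a 4-cycle $a,b,c,d$ (clockwise) with $a,c$ black and $b,d$ white; attach $e$ to $a$ and $f$ to $b$; join $c$ to boundary vertex $i$ and $d$ to a new boundary vertex $i+1$ placed next clockwise after $i$; the old labels $i+1,\dots,n$ increase by $1$. **BCFW cells.** For $2\le k\le n-2$ define sets $\tilde{\mathcal G}_{n,k,4}$ of plabic graphs: $\tilde{\mathcal G}_{4,2,4}$ consists of the single graph formed by a 4-cycle whose vertices in clockwise order are white, black, white, black and are joined respectively to boundary vertices $1,2,3,4$. For $n\ge 5$, $\tilde{\mathcal G}_{n,k,4}$ is the set of all graphs obtained by blowing up a graph in $\tilde{\mathcal G}_{n-1,k,4}$ at some $i\ne 1,n-1$ adjacent to a black vertex, or a graph in $\tilde{\mathcal G}_{n-1,k-1,4}$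 at some $i\neq 1,n-1$ adjacent to a white vertex. Let $c_n$ be the $n$-cycle $n\mapsto n-1\mapsto\cdots\mapsto 1\mapsto n$ (products composed right to left). For $0\le k\le n-4$, $\Pi_{n,k,4}=\{c_n^2\pi_G: G\in\tilde{\mathcal G}_{n,k+2,4}\}$, with all fixed points colored black, and $\mathcal C_{n,k,4}=\{S_\pi:\pi\in\Pi_{n,k,4}\}$; its members are the $(k,n)$-BCFW cells of $\mathrm{Gr}_{k,n}^{\ge0}$. *)

theory Defs
  imports
    "Jordan_Normal_Form.DL_Submatrix"
    "Jordan_Normal_Form.VS_Connect"
begin

section \<open>Grassmannians and amplituhedra\<close>

definition grassmannian :: "nat \<Rightarrow> nat \<Rightarrow> real vec set set" where
  "grassmannian k n =
    {V. VectorSpace.subspace class_ring V (module_vec TYPE(real) n) \<and>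
        vectorspace.dim class_ring ((module_vec TYPE(real) n)\<lparr>carrier := V\<rparr>) = k}"

text \<open>Matrix columns are numbered from \<open>0\<close>. The matrix \<open>submatrix A UNIV J\<close> keeps all rows, and
  the columns in \<open>J\<close> in increasing order.\<close>

definition nonneg_grassmannian :: "nat \<Rightarrow> nat \<Rightarrow> real vec set set" where
  "nonneg_grassmannian k n =
    {V \<in> grassmannian k n. \<exists>A \<in> carrier_mat k n. vec_space.row_space n A = V \<and>
       (\<forall>J \<subseteq> {0..<n}. card J = k \<longrightarrow> det (submatrix A UNIV J) \<ge> 0)}"

definition positive_mat :: "nat \<Rightarrow> nat \<Rightarrow> real mat set" where
  "positive_mat a b =
    {Z \<in> carrier_mat a b. \<forall>J \<subseteq> {0..<b}. card J = a \<longrightarrow> det (submatrix Z UNIV J) > 0}"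

definition amplituhedron_map :: "real mat \<Rightarrow> real vec set \<Rightarrow> real vec set" where
  "amplituhedron_map Z V = (\<lambda>v. Z *\<^sub>v v) ` V"

text \<open>Here \<open>Z\<close> is meant to lie in \<open>positive_mat (k + m) n\<close>; its size determines \<open>m\<close>.\<close>

definition amplituhedron :: "nat \<Rightarrow> nat \<Rightarrow> real mat \<Rightarrow> real vec set set" where
  "amplituhedron n k Z = amplituhedron_map Z ` nonneg_grassmannian k n"


section \<open>Decorated permutations and positroid cells\<close>

text \<open>A decorated permutation of \<open>{1..n}\<close> is a pair \<open>(\<pi>, W)\<close>: a permutation \<open>\<pi>\<close>, extended by the
  identity outside \<open>{1..n}\<close>, and its set \<open>W\<close> of white fixed points; all other fixed points in
  \<open>{1..n}\<close> are black.\<close>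

type_synonym decorated_perm = "(nat \<Rightarrow> nat) \<times> nat set"

text \<open>The residue of \<open>j\<close> modulo \<open>n\<close> in \<open>{1..n}\<close>, for \<open>j \<ge> 1\<close>.\<close>

definition residue1 :: "nat \<Rightarrow> nat \<Rightarrow> nat" where
  "residue1 n j = (j - 1) mod n + 1"

text \<open>The vectors \<open>v\<^sub>1, v\<^sub>2, \<dots>\<close> with \<open>v\<^sub>j\<^sub>+\<^sub>n = v\<^sub>j\<close>.\<close>

definition cyclic_col :: "real mat \<Rightarrow> nat \<Rightarrow> real vec" where
  "cyclic_col A j = col A (residue1 (dim_col A) j - 1)"

definition first_return :: "real mat \<Rightarrow> nat \<Rightarrow> nat" where
  "first_return A i =
    (LEAST j. i \<le> j \<and>
       cyclic_col A i \<in> LinearCombinations.module.span class_ring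
         (module_vec TYPE(real) (dim_row A)) (cyclic_col A ` {i + 1..j}))"

definition mat_decorated_perm :: "real mat \<Rightarrow> decorated_perm" where
  "mat_decorated_perm A =
    (let n = dim_col A in
     (\<lambda>i. if i \<in> {1..n} then residue1 n (first_return A i) else i,
      {i \<in> {1..n}. first_return A i = i + n}))"

text \<open>The result does not depend on the chosen representing matrix, since two choices differ by an
  invertible row transformation.\<close>

definition decorated_perm_of :: "nat \<Rightarrow> nat \<Rightarrow> real vec set \<Rightarrow> decorated_perm" where
  "decorated_perm_of k n V =
    mat_decorated_perm (SOME A. A \<in> carrier_mat k n \<and> vec_space.row_space n A = V)"

definition positroid_cell :: "nat \<Rightarrow> nat \<Rightarrow> decorated_perm \<Rightarrow> real vec set set" where
  "positroid_cell k n \<pi> = {V \<in> nonneg_grassmannian k n. decorated_perm_of k n V = \<pi>}"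


section \<open>Plabic graphs\<close>

text \<open>
  A graph embedded in an oriented surface is determined by its half-edges, the involution
  exchanging the two halves of each edge, and the clockwise cyclic order of the half-edges at each
  vertex. For a half-edge \<open>h\<close> of \<open>G\<close>, \<open>vert G h\<close> is the vertex \<open>h\<close> starts from, \<open>opp G h\<close> the other
  half of the same edge, and \<open>cw G h\<close> the half-edge following \<open>h\<close> clockwise around \<open>vert G h\<close>.
  Only the values at \<open>halves G\<close> are meaningful. Internal vertices carry a name and their color;
  the boundary vertices \<open>Boundary 1, \<dots>, Boundary n\<close> lie in clockwise order on the boundary of the
  disk. Planarity is not imposed on the record type: the BCFW graphs below start from a graph
  drawn in the disk, and blowing up is a local modification of such a drawing.
\<close>

datatype color = Black | White

datatype vertex = Boundary nat | Internal nat color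

record plabic =
  num_boundary :: nat
  halves :: "nat set"
  vert :: "nat \<Rightarrow> vertex"
  opp :: "nat \<Rightarrow> nat"
  cw :: "nat \<Rightarrow> nat"

text \<open>\<open>trip_ends G h j\<close>: the trip that leaves \<open>vert G h\<close> along \<open>h\<close> ends at boundary vertex \<open>j\<close>.
  Having arrived at a vertex along an edge, the leftmost way to go on is the edge following it in
  clockwise order, the rightmost one is the edge preceding it.\<close>

inductive trip_ends :: "plabic \<Rightarrow> nat \<Rightarrow> nat \<Rightarrow> bool" for G where
  boundary: "vert G (opp G h) = Boundary j \<Longrightarrow> trip_ends G h j"
| white: "vert G (opp G h) = Internal t White \<Longrightarrow> trip_ends G (cw G (opp G h)) j \<Longrightarrow>
    trip_ends G h j"
| black: "vert G (opp G h) = Internal t Black \<Longrightarrow> g \<in> halves G \<Longrightarrow> cw G g = opp G h \<Longrightarrow>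
    trip_ends G g j \<Longrightarrow> trip_ends G h j"

definition trip_perm :: "plabic \<Rightarrow> nat \<Rightarrow> nat" where
  "trip_perm G i =
    (if i \<in> {1..num_boundary G}
     then THE j. \<exists>h \<in> halves G. vert G h = Boundary i \<and> trip_ends G h j
     else i)"

fun shift_boundary :: "nat \<Rightarrow> vertex \<Rightarrow> vertex" where
  "shift_boundary i (Boundary j) = Boundary (if j \<le> i then j else j + 1)"
| "shift_boundary i (Internal t c) = Internal t c"

text \<open>
  \<open>blow_up i c G H\<close>: boundary vertex \<open>i\<close> of \<open>G\<close> is adjacent to an internal vertex of degree 3 and
  of color \<open>c\<close>, and \<open>H\<close> is obtained from \<open>G\<close> by blowing up at \<open>i\<close>. The half-edges at that vertex
  are, clockwise, \<open>x\<close> (leading to \<open>i\<close>), \<open>e\<close> and \<open>f\<close>. They are kept in \<open>H\<close>, where \<open>e\<close> starts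
  from \<open>a\<close>, \<open>f\<close> from \<open>b\<close> and \<open>x\<close> from \<open>c'\<close>. The half-edges \<open>y\<close> (at \<open>d\<close>) and \<open>z\<close> (at \<open>i + 1\<close>) form
  the new boundary edge, and \<open>ab\<close> is the half at \<open>a\<close> of the edge from \<open>a\<close> to \<open>b\<close>, etc. As
  \<open>a, b, c', d\<close> is clockwise, the clockwise order at each of these vertices is: the edge leaving
  the 4-cycle, the edge to the next vertex of the cycle, the edge to the previous one.
\<close>

inductive blow_up :: "nat \<Rightarrow> color \<Rightarrow> plabic \<Rightarrow> plabic \<Rightarrow> bool" where
  "\<lbrakk> i \<in> {1..num_boundary G};
     x \<in> halves G; vert G (opp G x) = Boundary i; vert G x = Internal t c;
     e = cw G x; f = cw G e; cw G f = x; distinct [x, e, f];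
     {h \<in> halves G. vert G h = Internal t c} = {x, e, f};
     distinct [y, z, ab, ba, bc, cb, cd, dc, da, ad];
     {y, z, ab, ba, bc, cb, cd, dc, da, ad} \<inter> halves G = {};
     a = Internal ta Black; b = Internal tb White; c' = Internal tc Black; d = Internal td White;
     distinct [a, b, c', d]; {a, b, c', d} \<inter> vert G ` halves G = {};
     H = \<lparr> num_boundary = num_boundary G + 1,
           halves = halves G \<union> {y, z, ab, ba, bc, cb, cd, dc, da, ad},
           vert = (\<lambda>h. shift_boundary i (vert G h))
             (e := a, ab := a, ad := a,  f := b, bc := b, ba := b,
              x := c', cd := c', cb := c',  y := d, da := d, dc := d,  z := Boundary (i + 1)),
           opp = (opp G)
             (y := z, z := y,  ab := ba, ba := ab,  bc := cb, cb := bc,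
              cd := dc, dc := cd,  da := ad, ad := da),
           cw = (cw G)
             (e := ab, ab := ad, ad := e,  f := bc, bc := ba, ba := f,
              x := cd, cd := cb, cb := x,  y := da, da := dc, dc := y,  z := z) \<rparr> \<rbrakk>
   \<Longrightarrow> blow_up i c G H"


section \<open>BCFW cells\<close>

text \<open>The 4-cycle with clockwise vertices \<open>1, 2, 3, 4\<close> (white, black, white, black), joined to the
  boundary vertices with the same numbers. Half-edge \<open>p\<close> is at boundary vertex \<open>p\<close>; at internal
  vertex \<open>p\<close> the clockwise order is \<open>4 + p\<close> (to the boundary), \<open>8 + p\<close> (to the next vertex of the
  cycle), \<open>12 + p\<close> (to the previous one).\<close>

definition bcfw_base :: plabic where
  "bcfw_base =
    \<lparr> num_boundary = 4,
      halves = {1..16},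
      vert = (\<lambda>h. if h \<le> 4 then Boundary h
                  else let p = (h - 1) mod 4 + 1 in Internal p (if odd p then White else Black)),
      opp = id(1 := 5, 5 := 1,  2 := 6, 6 := 2,  3 := 7, 7 := 3,  4 := 8, 8 := 4,
               9 := 14, 14 := 9,  10 := 15, 15 := 10,  11 := 16, 16 := 11,  12 := 13, 13 := 12),
      cw = (\<lambda>h. if h \<le> 4 then h else if h \<le> 12 then h + 4 else h - 8) \<rparr>"

text \<open>\<open>bcfw_graph n k G\<close>: \<open>G\<close> is one of the BCFW graphs with \<open>n\<close> boundary vertices, indexed by
  \<open>2 \<le> k \<le> n - 2\<close>. As graphs are considered up to isomorphism, one representative of the initial
  graph suffices, whereas \<open>blow_up\<close> leaves open how new vertices and half-edges are named.\<close>

inductive bcfw_graph :: "nat \<Rightarrow> nat \<Rightarrow> plabic \<Rightarrow> bool" where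
  base: "bcfw_graph 4 2 bcfw_base"
| black: "\<lbrakk> bcfw_graph n k G; i \<noteq> 1; i \<noteq> n; blow_up i Black G H \<rbrakk> \<Longrightarrow> bcfw_graph (n + 1) k H"
| white: "\<lbrakk> bcfw_graph n k G; i \<noteq> 1; i \<noteq> n; blow_up i White G H \<rbrakk> \<Longrightarrow>
    bcfw_graph (n + 1) (k + 1) H"

text \<open>The cycle \<open>n \<mapsto> n - 1 \<mapsto> \<dots> \<mapsto> 1 \<mapsto> n\<close>.\<close>

definition long_cycle :: "nat \<Rightarrow> nat \<Rightarrow> nat" where
  "long_cycle n i = (if i = 1 then n else if i \<in> {2..n} then i - 1 else i)"

definition bcfw_perms :: "nat \<Rightarrow> nat \<Rightarrow> decorated_perm set" where
  "bcfw_perms n k = {(long_cycle n \<circ> long_cycle n \<circ> trip_perm G, {}) | G. bcfw_graph n (k + 2) G}"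

definition bcfw_cells :: "nat \<Rightarrow> nat \<Rightarrow> real vec set set set" where
  "bcfw_cells n k = positroid_cell k n ` bcfw_perms n k"

end

theory Submission
  imports Defs "Jordan_Normal_Form.DL_Rank"
begin

text \<open>
  A plane \<open>V\<close> in a BCFW cell is spanned by two row vectors, and its image determines \<open>V\<close> up to
  adding elements of the kernel of \<open>Z\<close>. By Gantmakher and Krein, nonzero kernel vectors of the
  positive matrix \<open>Z\<close> have at least six sign changes, while the decorated permutation of a BCFW cell
  forces the points of the cell into an explicit sparse form with prescribed signs. Comparing two
  such forms with the same image therefore forces them to be equal, which gives injectivity
  on each cell as well as disjointness of the images of different cells. To see which
  decorated permutations occur, we follow the trips while a graph is blown up: one trip is cut at the
  vertex at \<open>i\<close>, and its two pieces are reconnected with the trips from and to \<open>i\<close>.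
\<close>

text \<open>The obstacle is that the supports of two planes, from one cell or from two, can overlap
  in many ways. It is removed by encoding adjacent entries \<open>f\<close>, \<open>g\<close> of
  equal sign at \<open>i\<close>, \<open>i + 1\<close> (a domino) as one real point
  \<open>i + g / (f + g)\<close> of weight \<open>f + g\<close>. Hat functions evaluated at
  increasing points form a totally nonnegative matrix, so six sign changes of a kernel vector need
  seven such points with alternating weights. All overlaps thus reduce to the order of at most nine
  points on a line. Cells of planes correspond to two chords \<open>(i, j)\<close>,
  \<open>(k, l)\<close>, each with a domino at either end, lying side by side
  (\<open>form_S\<close>) or nested (\<open>form_N\<close>). In the nested case both generators
  share a domino, and there the comparison uses both inclusions of the images. On the graph side the
  trip permutation alone is not an invariant that can be carried along: to cut a trip one must know
  which later cutting places lie on which piece. Hence each trip records, in order, the vertices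
  next to the boundary that it passes. A white blow-up adds exactly one black vertex of this kind
  and a black one adds none, so only a few kinds of steps occur.\<close>

section \<open>Sign alternations of finite sequences\<close>

text \<open>Greedy length of a longest subsequence with strictly alternating signs whose first sign
  is that of \<open>s\<close>; zeros are skipped. Keeping the first sign as an argument makes the
  effect of a prefix on the rest explicit.\<close>

fun sign_alts :: "real \<Rightarrow> real list \<Rightarrow> nat" where
  "sign_alts s [] = 0"
| "sign_alts s (x # xs) = (if s * x > 0 then Suc (sign_alts (- s) xs) else sign_alts s xs)"

text \<open>Dropping the first chosen entry leaves an alternating subsequence that starts with the
  opposite sign.\<close>

lemma sign_alts_le_Suc: "sign_alts s xs \<le> Suc (sign_alts (- s) xs)"
proof (induction xs arbitrary: s)
  case (Cons x xs)
  from Cons[of s] Cons[of "-s"] show ?case by auto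
qed simp

text \<open>The sign awaited after the prefix depends on the prefix, hence the premise for all
  \<open>s\<close>.\<close>

lemma sign_alts_append_mono:
  assumes "\<And>s. sign_alts s ys \<le> sign_alts s zs"
  shows "sign_alts s (xs @ ys) \<le> sign_alts s (xs @ zs)"
  using assms by (induction xs arbitrary: s) auto

lemma sign_alts_zero: "sign_alts s (xs @ 0 # ys) = sign_alts s (xs @ ys)"
  by (induction xs arbitrary: s) auto

text \<open>If \<open>x + y\<close> has a given sign, then \<open>x\<close> or \<open>y\<close> has
  it.\<close>

lemma sign_alts_merge: "sign_alts s (xs @ (x + y) # ys) \<le> sign_alts s (xs @ x # y # ys)"
proof (rule sign_alts_append_mono)
  fix s :: real
  show "sign_alts s ((x + y) # ys) \<le> sign_alts s (x # y # ys)"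
  proof (cases "s * (x + y) > 0")
    case True
    then have "s * x > 0 \<or> s * y > 0" by (simp add: distrib_left) linarith
    then show ?thesis using True sign_alts_le_Suc[of "- s" ys] by auto
  next
    case False
    then show ?thesis using sign_alts_le_Suc[of "s" ys] by (auto simp: distrib_left)
  qed
qed

text \<open>Nonnegative multiples of one number never have opposite signs.\<close>

lemma sign_alts_split:
  assumes "a \<ge> 0" "b \<ge> 0"
  shows "sign_alts s (xs @ a * x # b * x # ys) \<le> sign_alts s (xs @ x # ys)"
proof (rule sign_alts_append_mono)
  fix s :: real
  have *: "s * (c * x) > 0 \<Longrightarrow> s * x > 0" "(- s) * (c * x) > 0 \<Longrightarrow> s * x < 0" if "c \<ge> 0" for c
  proof -
    show "s * (c * x) > 0 \<Longrightarrow> s * x > 0"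
      using that by (metis mult.left_commute zero_less_mult_pos order_le_less mult_zero_left mult_zero_right)
    show "(- s) * (c * x) > 0 \<Longrightarrow> s * x < 0"
      using that by (metis mult.left_commute zero_less_mult_pos order_le_less mult_zero_left mult_zero_right
          mult_minus_left neg_0_less_iff_less)
  qed
  show "sign_alts s (a * x # b * x # ys) \<le> sign_alts s (x # ys)"
    using *[OF assms(1)] *[OF assms(2)] sign_alts_le_Suc[of s ys] by auto
qed

text \<open>\<open>blockL\<close> and \<open>blockR\<close> are the two coordinates of a weighted
  sum of columns \<open>(1 - f, f)\<close>: a hat combination whose points lie in one unit
  interval.\<close>

definition blockL :: "(real \<times> real) list \<Rightarrow> real" where
  "blockL L = sum_list (map (\<lambda>(f, c). c * (1 - f)) L)"
definition blockR :: "(real \<times> real) list \<Rightarrow> real" where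
  "blockR L = sum_list (map (\<lambda>(f, c). c * f) L)"

text \<open>Total nonnegativity of the two-row matrix with columns \<open>(1 - f, f)\<close>, by
  peeling from the right. For \<open>f \<le> f'\<close> the last column is \<open>\<mu>\<close>
  times the one before it plus \<open>1 - \<mu>\<close> times \<open>(0, 1)\<close>. The first share
  joins the previous weight, the second becomes an entry of its own behind the block; afterwards
  merging and splitting restore the original weights.\<close>

lemma sign_alts_block:
  assumes "sorted (map fst L)" "\<forall>f\<in>set (map fst L). 0 \<le> f \<and> f \<le> 1"
  shows "sign_alts s (xs @ blockL L # blockR L # ys) \<le> sign_alts s (xs @ map snd L @ ys)"
  using assms
proof (induction "length L" arbitrary: L ys rule: less_induct)
  case less
  show ?case
  proof (cases L rule: rev_cases)
    case Nil
    then show ?thesis using sign_alts_zero[of s xs "0 # ys"] sign_alts_zero[of s xs "ys"]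
      by (simp add: blockL_def blockR_def)
  next
    case (snoc L1 p')
    show ?thesis
    proof (cases L1 rule: rev_cases)
      case Nil
      obtain f c where p: "p' = (f, c)" by force
      have "0 \<le> f" "f \<le> 1" using less.prems(2) snoc p by auto
      then show ?thesis using sign_alts_split[of "1 - f" f s xs c ys] snoc Nil p
        by (simp add: blockL_def blockR_def mult.commute)
    next
      case (snoc L0 p)
      obtain f c where p: "p = (f, c)" by force
      obtain f' c' where p': "p' = (f', c')" by force
      have L: "L = L0 @ [(f, c), (f', c')]" using \<open>L = L1 @ [p']\<close> snoc p p' by simp
      have f: "0 \<le> f" "f \<le> f'" "f' \<le> 1" using less.prems L by (auto simp: sorted_append)
      \<comment> \<open>If \<open>f = 1\<close> then \<open>f' = 1\<close> too; the last column is
        then already \<open>(0, 1)\<close>, which is the share \<open>\<mu> = 0\<close>.\<close>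
      define \<mu> where "\<mu> = (if f = 1 then 0 else (1 - f') / (1 - f))"
      have mu: "0 \<le> \<mu>" "\<mu> \<le> 1" "1 - f' = \<mu> * (1 - f)"
        using f by (auto simp: \<mu>_def field_simps)
      let ?L = "L0 @ [(f, c + \<mu> * c')]"
      have A: "blockL L = blockL ?L" using arg_cong[OF mu(3), of "\<lambda>z. c' * z"]
        by (simp add: L blockL_def algebra_simps)
      have f': "f' = \<mu> * f + (1 - \<mu>)" using mu(3) by (simp add: algebra_simps)
      have "c' * f' = c' * (\<mu> * f + (1 - \<mu>))" by (rule arg_cong[OF f'])
      then have B: "blockR L = blockR ?L + (1 - \<mu>) * c'"
        by (simp add: L blockR_def algebra_simps)
      have "sign_alts s (xs @ blockL L # blockR L # ys)
          \<le> sign_alts s (xs @ blockL ?L # blockR ?L # (1 - \<mu>) * c' # ys)"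
        using sign_alts_merge[of s "xs @ [blockL L]" "blockR ?L" "(1 - \<mu>) * c'" ys] A B by simp
      also have "\<dots> \<le> sign_alts s (xs @ map snd ?L @ (1 - \<mu>) * c' # ys)"
        by (rule less.hyps) (use less.prems L in \<open>auto simp: sorted_append\<close>)
      also have "\<dots> \<le> sign_alts s (xs @ map snd L0 @ c # \<mu> * c' # (1 - \<mu>) * c' # ys)"
        using sign_alts_merge[of s "xs @ map snd L0" c "\<mu> * c'" "(1 - \<mu>) * c' # ys"] by simp
      also have "\<dots> \<le> sign_alts s (xs @ map snd L0 @ c # c' # ys)"
        using sign_alts_split[of \<mu> "1 - \<mu>" s "xs @ map snd L0 @ [c]" c' ys] mu by simp
      finally show ?thesis using L by simp
    qed
  qed
qed

section \<open>Hat functions and variation diminution\<close>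

text \<open>The tent of height 1 over the integer \<open>a\<close>. A point \<open>t\<close>
  strictly between \<open>i\<close> and \<open>i + 1\<close> has the values \<open>i + 1 - t\<close>
  and \<open>t - i\<close> at these two integers and 0 elsewhere.\<close>

definition hat :: "nat \<Rightarrow> real \<Rightarrow> real" where
  "hat a t = max 0 (1 - \<bar>t - real a\<bar>)"

definition hat_comb :: "(real \<times> real) list \<Rightarrow> nat \<Rightarrow> real" where
  "hat_comb L a = (\<Sum>(t, c)\<leftarrow>L. c * hat a t)"

lemma hat_comb_append: "hat_comb (L @ M) a = hat_comb L a + hat_comb M a"
  by (simp add: hat_comb_def)

lemma hat_comb_eq_0:
  assumes "\<And>t c. (t, c) \<in> set L \<Longrightarrow> \<bar>t - real a\<bar> \<ge> 1"
  shows "hat_comb L a = 0"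
proof -
  have "(case p of (t, c) \<Rightarrow> c * hat a t) = 0" if "p \<in> set L" for p
    using assms[of "fst p" "snd p"] that by (simp add: hat_def case_prod_beta)
  then have "map (\<lambda>(t, c). c * hat a t) L = map (\<lambda>_. 0) L" by (simp only: map_eq_conv) blast
  then show ?thesis by (simp only: hat_comb_def) (simp add: sum_list_0)
qed

lemma hat_at_self: "hat a (real a) = 1"
  by (simp add: hat_def)

text \<open>The columns of the hat matrix taken at increasing points form a totally nonnegative matrix, so
  it does not increase the number of sign alternations; unit intervals are peeled off from the left.\<close>

lemma sign_alts_hat_comb:
  assumes "sorted (map fst L)" "\<forall>t\<in>set (map fst L). real k \<le> t \<and> t \<le> real N" "k \<le> N"
  shows "sign_alts s (xs @ map (hat_comb L) [k..<Suc N]) \<le> sign_alts s (xs @ map snd L)"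
  using assms
proof (induction "N - k" arbitrary: k L xs)
  case 0
  then have k: "k = N" by simp
  have eq: "t = real N" if "(t, c) \<in> set L" for t c using 0 k that by force
  have "sign_alts s (xs @ sum_list (map snd L) # ys) \<le> sign_alts s (xs @ map snd L @ ys)" for xs ys
  proof (induction L arbitrary: xs)
    case Nil
    then show ?case by (simp add: sign_alts_zero)
  next
    case (Cons p L)
    have "sign_alts s (xs @ sum_list (map snd (p # L)) # ys)
        \<le> sign_alts s ((xs @ [snd p]) @ sum_list (map snd L) # ys)"
      using sign_alts_merge[of s xs "snd p" "sum_list (map snd L)" ys] by simp
    also have "\<dots> \<le> sign_alts s (xs @ map snd (p # L) @ ys)" using Cons.IH[of "xs @ [snd p]"] by simp
    finally show ?case .
  qed
  moreover have "hat_comb L N = sum_list (map snd L)"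
  proof -
    have "map (\<lambda>(t, c). c * hat N t) L = map snd L"
      using hat_at_self by (force dest: eq)
    then show ?thesis by (simp only: hat_comb_def)
  qed
  ultimately show ?case using k by (metis append_Nil2 list.simps(8,9) upt_rec lessI less_irrefl upt_0 not_less_eq append.right_neutral le_refl upt_conv_Nil)
next
  case (Suc d)
  define L1 where "L1 = takeWhile (\<lambda>p. fst p < real (Suc k)) L"
  define L2 where "L2 = dropWhile (\<lambda>p. fst p < real (Suc k)) L"
  have L: "L = L1 @ L2" by (simp add: L1_def L2_def)
  have L1: "fst p < real (Suc k)" "real k \<le> fst p" if "p \<in> set L1" for p
    using that set_takeWhileD[of p] Suc.prems(2) L unfolding L1_def by (force, force)
  have L2: "real (Suc k) \<le> fst p" if "p \<in> set L2" for p
  proof (cases L2)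
    case (Cons a as)
    then have "\<not> fst a < real (Suc k)" unfolding L2_def by (metis hd_dropWhile list.sel(1) list.distinct(1))
    moreover have "fst a \<le> fst p" using Suc.prems(1) L Cons that by (auto simp: sorted_append)
    ultimately show ?thesis by linarith
  qed (use that in simp)
  let ?M = "map (\<lambda>(t, c). (t - real k, c)) L1"
  \<comment> \<open>What the points left of \<open>k + 1\<close> contribute to coordinate
    \<open>k + 1\<close> is placed exactly at the point \<open>k + 1\<close>. The remaining
    coordinates then come from a list of points in the interval from \<open>k + 1\<close> to
    \<open>N\<close>.\<close>
  let ?L' = "(real (Suc k), blockR ?M) # L2"
  have left: "hat_comb L k = blockL ?M"
  proof -
    have "hat_comb L2 k = 0" by (rule hat_comb_eq_0) (use L2 in fastforce)
    moreover have "hat_comb L1 k = blockL ?M"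
    proof -
      have "hat k (fst p) = 1 - (fst p - real k)" if "p \<in> set L1" for p
        using L1[OF that] by (auto simp: hat_def)
      then have "map (\<lambda>(t, c). c * hat k t) L1 = map (\<lambda>(t, c). c * (1 - (t - real k))) L1" by force
      then show ?thesis by (simp only: hat_comb_def blockL_def) (simp add: comp_def case_prod_beta')
    qed
    ultimately show ?thesis using L by (simp add: hat_comb_append)
  qed
  have right: "hat_comb L a = hat_comb ?L' a" if a: "a \<ge> Suc k" for a
  proof -
    have "hat_comb L1 a = blockR ?M * hat a (real (Suc k))"
    proof (cases "a = Suc k")
      case True
      have "hat_comb L1 (Suc k) = blockR ?M"
      proof -
        have "hat (Suc k) (fst p) = fst p - real k" if "p \<in> set L1" for p
          using L1[OF that] by (auto simp: hat_def)
        then have "map (\<lambda>(t, c). c * hat (Suc k) t) L1 = map (\<lambda>(t, c). c * (t - real k)) L1" by force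
        then show ?thesis by (simp only: hat_comb_def blockR_def) (simp add: comp_def case_prod_beta')
      qed
      then show ?thesis using True by (simp add: hat_at_self del: of_nat_Suc)
    next
      case False
      then have a2: "real a \<ge> real k + 2" using a by linarith
      then have "hat a (real (Suc k)) = 0" by (auto simp: hat_def)
      moreover have "hat_comb L1 a = 0" by (rule hat_comb_eq_0) (use L1 a2 in fastforce)
      ultimately show ?thesis by simp
    qed
    then show ?thesis using L by (simp add: hat_comb_append) (simp add: hat_comb_def)
  qed
  have "[k..<Suc N] = k # [Suc k..<Suc N]" using Suc.prems(3) by (simp add: upt_rec)
  then have "xs @ map (hat_comb L) [k..<Suc N] = (xs @ [blockL ?M]) @ map (hat_comb ?L') [Suc k..<Suc N]"
  proof -
    have "map (hat_comb L) [Suc k..<Suc N] = map (hat_comb ?L') [Suc k..<Suc N]"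
      by (rule map_cong[OF refl], rule right) (simp del: upt_Suc)
    then show ?thesis using left \<open>[k..<Suc N] = k # [Suc k..<Suc N]\<close>
      by (simp only: list.map append_assoc append.simps)
  qed
  also have "sign_alts s \<dots> \<le> sign_alts s ((xs @ [blockL ?M]) @ map snd ?L')"
  proof (rule Suc.hyps)
    show "d = N - Suc k" "Suc k \<le> N" using Suc.hyps(2) by auto
    show "sorted (map fst ?L')" using Suc.prems(1) L L2 by (auto simp: sorted_append)
    show "\<forall>t\<in>set (map fst ?L'). real (Suc k) \<le> t \<and> t \<le> real N"
      using L2 Suc.prems(2) L \<open>Suc k \<le> N\<close> by auto
  qed
  also have "\<dots> \<le> sign_alts s (xs @ map snd ?M @ map snd L2)"
  proof -
    have "\<forall>p\<in>set L1. fst p - real k \<le> 1" using L1(1) by force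
    then show ?thesis
      using sign_alts_block[of ?M s xs "map snd L2"] Suc.prems(1) L1(2) L
      by (auto simp: sorted_append comp_def case_prod_beta sorted_map)
  qed
  also have "\<dots> = sign_alts s (xs @ map snd L)" using L by (simp add: comp_def case_prod_beta')
  finally show ?case .
qed

section \<open>Sign changes of kernel vectors of positive matrices\<close>

lemma pick_eqI:
  assumes "y \<in> J" "card {a \<in> J. a < y} = c"
  shows "pick J c = y"
  using pick_card_in_set[OF assms(1)] assms(2) by simp

text \<open>The determinant of column \<open>a\<close> of \<open>Z\<close> put in front of the
  columns in \<open>C\<close>, expanded along this first column. So written it is visibly a
  combination of the rows of \<open>Z\<close> with coefficients independent of
  \<open>a\<close>.\<close>

definition minor_vec :: "real mat \<Rightarrow> nat set \<Rightarrow> nat \<Rightarrow> real" where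
  "minor_vec Z C a = (\<Sum>r<dim_row Z. Z $$ (r, a) *
     ((-1) ^ r * det (mat (dim_row Z - 1) (dim_row Z - 1)
        (\<lambda>(i, j). Z $$ (insert_index r i, pick C j)))))"

text \<open>The sign is that of moving column \<open>a\<close> from the front to its sorted place.
  It is obtained by expanding the sorted minor along the column that comes from
  \<open>a\<close>.\<close>

lemma minor_vec_outside:
  assumes Z: "Z \<in> carrier_mat (Suc m) n" and C: "C \<subseteq> {0..<n}" "card C = m" and a: "a < n" "a \<notin> C"
  shows "minor_vec Z C a = (-1) ^ card {c \<in> C. c < a} * det (submatrix Z UNIV (insert a C))"
proof -
  let ?J = "insert a C" and ?k = "card {c \<in> C. c < a}"
  let ?A = "submatrix Z UNIV ?J"
  have fin: "finite C" using C(1) finite_subset by blast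
  have cJ: "card ?J = Suc m" using fin a C by simp
  have cols: "{j. j < n \<and> j \<in> ?J} = ?J" using C a by auto
  have A: "?A \<in> carrier_mat (Suc m) (Suc m)"
  proof (rule carrier_matI)
    show "dim_row ?A = Suc m" using Z by (simp add: dim_submatrix(1))
    show "dim_col ?A = Suc m" unfolding dim_submatrix(2) using Z cols cJ by (metis carrier_matD(2))
  qed
  have k: "?k < Suc m" using C card_mono[OF fin, of "{c \<in> C. c < a}"] by auto
  have ka: "{b \<in> ?J. b < a} = {c \<in> C. c < a}" by auto
  have idx: "?A $$ (r, j) = Z $$ (r, pick ?J j)" if "r < Suc m" "j < Suc m" for r j
      proof -
    have "r < card {i. i < dim_row Z \<and> i \<in> UNIV}" "j < card {j. j < dim_col Z \<and> j \<in> ?J}"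
      using that carrier_matD[OF A] dim_submatrix[of Z UNIV ?J] by (metis (no_types))+
    from submatrix_index[OF this] show ?thesis by (simp add: pick_UNIV)
  qed
  have pa: "pick ?J ?k = a" by (rule pick_eqI[OF insertI1]) (simp only: ka)
  \<comment> \<open>Deleting the position of \<open>a\<close> from the sorted columns leaves the
    columns of \<open>C\<close> in their order.\<close>
  have pk: "pick ?J (insert_index ?k j) = pick C j" if j: "j < m" for j
  proof (rule pick_eqI)
    let ?y = "pick C j"
    have y: "?y \<in> C" "card {c \<in> C. c < ?y} = j"
      using pick_in_set_le[of j C] card_pick_le[of j C] j C(2) by simp_all
    show "?y \<in> ?J" using y by simp
    show "card {b \<in> ?J. b < ?y} = insert_index ?k j"
    proof (cases "?y < a")
      case True
      have "{c \<in> C. c < ?y} \<subset> {c \<in> C. c < a}" using True y(1) by (intro psubsetI subsetI) (auto dest: less_trans)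
      then have "card {c \<in> C. c < ?y} < ?k" by (rule psubset_card_mono[rotated]) (simp add: fin)
      then have "j < ?k" using y(2) by linarith
      moreover have "{b \<in> ?J. b < ?y} = {c \<in> C. c < ?y}" using True by auto
      ultimately show ?thesis using y by (simp add: insert_index_def)
    next
      case False
      then have "a < ?y" using y a by (metis linorder_neqE_nat)
      then have eq: "{b \<in> ?J. b < ?y} = insert a {c \<in> C. c < ?y}" by auto
      have "{c \<in> C. c < a} \<subseteq> {c \<in> C. c < ?y}" using \<open>a < ?y\<close> by auto
      then have "?k \<le> card {c \<in> C. c < ?y}" by (rule card_mono[rotated]) (simp add: fin)
      then have "?k \<le> j" using y(2) by linarith
      then show ?thesis unfolding eq using fin a(2) y(2) by (simp add: insert_index_def)
    qed
  qed
  have md: "mat_delete ?A r ?k = mat m m (\<lambda>(i, j). Z $$ (insert_index r i, pick C j))" if r: "r < Suc m" for r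
  proof (rule eq_matI)
    fix i j assume "i < dim_row (mat m m (\<lambda>(i, j). Z $$ (insert_index r i, pick C j)))"
      "j < dim_col (mat m m (\<lambda>(i, j). Z $$ (insert_index r i, pick C j)))"
    then have ij: "i < m" "j < m" by auto
    have lt: "insert_index r i < Suc m" "insert_index ?k j < Suc m" using ij by (auto simp: insert_index_def)
    show "mat_delete ?A r ?k $$ (i, j) = mat m m (\<lambda>(i, j). Z $$ (insert_index r i, pick C j)) $$ (i, j)"
      using mat_delete_index[OF A r k ij] idx[OF lt] pk[OF ij(2)] ij by simp
  qed (use A in auto)
  have "det ?A = (\<Sum>r<Suc m. ?A $$ (r, ?k) * cofactor ?A r ?k)"
    by (rule laplace_expansion_column[OF A k])
  also have "\<dots> = (\<Sum>r<Suc m. (-1) ^ ?k * (Z $$ (r, a) *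
     ((-1) ^ r * det (mat m m (\<lambda>(i, j). Z $$ (insert_index r i, pick C j))))))"
    by (rule sum.cong) (auto simp: cofactor_def md idx k pa power_add)
  also have "\<dots> = (-1) ^ ?k * minor_vec Z C a"
    using Z by (simp add: minor_vec_def sum_distrib_left del: sum.lessThan_Suc)
  finally have "det ?A = (-1) ^ ?k * minor_vec Z C a" .
  then show ?thesis by (simp add: power_mult_distrib[symmetric] flip: mult.assoc)
qed

text \<open>The determinant in question has column \<open>a\<close> twice.\<close>

lemma minor_vec_inside:
  assumes Z: "Z \<in> carrier_mat (Suc m) n" and C: "C \<subseteq> {0..<n}" "card C = m" and a: "a \<in> C"
  shows "minor_vec Z C a = 0"
proof -
  let ?B = "mat (Suc m) (Suc m) (\<lambda>(r, j). Z $$ (r, if j = 0 then a else pick C (j - 1)))"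
  let ?k = "card {c \<in> C. c < a}"
  have fin: "finite C" using C(1) finite_subset by blast
  have B: "?B \<in> carrier_mat (Suc m) (Suc m)" by simp
  have "{c \<in> C. c < a} \<subset> C" using a by auto
  then have k: "?k < m" using psubset_card_mono[OF fin] C(2) by auto
  have "col ?B 0 = col ?B (Suc ?k)"
    using k pick_card_in_set[OF a] by (auto simp: col_def)
  then have "det ?B = 0" by (rule det_identical_cols[OF B, rotated 3]) (use k in auto)
  moreover have md: "mat_delete ?B r 0 = mat m m (\<lambda>(i, j). Z $$ (insert_index r i, pick C j))"
    if r: "r < Suc m" for r
    by (rule eq_matI) (use r in \<open>auto simp: mat_delete_def insert_index_def\<close>)
  then have "det ?B = minor_vec Z C a"
    using Z by (subst laplace_expansion_column[OF B, of 0]) (auto simp: cofactor_def minor_vec_def intro!: sum.cong)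
  ultimately show ?thesis by simp
qed

text \<open>\<open>minor_vec Z C\<close> lies in the row space of \<open>Z\<close>, to which kernel
  vectors are orthogonal.\<close>

lemma kernel_minor_vec:
  assumes Z: "Z \<in> carrier_mat m n" and w: "w \<in> carrier_vec n" "Z *\<^sub>v w = 0\<^sub>v m"
  shows "(\<Sum>a<n. w $ a * minor_vec Z C a) = 0"
proof -
  let ?M = "\<lambda>r. (-1) ^ r * det (mat (m - 1) (m - 1) (\<lambda>(i, j). Z $$ (insert_index r i, pick C j)))"
  have row: "(\<Sum>a<n. Z $$ (r, a) * w $ a) = 0" if "r < m" for r
  proof -
    have "(Z *\<^sub>v w) $ r = 0" using w(2) that by simp
    moreover have "row Z r \<bullet> w = (\<Sum>a<n. Z $$ (r, a) * w $ a)"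
      using Z w(1) that by (auto simp: scalar_prod_def lessThan_atLeast0 intro!: sum.cong)
    ultimately show ?thesis using Z that by simp
  qed
  have "(\<Sum>a<n. w $ a * minor_vec Z C a) = (\<Sum>a<n. \<Sum>r<m. ?M r * (Z $$ (r, a) * w $ a))"
    using Z by (simp add: minor_vec_def sum_distrib_left algebra_simps)
  also have "\<dots> = (\<Sum>r<m. ?M r * (\<Sum>a<n. Z $$ (r, a) * w $ a))"
    by (subst sum.swap) (simp add: sum_distrib_left)
  also have "\<dots> = 0" using row by simp
  finally show ?thesis .
qed

text \<open>In the relation of \<open>kernel_minor_vec\<close> only indices outside \<open>C\<close>
  survive, each with a positive maximal minor times a signed entry of \<open>w\<close>. The sign
  hypothesis gives all terms the same sign, so each of them vanishes.\<close>

lemma kernel_sign_pattern_exact: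
  assumes Z: "Z \<in> positive_mat (Suc m) n" and w: "w \<in> carrier_vec n" "Z *\<^sub>v w = 0\<^sub>v (Suc m)"
    and C: "C \<subseteq> {0..<n}" "card C = m"
    and sgn: "\<And>a. a < n \<Longrightarrow> a \<notin> C \<Longrightarrow> s * w $ a * (-1) ^ card {c \<in> C. c < a} \<le> 0" and s: "s \<noteq> 0"
  shows "\<And>a. a < n \<Longrightarrow> a \<notin> C \<Longrightarrow> w $ a = 0"
proof -
  have Z': "Z \<in> carrier_mat (Suc m) n"
    and pos: "\<And>J. J \<subseteq> {0..<n} \<Longrightarrow> card J = Suc m \<Longrightarrow> det (submatrix Z UNIV J) > 0"
    using Z by (auto simp: positive_mat_def)
  let ?t = "\<lambda>a. - s * w $ a * minor_vec Z C a"
  have fin: "finite C" using C(1) finite_subset by blast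
  have t: "?t a \<ge> 0 \<and> (?t a = 0 \<longrightarrow> a \<notin> C \<longrightarrow> w $ a = 0)" if a: "a < n" for a
  proof (cases "a \<in> C")
    case True
    then show ?thesis using minor_vec_inside[OF Z' C] by simp
  next
    case False
    have d: "det (submatrix Z UNIV (insert a C)) > 0"
      by (rule pos) (use C a fin False in auto)
    have "?t a = - (s * w $ a * (-1) ^ card {c \<in> C. c < a}) * det (submatrix Z UNIV (insert a C))"
      using minor_vec_outside[OF Z' C a False] by simp
    moreover have "- (s * w $ a * (-1) ^ card {c \<in> C. c < a}) * det (submatrix Z UNIV (insert a C)) \<ge> 0"
      using d sgn[OF a False] by (intro mult_nonneg_nonneg) auto
    ultimately show ?thesis using d s by auto
  qed
  have "(\<Sum>a<n. ?t a) = - s * (\<Sum>a<n. w $ a * minor_vec Z C a)" by (simp add: sum_distrib_left mult.assoc)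
  then have "(\<Sum>a<n. ?t a) = 0" using kernel_minor_vec[OF Z' w] by simp
  then have "\<forall>a\<in>{..<n}. ?t a = 0" using t by (subst (asm) sum_nonneg_eq_0_iff) auto
  then show "\<And>a. a < n \<Longrightarrow> a \<notin> C \<Longrightarrow> w $ a = 0" using t by blast
qed

text \<open>Adding the least missing index to \<open>C\<close> flips all the signs outside \<open>C\<close>, hence \<open>C\<close> may be
  enlarged to a set with \<open>m + 1\<close> elements.\<close>

lemma kernel_sign_pattern:
  assumes Z: "Z \<in> positive_mat (Suc m) n" and w: "w \<in> carrier_vec n" "Z *\<^sub>v w = 0\<^sub>v (Suc m)"
    and n: "m < n"
    and C: "C \<subseteq> {0..<n}" "card C \<le> m"
    and sgn: "\<And>a. a < n \<Longrightarrow> a \<notin> C \<Longrightarrow> s * w $ a * (-1) ^ card {c \<in> C. c < a} \<le> 0" and s: "s \<noteq> 0"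
  shows "w = 0\<^sub>v n"
  using C sgn s
proof (induction "m - card C" arbitrary: C s)
  case (Suc d)
  have fin: "finite C" using Suc.prems(1) finite_subset by blast
  have ex: "\<exists>b. b < n \<and> b \<notin> C"
  proof (rule ccontr)
    assume "\<not> ?thesis"
    then have "{0..<n} \<subseteq> C" by auto
    then have "n \<le> card C" using card_mono[OF fin, of "{0..<n}"] by simp
    then show False using Suc.prems(2) n by simp
  qed
  define b where "b = (LEAST b. b < n \<and> b \<notin> C)"
  have b: "b < n" "b \<notin> C" and least: "\<And>a. a < n \<Longrightarrow> a \<notin> C \<Longrightarrow> b \<le> a"
    using LeastI_ex[OF ex] unfolding b_def by (auto intro: Least_le)
  show ?case
  proof (rule Suc.hyps(1)[of "insert b C" "- s"])
    show "d = m - card (insert b C)" "card (insert b C) \<le> m" "insert b C \<subseteq> {0..<n}" "- s \<noteq> 0"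
      using Suc.hyps(2) Suc.prems b fin by auto
    fix a assume a: "a < n" "a \<notin> insert b C"
    then have "b < a" using least[of a] by (metis insertCI le_neq_implies_less)
    then have "{c \<in> insert b C. c < a} = insert b {c \<in> C. c < a}" by auto
    then have "card {c \<in> insert b C. c < a} = Suc (card {c \<in> C. c < a})" using fin b by simp
    then show "- s * w $ a * (-1) ^ card {c \<in> insert b C. c < a} \<le> 0" using Suc.prems(3)[of a] a by simp
  qed
next
  case 0
  then have cC: "card C = m" by simp
  have zero: "w $ a = 0" if "a < n" "a \<notin> C" for a
    using kernel_sign_pattern_exact[OF Z w 0(2) cC] 0 that by blast
  have fin: "finite C" using 0(2) finite_subset by blast
  \<comment> \<open>Now \<open>w\<close> vanishes outside \<open>C\<close>. After exchanging
    \<open>c\<close> for some \<open>b\<close> outside \<open>C\<close>, the only possibly nonzero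
    entry outside the new set is the one at \<open>c\<close>, and a suitable sign \<open>t\<close>
    satisfies the hypothesis there.\<close>
  have "w $ c = 0" if c: "c \<in> C" for c
  proof -
    have "\<exists>b. b < n \<and> b \<notin> C"
    proof (rule ccontr)
      assume "\<not> ?thesis"
      then have "{0..<n} \<subseteq> C" by auto
      then show False using card_mono[OF fin, of "{0..<n}"] cC n by simp
    qed
    then obtain b where b: "b < n" "b \<notin> C" by blast
    let ?D = "insert b (C - {c})"
    have "card C \<noteq> 0" using c fin by auto
    then have D: "?D \<subseteq> {0..<n}" "card ?D = m" using b 0(2) fin c cC
      by (auto simp: card_Diff_singleton)
    have s': "\<exists>t. t \<noteq> 0 \<and> t * w $ c * (-1) ^ card {e \<in> ?D. e < c} \<le> 0"
      by (cases "w $ c * (-1) ^ card {e \<in> ?D. e < c} \<le> 0")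
         (use exI[of _ "1::real"] exI[of _ "-1::real"] in \<open>(fastforce simp: not_le)+\<close>)
    then obtain t where t: "t \<noteq> 0" "t * w $ c * (-1) ^ card {e \<in> ?D. e < c} \<le> 0" by blast
    show ?thesis
    proof (rule kernel_sign_pattern_exact[OF Z w D _ t(1)])
      fix a assume a: "a < n" "a \<notin> ?D"
      then have "a = c \<or> a \<notin> C" by auto
      then show "t * w $ a * (-1) ^ card {e \<in> ?D. e < a} \<le> 0" using t zero a by auto
    qed (use c 0(2) b in auto)
  qed
  then show ?case using zero w by (intro eq_vecI) auto
qed

text \<open>\<open>C\<close> consists of the positions chosen by the greedy count, with indices
  starting at \<open>k\<close>. An entry that is passed over does not have the awaited sign, and
  this sign flips with every earlier choice.\<close>

lemma sign_alts_cuts: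
  "\<exists>C \<subseteq> {k..<k + length xs}. card C = sign_alts s xs \<and>
     (\<forall>a<length xs. k + a \<notin> C \<longrightarrow> s * xs ! a * (-1) ^ card {c \<in> C. c < k + a} \<le> 0)"
proof (induction xs arbitrary: s k)
  case (Cons x xs)
  define s' where "s' = (if s * x > 0 then - s else s)"
  obtain C where C: "C \<subseteq> {Suc k..<Suc k + length xs}" "card C = sign_alts s' xs"
    "\<And>a. a < length xs \<Longrightarrow> Suc k + a \<notin> C \<Longrightarrow> s' * xs ! a * (-1) ^ card {c \<in> C. c < Suc k + a} \<le> 0"
    using Cons[of "Suc k" s'] by blast
  have fin: "finite C" using C(1) finite_subset by blast
  have k: "k \<notin> C" using C(1) by auto
  show ?case
  proof (cases "s * x > 0")
    case True
    have *: "{c. (c = k \<or> c \<in> C) \<and> c \<le> k + a} = insert k {c \<in> C. c \<le> k + a}" for a using k by auto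
    show ?thesis
      by (rule exI[of _ "insert k C"]) (use C fin k True in \<open>auto simp: s'_def nth_Cons * less_Suc_eq_le split: nat.splits\<close>)
  next
    case False
    have *: "{c \<in> C. c < k} = {}" using C(1) by auto
    show ?thesis
      by (rule exI[of _ C]) (use C False in \<open>auto simp: s'_def nth_Cons * split: nat.splits\<close>)
  qed
qed auto

text \<open>The first nonzero entry is chosen for one starting sign and passed over for the other;
  from there on the two counts agree.\<close>

lemma sign_alts_nonzero:
  assumes "x \<in> set xs" "x \<noteq> 0"
  shows "\<exists>s \<in> {1, - 1}. sign_alts s xs = Suc (sign_alts (- s) xs)"
  using assms
proof (induction xs)
  case (Cons y ys)
  then show ?case by (cases "y = 0") (auto simp: neq_iff)
qed simp

text \<open>Gantmakher and Krein: nonzero kernel vectors have at least \<open>m + 1\<close> sign changes.\<close>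

lemma kernel_sign_alts:
  assumes Z: "Z \<in> positive_mat (Suc m) n" and n: "m < n"
    and w: "w \<in> carrier_vec n" "Z *\<^sub>v w = 0\<^sub>v (Suc m)" "w \<noteq> 0\<^sub>v n"
  shows "\<exists>s \<in> {1, - 1}. sign_alts s (list_of_vec w) \<ge> m + 2"
proof -
  \<comment> \<open>A count of at most \<open>m\<close> would produce a set \<open>C\<close>
    excluded by \<open>kernel_sign_pattern\<close>. This bound holds for both starting signs, and
    one of them gains a further entry; \<open>m + 2\<close> alternating entries are
    \<open>m + 1\<close> sign changes.\<close>
  have ge: "sign_alts s (list_of_vec w) \<ge> m + 1" if s: "s \<noteq> 0" for s
  proof (rule ccontr)
    assume "\<not> ?thesis"
    then have lt: "sign_alts s (list_of_vec w) \<le> m" by simp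
    obtain C where C: "C \<subseteq> {0..<n}" "card C = sign_alts s (list_of_vec w)"
      "\<And>a. a < n \<Longrightarrow> a \<notin> C \<Longrightarrow> s * w $ a * (-1) ^ card {c \<in> C. c < a} \<le> 0"
      using sign_alts_cuts[of 0 "list_of_vec w" s] w(1) by (auto simp: list_of_vec_index)
    have "w = 0\<^sub>v n" by (rule kernel_sign_pattern[OF Z w(1,2) n C(1) _ C(3) s]) (use C lt in auto)
    then show False using w(3) by simp
  qed
  have "\<exists>a<n. w $ a \<noteq> 0" using w by (metis eq_vecI carrier_vecD index_zero_vec)
  then have "\<exists>x \<in> set (list_of_vec w). x \<noteq> 0"
    using w(1) by (metis carrier_vecD vec_set_def set_list_of_vec image_eqI lessThan_iff atLeast0LessThan vec_setI)
  then obtain s where "s \<in> {1, - 1}" "sign_alts s (list_of_vec w) = Suc (sign_alts (- s) (list_of_vec w))"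
    using sign_alts_nonzero by blast
  then show ?thesis using ge[of "- s"] by (intro bexI[of _ s]) auto
qed

lemma sign_alts_chain:
  assumes "m \<le> sign_alts s xs"
  shows "\<exists>f. (\<forall>i<m. f i < length xs \<and> s * (-1) ^ i * xs ! f i > 0) \<and> (\<forall>i j. i < j \<longrightarrow> j < m \<longrightarrow> f i < (f j :: nat))"
  using assms
proof (induction xs arbitrary: m s)
  case (Cons x xs)
  show ?case
  proof (cases "s * x > 0 \<and> m > 0")
    case True
    then have "m - 1 \<le> sign_alts (- s) xs" using Cons.prems by auto
    from Cons.IH[OF this] obtain f where f: "\<forall>i<m - 1. f i < length xs \<and> - s * (-1) ^ i * xs ! f i > 0"
      "\<forall>i j. i < j \<longrightarrow> j < m - 1 \<longrightarrow> f i < f j" by blast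
    let ?g = "\<lambda>i. case i of 0 \<Rightarrow> 0 | Suc i \<Rightarrow> Suc (f i)"
    show ?thesis
      by (rule exI[of _ ?g]) (use f True in \<open>auto split: nat.splits\<close>)
  next
    case False
    then have "m \<le> sign_alts s xs" using Cons.prems by (auto split: if_splits)
    from Cons.IH[OF this] obtain f where f: "\<forall>i<m. f i < length xs \<and> s * (-1) ^ i * xs ! f i > 0"
      "\<forall>i j. i < j \<longrightarrow> j < m \<longrightarrow> f i < f j" by blast
    show ?thesis by (rule exI[of _ "\<lambda>i. Suc (f i)"]) (use f in auto)
  qed
qed simp

section \<open>Seven alternating points\<close>

text \<open>Seven points carry the six sign changes that a positive matrix with six rows forces on
  its kernel.\<close>

definition alternating :: "real set \<Rightarrow> real set \<Rightarrow> bool" where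
  "alternating P Q \<longleftrightarrow>
     (\<exists>p :: nat \<Rightarrow> real. (\<forall>i<6. p i < p (i + 1)) \<and> (\<forall>i<7. p i \<in> (if even i then P else Q)))"

definition pos_points :: "(real \<times> real) list \<Rightarrow> real set" where
  "pos_points L = {t. \<exists>c. (t, c) \<in> set L \<and> c > 0}"

definition neg_points :: "(real \<times> real) list \<Rightarrow> real set" where
  "neg_points L = {t. \<exists>c. (t, c) \<in> set L \<and> c < 0}"

lemma points_simps [simp]:
  "pos_points [] = {}" "neg_points [] = {}"
  "pos_points ((t, c) # L) = (if c > 0 then insert t (pos_points L) else pos_points L)"
  "neg_points ((t, c) # L) = (if c < 0 then insert t (neg_points L) else neg_points L)"
  by (auto simp: pos_points_def neg_points_def)

text \<open>A list may contain a point repeatedly, for instance when two planes share a point, and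
  only the total weight counts. A total of one sign still needs an entry of that sign, so
  \<open>pos_points\<close> and \<open>neg_points\<close> bound the points from above.\<close>

definition coeff_at :: "(real \<times> real) list \<Rightarrow> real \<Rightarrow> real" where
  "coeff_at L t = sum_list (map snd (filter (\<lambda>p. fst p = t) L))"

lemma coeff_at_pos: "coeff_at L t > 0 \<Longrightarrow> t \<in> pos_points L"
proof (induction L)
  case (Cons p L)
  then show ?case by (cases p; cases "snd p > 0") (auto simp: coeff_at_def split: if_splits)
qed (simp add: coeff_at_def)

lemma coeff_at_neg: "coeff_at L t < 0 \<Longrightarrow> t \<in> neg_points L"
proof (induction L)
  case (Cons p L)
  then show ?case by (cases p; cases "snd p < 0") (auto simp: coeff_at_def split: if_splits)
qed (simp add: coeff_at_def)

lemma hat_comb_coeff_at: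
  assumes "finite T" "fst ` set L \<subseteq> T"
  shows "hat_comb L a = (\<Sum>t\<in>T. coeff_at L t * hat a t)"
  using assms(2)
proof (induction L)
  case Nil
  then show ?case by (simp add: hat_comb_def coeff_at_def)
next
  case (Cons p L)
  have "(\<Sum>t\<in>T. coeff_at (p # L) t * hat a t)
      = (\<Sum>t\<in>T. (if t = fst p then snd p * hat a t else 0) + coeff_at L t * hat a t)"
    by (rule sum.cong) (auto simp: coeff_at_def algebra_simps)
  also have "\<dots> = snd p * hat a (fst p) + hat_comb L a"
    using Cons assms(1) by (simp add: sum.distrib sum.delta)
  finally show ?case by (simp add: hat_comb_def case_prod_beta)
qed

text \<open>Equal points are merged and sorted; then the alternations of the coordinates, at least
  seven by \<open>kernel_sign_alts\<close>, are bounded by those of the weights.\<close>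

theorem kernel_alternating:
  assumes Z: "Z \<in> positive_mat 6 (Suc N)" and N: "N \<ge> 5"
    and L: "\<forall>t\<in>fst ` set L. 0 \<le> t \<and> t \<le> real N"
    and ker: "Z *\<^sub>v vec (Suc N) (hat_comb L) = 0\<^sub>v 6" and nz: "vec (Suc N) (hat_comb L) \<noteq> 0\<^sub>v (Suc N)"
  shows "alternating (pos_points L) (neg_points L) \<or> alternating (neg_points L) (pos_points L)"
proof -
  let ?T = "fst ` set L" and ?ts = "sorted_list_of_set (fst ` set L)"
  let ?L = "map (\<lambda>t. (t, coeff_at L t)) ?ts"
  have same: "hat_comb L = hat_comb ?L"
  proof
    fix a
    have "hat_comb ?L a = (\<Sum>t\<leftarrow>?ts. coeff_at L t * hat a t)" by (simp add: hat_comb_def comp_def)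
    also have "\<dots> = (\<Sum>t\<in>?T. coeff_at L t * hat a t)" by (subst sum_list_distinct_conv_sum_set) auto
    finally show "hat_comb L a = hat_comb ?L a" using hat_comb_coeff_at[of ?T L a] by simp
  qed
  have Z': "Z \<in> positive_mat (Suc 5) (Suc N)" and ker': "Z *\<^sub>v vec (Suc N) (hat_comb L) = 0\<^sub>v (Suc 5)"
    using Z ker by simp_all
  obtain s where s: "s \<in> {1, -1}" and "5 + 2 \<le> sign_alts s (list_of_vec (vec (Suc N) (hat_comb L)))"
    using kernel_sign_alts[OF Z' _ _ ker' nz] N by auto
  moreover have "list_of_vec (vec (Suc N) (hat_comb L)) = map (hat_comb ?L) [0..<Suc N]"
    unfolding same by (rule nth_equalityI) (auto simp: list_of_vec_index simp del: upt_Suc)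
  moreover have "sign_alts s ([] @ map (hat_comb ?L) [0..<Suc N]) \<le> sign_alts s ([] @ map snd ?L)"
    by (rule sign_alts_hat_comb) (use L in \<open>auto simp: comp_def\<close>)
  ultimately have "7 \<le> sign_alts s (map (coeff_at L) ?ts)"
    by (simp add: comp_def del: upt_Suc map_eq_conv)
  from sign_alts_chain[OF this] obtain f
    where f0: "\<forall>i<7. f i < length (map (coeff_at L) ?ts) \<and> s * (-1) ^ i * map (coeff_at L) ?ts ! f i > 0"
      and inc: "\<forall>i j. i < j \<longrightarrow> j < 7 \<longrightarrow> f i < f j" by blast
  from f0 have "\<forall>i<7. f i < length ?ts \<and> s * (-1) ^ i * coeff_at L (?ts ! f i) > 0"
    by (metis length_map nth_map)
  note f = this inc
  define p where "p i = ?ts ! f i" for i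
  have "p i < p (i + 1)" if "i < 6" for i
    using f that sorted_wrt_nth_less[OF strict_sorted_list_of_set, of "f i" "f (Suc i)" ?T]
    by (auto simp: p_def)
  moreover have "s * (-1) ^ i * coeff_at L (p i) > 0" if "i < 7" for i
    using f that by (simp add: p_def)
  then have "p i \<in> (if even i = (s = 1) then pos_points L else neg_points L)" if "i < 7" for i
    using that s coeff_at_pos[of L "p i"] coeff_at_neg[of L "p i"] by (fastforce split: if_splits)
  ultimately have *: "\<forall>i<6. p i < p (i + 1)"
    "\<forall>i<7. p i \<in> (if even i = (s = 1) then pos_points L else neg_points L)" by blast+
  show ?thesis
  proof (cases "s = 1")
    case True
    then have "alternating (pos_points L) (neg_points L)" using * unfolding alternating_def by (intro exI[of _ p]) simp
    then show ?thesis ..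
  next
    case False
    then have "alternating (neg_points L) (pos_points L)" using * unfolding alternating_def by (intro exI[of _ p]) auto
    then show ?thesis ..
  qed
qed

lemma alternatingE:
  assumes "alternating P Q"
  obtains p0 p1 p2 p3 p4 p5 p6 where "p0 < p1" "p1 < p2" "p2 < p3" "p3 < p4" "p4 < p5" "p5 < p6"
    "p0 \<in> P" "p1 \<in> Q" "p2 \<in> P" "p3 \<in> Q" "p4 \<in> P" "p5 \<in> Q" "p6 \<in> P"
proof -
  obtain p :: "nat \<Rightarrow> real" where "\<And>i. i < 6 \<Longrightarrow> p i < p (i + 1)"
    "\<And>i. i < 7 \<Longrightarrow> p i \<in> (if even i then P else Q)"
    using assms by (auto simp: alternating_def)
  from this(1)[of 0] this(1)[of 1] this(1)[of 2] this(1)[of 3] this(1)[of 4] this(1)[of 5]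
    this(2)[of 0] this(2)[of 1] this(2)[of 2] this(2)[of 3] this(2)[of 4] this(2)[of 5] this(2)[of 6]
  show ?thesis by (intro that[of "p 0" "p 1" "p 2" "p 3" "p 4" "p 5" "p 6"]) (simp_all del: One_nat_def add: even_numeral)
qed

text \<open>Starting in \<open>P\<close> would take four points of \<open>P\<close>. Starting in
  \<open>Q\<close> takes three, hence all of \<open>a\<close>, \<open>b\<close>, \<open>z\<close>,
  and then a point of \<open>Q\<close> beyond \<open>z\<close>. In the applications \<open>z\<close>
  is the last coordinate.\<close>

lemma not_alternating_few:
  assumes "alternating P Q \<or> alternating Q P" "P \<subseteq> {a, b, z}" "Q \<subseteq> {..z}"
  shows False
  using assms(1)
proof
  assume "alternating P Q"
  then obtain p0 p1 p2 p3 p4 p5 p6 where p: "p0 < p1" "p1 < p2" "p2 < p3" "p3 < p4" "p4 < p5" "p5 < p6"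
    "p0 \<in> P" "p2 \<in> P" "p4 \<in> P" "p6 \<in> P" by (rule alternatingE)
  then have "p0 \<in> {a, b, z}" "p2 \<in> {a, b, z}" "p4 \<in> {a, b, z}" "p6 \<in> {a, b, z}" using assms(2) by auto
  then show False using p(1-6) by auto
next
  assume "alternating Q P"
  then obtain p0 p1 p2 p3 p4 p5 p6 where p: "p0 < p1" "p1 < p2" "p2 < p3" "p3 < p4" "p4 < p5" "p5 < p6"
    "p1 \<in> P" "p3 \<in> P" "p5 \<in> P" "p6 \<in> Q" by (rule alternatingE)
  then have "p1 \<in> {a, b, z}" "p3 \<in> {a, b, z}" "p5 \<in> {a, b, z}" "p6 \<le> z" using assms(2,3) by auto
  then show False using p(1-6) by auto
qed

lemma alternating_three:
  assumes "alternating P Q \<or> alternating Q P" "P \<subseteq> {a, b, c}"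
  obtains x0 y0 x1 y1 x2 y2 x3 where "x0 < y0" "y0 < x1" "x1 < y1" "y1 < x2" "x2 < y2" "y2 < x3"
    "x0 \<in> Q" "x1 \<in> Q" "x2 \<in> Q" "x3 \<in> Q" "y0 \<in> {a, b, c}" "y1 \<in> {a, b, c}" "y2 \<in> {a, b, c}"
  using assms(1)
proof
  assume "alternating P Q"
  then obtain p0 p1 p2 p3 p4 p5 p6 where p: "p0 < p1" "p1 < p2" "p2 < p3" "p3 < p4" "p4 < p5" "p5 < p6"
    "p0 \<in> P" "p2 \<in> P" "p4 \<in> P" "p6 \<in> P" by (rule alternatingE)
  then have "p0 \<in> {a, b, c}" "p2 \<in> {a, b, c}" "p4 \<in> {a, b, c}" "p6 \<in> {a, b, c}" using assms(2) by auto
  then have False using p(1-6) by auto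
  then show ?thesis ..
next
  assume "alternating Q P"
  then obtain p0 p1 p2 p3 p4 p5 p6 where p: "p0 < p1" "p1 < p2" "p2 < p3" "p3 < p4" "p4 < p5" "p5 < p6"
    "p0 \<in> Q" "p2 \<in> Q" "p4 \<in> Q" "p6 \<in> Q" "p1 \<in> P" "p3 \<in> P" "p5 \<in> P" by (rule alternatingE)
  then have "p1 \<in> {a, b, c}" "p3 \<in> {a, b, c}" "p5 \<in> {a, b, c}" using assms(2) by auto
  then show ?thesis using that p by metis
qed

lemma alternating_three_first:
  assumes "alternating P Q \<or> alternating Q P" "P \<subseteq> {a, b, c}"
  obtains x where "x \<in> Q" "x < a" "x < b" "x < c"
proof -
  obtain x0 y0 x1 y1 x2 y2 x3 where "x0 < y0" "y0 < x1" "x1 < y1" "y1 < x2" "x2 < y2" "y2 < x3"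
    "x0 \<in> Q" "x1 \<in> Q" "x2 \<in> Q" "x3 \<in> Q" "y0 \<in> {a, b, c}" "y1 \<in> {a, b, c}" "y2 \<in> {a, b, c}"
    using alternating_three[OF assms] .
  then have "x0 < a \<and> x0 < b \<and> x0 < c" by auto
  then show ?thesis using that \<open>x0 \<in> Q\<close> by blast
qed

lemma alternating_three_between:
  assumes "alternating P Q \<or> alternating Q P" "P \<subseteq> {a, b, c}" "b < c"
  obtains x where "x \<in> Q" "b < x" "x < c"
proof -
  obtain x0 y0 x1 y1 x2 y2 x3 where x: "x0 < y0" "y0 < x1" "x1 < y1" "y1 < x2" "x2 < y2" "y2 < x3"
    "x0 \<in> Q" "x1 \<in> Q" "x2 \<in> Q" "x3 \<in> Q" "y0 \<in> {a, b, c}" "y1 \<in> {a, b, c}" "y2 \<in> {a, b, c}"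
    using alternating_three[OF assms(1,2)] .
  then have "b < x1 \<and> x1 < c \<or> b < x2 \<and> x2 < c" using assms(3) by auto
  then show ?thesis using that x by blast
qed

lemma mem_points [simp]:
  "t \<in> pos_points ((t', c) # L) \<longleftrightarrow> t = t' \<and> c > 0 \<or> t \<in> pos_points L"
  "t \<in> neg_points ((t', c) # L) \<longleftrightarrow> t = t' \<and> c < 0 \<or> t \<in> neg_points L"
  by (auto simp: pos_points_def neg_points_def)

section \<open>Planes and their two normal forms\<close>

definition plane :: "nat \<Rightarrow> (nat \<Rightarrow> real) \<Rightarrow> (nat \<Rightarrow> real) \<Rightarrow> real vec set" where
  "plane N f g = {vec (Suc N) (\<lambda>a. \<alpha> * f a + \<beta> * g a) | \<alpha> \<beta>. True}"

lemma plane_memI: "(\<And>a. a \<le> N \<Longrightarrow> h a = \<alpha> * f a + \<beta> * g a) \<Longrightarrow> vec (Suc N) h \<in> plane N f g"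
  unfolding plane_def by (intro CollectI exI[of _ \<alpha>] exI[of _ \<beta>]) (auto intro!: eq_vecI)

lemma plane_memD:
  assumes "vec (Suc N) h \<in> plane N f g"
  obtains \<alpha> \<beta> where "\<And>a. a \<le> N \<Longrightarrow> h a = \<alpha> * f a + \<beta> * g a"
proof -
  from assms obtain \<alpha> \<beta> where eq: "vec (Suc N) h = vec (Suc N) (\<lambda>a. \<alpha> * f a + \<beta> * g a)"
    unfolding plane_def by auto
  have "h a = \<alpha> * f a + \<beta> * g a" if "a \<le> N" for a
    using arg_cong[OF eq, of "\<lambda>v. v $ a"] that by simp
  then show ?thesis by (rule that)
qed

lemma plane_subset:
  assumes "vec (Suc N) f \<in> plane N f' g'" "vec (Suc N) g \<in> plane N f' g'"
  shows "plane N f g \<subseteq> plane N f' g'"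
proof
  fix v assume "v \<in> plane N f g"
  then obtain \<alpha> \<beta> where v: "v = vec (Suc N) (\<lambda>a. \<alpha> * f a + \<beta> * g a)" unfolding plane_def by auto
  obtain a1 b1 where f: "\<And>a. a \<le> N \<Longrightarrow> f a = a1 * f' a + b1 * g' a" by (rule plane_memD[OF assms(1)]) blast
  obtain a2 b2 where g: "\<And>a. a \<le> N \<Longrightarrow> g a = a2 * f' a + b2 * g' a" by (rule plane_memD[OF assms(2)]) blast
  show "v \<in> plane N f' g'" unfolding v
    by (rule plane_memI[of _ _ "\<alpha> * a1 + \<beta> * a2" _ "\<alpha> * b1 + \<beta> * b2"]) (simp add: f g algebra_simps)
qed

lemma hat_between:
  assumes "real i < t" "t < real i + 1"
  shows "hat i t = real i + 1 - t" "hat (Suc i) t = t - real i" "a \<noteq> i \<Longrightarrow> a \<noteq> Suc i \<Longrightarrow> hat a t = 0"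
proof -
  show "a \<noteq> i \<Longrightarrow> a \<noteq> Suc i \<Longrightarrow> hat a t = 0"
  proof -
    assume "a \<noteq> i" "a \<noteq> Suc i"
    then consider "a + 1 \<le> i" | "i + 2 \<le> a" by linarith
    then have "real a + 1 \<le> real i \<or> real i + 2 \<le> real a" by cases linarith+
    then show ?thesis using assms by (auto simp: hat_def)
  qed
qed (use assms in \<open>auto simp: hat_def\<close>)

lemma hat_nat: "hat a (real b) = (if a = b then 1 else 0)"
proof -
  have "\<bar>real b - real a\<bar> \<ge> 1" if "a \<noteq> b" using that by linarith
  then show ?thesis by (auto simp: hat_def)
qed

lemma hat_comb_simps: "hat_comb [] a = 0" "hat_comb ((t, c) # L) a = c * hat a t + hat_comb L a"
  by (simp_all add: hat_comb_def)

text \<open>\<open>M\<close> encodes the difference of the two vectors, a nonzero vector in the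
  kernel of \<open>Z\<close>.\<close>

lemma same_image_alternating:
  assumes Z: "Z \<in> positive_mat 6 (Suc N)" "N \<ge> 5"
    and eq: "Z *\<^sub>v vec (Suc N) f = Z *\<^sub>v vec (Suc N) g"
    and ne: "vec (Suc N) f \<noteq> vec (Suc N) g"
    and M: "\<And>a. hat_comb M a = f a - g a" "\<forall>t\<in>fst ` set M. 0 \<le> t \<and> t \<le> real N"
  shows "alternating (pos_points M) (neg_points M) \<or> alternating (neg_points M) (pos_points M)"
proof (rule kernel_alternating[OF Z M(2)])
  have Zc: "Z \<in> carrier_mat 6 (Suc N)" using Z by (simp add: positive_mat_def)
  have diff: "vec (Suc N) (hat_comb M) = vec (Suc N) f - vec (Suc N) g"
    by (rule eq_vecI) (simp_all add: M)
  show "Z *\<^sub>v vec (Suc N) (hat_comb M) = 0\<^sub>v 6"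
    unfolding diff using eq Zc by (subst mult_minus_distrib_mat_vec[OF Zc]) auto
  show "vec (Suc N) (hat_comb M) \<noteq> 0\<^sub>v (Suc N)"
  proof
    assume "vec (Suc N) (hat_comb M) = 0\<^sub>v (Suc N)"
    then have "vec (Suc N) (hat_comb M) $ a = 0" if "a < Suc N" for a using that by simp
    then have "f a = g a" if "a < Suc N" for a using that by (simp add: M)
    then show False using ne by (auto intro: eq_vecI)
  qed
qed

text \<open>Normal form for two chords side by side: one generator has its dominoes at the ends of
  the first chord, the other at the ends of the second. The last coordinate enters them with
  opposite signs and may vanish. \<open>t23\<close> orders the two inner dominoes also when
  \<open>j = k\<close>, where they occupy the same two coordinates.\<close>

locale form_S =
  fixes N i j k l :: nat and t1 t2 t3 t4 a1 a2 a3 b1 b2 b3 :: real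
  assumes idx: "i + 2 \<le> j" "j \<le> k" "k + 2 \<le> l" "l + 1 < N"
    and t1: "real i < t1" "t1 < real i + 1" and t2: "real j < t2" "t2 < real j + 1"
    and t3: "real k < t3" "t3 < real k + 1" and t4: "real l < t4" "t4 < real l + 1"
    and t23: "t2 < t3"
    and pos: "a1 > 0" "a2 > 0" "a3 \<ge> 0" "b1 > 0" "b2 > 0" "b3 \<ge> 0"
begin

definition comb :: "real \<Rightarrow> real \<Rightarrow> (real \<times> real) list" where
  "comb \<alpha> \<beta> = [(t1, \<alpha> * a1), (t2, \<alpha> * a2), (t3, \<beta> * b1), (t4, \<beta> * b2), (real N, \<beta> * b3 - \<alpha> * a3)]"

definition space :: "real vec set" where
  "space = plane N (hat_comb (comb 1 0)) (hat_comb (comb 0 1))"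

lemma hat_comb_comb: "hat_comb (comb \<alpha> \<beta>) a = \<alpha> * hat_comb (comb 1 0) a + \<beta> * hat_comb (comb 0 1) a"
  by (simp add: comb_def hat_comb_simps algebra_simps)

lemma space_eq: "space = {vec (Suc N) (hat_comb (comb \<alpha> \<beta>)) | \<alpha> \<beta>. True}"
  proof -
  have "vec (Suc N) (hat_comb (comb \<alpha> \<beta>))
      = vec (Suc N) (\<lambda>a. \<alpha> * hat_comb (comb 1 0) a + \<beta> * hat_comb (comb 0 1) a)" for \<alpha> \<beta>
    by (rule arg_cong[where f = "vec (Suc N)"], rule ext, rule hat_comb_comb)
  then show ?thesis unfolding space_def plane_def by (simp only:)
qed

lemma order: "0 < t1" "t1 < t2" "t2 < t3" "t3 < t4" "t4 < real N"
  using t1 t2 t3 t4 t23 idx by linarith+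

lemma range: "\<forall>t\<in>fst ` set (comb \<alpha> \<beta>). 0 \<le> t \<and> t \<le> real N"
  using order by (auto simp: comb_def)

end

text \<open>Normal form for nested chords, \<open>(i, j)\<close> being the outer one. The first
  generator is positive at the domino \<open>t1\<close> and negative at the domino \<open>t4\<close>
  and the last coordinate. The second is positive at \<open>t1\<close>, \<open>t2\<close>,
  \<open>t3\<close>; the shared point \<open>t1\<close> makes it the harder one to recover.\<close>

locale form_N =
  fixes N i j k l :: nat and t1 t2 t3 t4 a1 a2 a3 b1 b2 b3 :: real
  assumes idx: "i < k" "k + 2 \<le> l" "l \<le> j" "j + 1 < N"
    and t1: "real i < t1" "t1 < real i + 1" and t2: "real k < t2" "t2 < real k + 1"
    and t3: "real l < t3" "t3 < real l + 1" and t4: "real j < t4" "t4 < real j + 1"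
    and t34: "t3 < t4"
    and pos: "a1 > 0" "a2 > 0" "a3 > 0" "b1 > 0" "b2 > 0" "b3 > 0"
begin

definition comb :: "real \<Rightarrow> real \<Rightarrow> (real \<times> real) list" where
  "comb \<alpha> \<beta> = [(t1, \<alpha> * a1 + \<beta> * b1), (t2, \<beta> * b2), (t3, \<beta> * b3), (t4, - \<alpha> * a2), (real N, - \<alpha> * a3)]"

definition space :: "real vec set" where
  "space = plane N (hat_comb (comb 1 0)) (hat_comb (comb 0 1))"

lemma hat_comb_comb: "hat_comb (comb \<alpha> \<beta>) a = \<alpha> * hat_comb (comb 1 0) a + \<beta> * hat_comb (comb 0 1) a"
  by (simp add: comb_def hat_comb_simps algebra_simps)

lemma space_eq: "space = {vec (Suc N) (hat_comb (comb \<alpha> \<beta>)) | \<alpha> \<beta>. True}"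
  proof -
  have "vec (Suc N) (hat_comb (comb \<alpha> \<beta>))
      = vec (Suc N) (\<lambda>a. \<alpha> * hat_comb (comb 1 0) a + \<beta> * hat_comb (comb 0 1) a)" for \<alpha> \<beta>
    by (rule arg_cong[where f = "vec (Suc N)"], rule ext, rule hat_comb_comb)
  then show ?thesis unfolding space_def plane_def by (simp only:)
qed

lemma order: "0 < t1" "t1 < t2" "t2 < t3" "t3 < t4" "t4 < real N"
  using t1 t2 t3 t4 t34 idx by linarith+

lemma range: "\<forall>t\<in>fst ` set (comb \<alpha> \<beta>). 0 \<le> t \<and> t \<le> real N"
  using order by (auto simp: comb_def)

end

section \<open>Generators of planes with equal image\<close>

lemmas sign_simps = zero_less_mult_iff mult_less_0_iff

text \<open>For each combination of signs of \<open>\<alpha>\<close> and \<open>\<beta>\<close>, the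
  difference has one sign confined to at most two points and the last coordinate, against
  \<open>not_alternating_few\<close>.\<close>

lemma S_S_generator:
  assumes "form_S N i j k l t1 t2 t3 t4 a1 a2 a3 b1 b2 b3"
    and "form_S N i' j' k' l' s1 s2 s3 s4 c1 c2 c3 d1 d2 d3"
    and Z: "Z \<in> positive_mat 6 (Suc N)" "N \<ge> 5"
    and xy: "(x = 1 \<and> y = 0) \<or> (x = 0 \<and> y = 1)"
    and eq: "Z *\<^sub>v vec (Suc N) (hat_comb (form_S.comb N t1 t2 t3 t4 a1 a2 a3 b1 b2 b3 x y)) =
      Z *\<^sub>v vec (Suc N) (hat_comb (form_S.comb N s1 s2 s3 s4 c1 c2 c3 d1 d2 d3 \<alpha> \<beta>))"
  shows "vec (Suc N) (hat_comb (form_S.comb N t1 t2 t3 t4 a1 a2 a3 b1 b2 b3 x y)) =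
      vec (Suc N) (hat_comb (form_S.comb N s1 s2 s3 s4 c1 c2 c3 d1 d2 d3 \<alpha> \<beta>))"
proof (rule ccontr)
  interpret V: form_S N i j k l t1 t2 t3 t4 a1 a2 a3 b1 b2 b3 by fact
  interpret W: form_S N i' j' k' l' s1 s2 s3 s4 c1 c2 c3 d1 d2 d3 by fact
  assume ne: "\<not> ?thesis"
  define M where "M = [(t1, x * a1), (t2, x * a2), (t3, y * b1), (t4, y * b2),
    (s1, - (\<alpha> * c1)), (s2, - (\<alpha> * c2)), (s3, - (\<beta> * d1)), (s4, - (\<beta> * d2)),
    (real N, (y * b3 - x * a3) - (\<beta> * d3 - \<alpha> * c3))]"
  have alt: "alternating (pos_points M) (neg_points M) \<or> alternating (neg_points M) (pos_points M)"
    by (rule same_image_alternating[OF Z eq ne])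
      (use V.order W.order in \<open>auto simp: M_def V.comb_def W.comb_def hat_comb_simps algebra_simps\<close>)
  have le: "pos_points M \<subseteq> {..real N}" "neg_points M \<subseteq> {..real N}"
    using V.order W.order unfolding M_def by (auto simp: pos_points_def neg_points_def)
  note few = not_alternating_few[OF alt _ le(2)] not_alternating_few[OF alt[THEN disj_commute[THEN iffD1]] _ le(1)]
  consider "\<alpha> \<ge> 0" "\<beta> \<ge> 0" | "\<alpha> \<le> 0" "\<beta> \<le> 0" | "\<alpha> > 0" "\<beta> < 0" | "\<alpha> < 0" "\<beta> > 0" by linarith
  then show False
  proof cases
    case 1
    show ?thesis
    proof (cases "x = 1")
      case True
      have "pos_points M \<subseteq> {t1, t2, real N}" using 1 True xy V.pos W.pos
        by (auto simp: M_def sign_simps)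
      then show ?thesis by (rule few)
    next
      case False
      have "pos_points M \<subseteq> {t3, t4, real N}" using 1 False xy V.pos W.pos
        by (auto simp: M_def sign_simps)
      then show ?thesis by (rule few)
    qed
  next
    case 2
    have "neg_points M \<subseteq> {real N, real N, real N}" using 2 xy V.pos W.pos
      by (auto simp: M_def sign_simps)
    then show ?thesis by (rule few)
  next
    case 3
    have "neg_points M \<subseteq> {s1, s2, real N}" using 3 xy V.pos W.pos
      by (auto simp: M_def sign_simps)
    then show ?thesis by (rule few)
  next
    case 4
    have "neg_points M \<subseteq> {s3, s4, real N}" using 4 xy V.pos W.pos
      by (auto simp: M_def sign_simps)
    then show ?thesis by (rule few)
  qed
qed

text \<open>For the first generator the count of \<open>S_S_generator\<close> goes through. For the
  second, one sign can occupy three points without the last coordinate; a point of the other sign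
  must then precede all three, which \<open>t1 = s1\<close> excludes.\<close>

lemma N_N_generators:
  assumes "form_N N i j k l t1 t2 t3 t4 a1 a2 a3 b1 b2 b3"
    and "form_N N i' j' k' l' s1 s2 s3 s4 c1 c2 c3 d1 d2 d3"
    and Z: "Z \<in> positive_mat 6 (Suc N)" "N \<ge> 5"
    and xy: "(x = 1 \<and> y = 0) \<or> (x = 0 \<and> y = 1 \<and> t1 = s1)"
    and eq: "Z *\<^sub>v vec (Suc N) (hat_comb (form_N.comb N t1 t2 t3 t4 a1 a2 a3 b1 b2 b3 x y)) =
      Z *\<^sub>v vec (Suc N) (hat_comb (form_N.comb N s1 s2 s3 s4 c1 c2 c3 d1 d2 d3 \<alpha> \<beta>))"
  shows "vec (Suc N) (hat_comb (form_N.comb N t1 t2 t3 t4 a1 a2 a3 b1 b2 b3 x y)) =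
      vec (Suc N) (hat_comb (form_N.comb N s1 s2 s3 s4 c1 c2 c3 d1 d2 d3 \<alpha> \<beta>))"
proof (rule ccontr)
  interpret V: form_N N i j k l t1 t2 t3 t4 a1 a2 a3 b1 b2 b3 by fact
  interpret W: form_N N i' j' k' l' s1 s2 s3 s4 c1 c2 c3 d1 d2 d3 by fact
  assume ne: "\<not> ?thesis"
  define M where "M = [(t1, x * a1 + y * b1), (t2, y * b2), (t3, y * b3), (t4, - (x * a2)),
    (s1, - (\<alpha> * c1 + \<beta> * d1)), (s2, - (\<beta> * d2)), (s3, - (\<beta> * d3)), (s4, \<alpha> * c2),
    (real N, \<alpha> * c3 - x * a3)]"
  have alt: "alternating (pos_points M) (neg_points M) \<or> alternating (neg_points M) (pos_points M)"
    by (rule same_image_alternating[OF Z eq ne])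
      (use V.order W.order in \<open>auto simp: M_def V.comb_def W.comb_def hat_comb_simps algebra_simps\<close>)
  note alt' = alt[THEN disj_commute[THEN iffD1]]
  have le: "pos_points M \<subseteq> {..real N}" "neg_points M \<subseteq> {..real N}"
    using V.order W.order unfolding M_def by (auto simp: pos_points_def neg_points_def)
  note few = not_alternating_few[OF alt _ le(2)] not_alternating_few[OF alt' _ le(1)]
  define I where "I = \<alpha> * c1 + \<beta> * d1"
  consider "\<beta> > 0" "\<alpha> \<ge> 0" | "\<beta> > 0" "\<alpha> < 0" | "\<beta> \<le> 0" "\<alpha> \<ge> 0" | "\<beta> \<le> 0" "\<alpha> < 0" by linarith
  then show False
  proof cases
    case 1
    then have I: "I > 0" using W.pos by (simp add: I_def add_nonneg_pos)
    show ?thesis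
    proof (cases "x = 1")
      case True
      have "pos_points M \<subseteq> {t1, s4, real N}" using 1 True xy V.pos W.pos I
        by (auto simp: M_def sign_simps I_def[symmetric])
      then show ?thesis by (rule few)
    next
      case False
      then have *: "x = 0" "y = 1" "t1 = s1" using xy by auto
      have "neg_points M \<subseteq> {s1, s2, s3}" using 1 * V.pos W.pos I
        by (auto simp: M_def sign_simps I_def[symmetric])
      then obtain x0 where "x0 \<in> pos_points M" "x0 < s1" "x0 < s2" "x0 < s3"
        by (rule alternating_three_first[OF alt'])
      moreover have "pos_points M \<subseteq> {s1..}" using V.order W.order *
        by (auto simp: M_def)
      ultimately show ?thesis by auto
    qed
  next
    case 2
    show ?thesis
    proof (cases "x = 1")
      case True
      have "pos_points M \<subseteq> {t1, s1, real N}" using 2 True xy V.pos W.pos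
        by (auto simp: M_def sign_simps)
      then show ?thesis by (rule few)
    next
      case False
      then have *: "x = 0" "y = 1" "t1 = s1" using xy by auto
      have "pos_points M \<subseteq> {t1, t2, t3}" using 2 * V.pos W.pos
        by (auto simp: M_def sign_simps)
      then obtain x0 where "x0 \<in> neg_points M" "x0 < t1" "x0 < t2" "x0 < t3"
        by (rule alternating_three_first[OF alt])
      moreover have "neg_points M \<subseteq> {t1..}" using V.order W.order *
        by (auto simp: M_def)
      ultimately show ?thesis by auto
    qed
  next
    case 3
    have "neg_points M \<subseteq> {t4, s1, real N}" using 3 xy V.pos W.pos
      by (auto simp: M_def sign_simps)
    then show ?thesis by (rule few)
  next
    case 4
    then have I: "I < 0" using W.pos by (simp add: I_def mult_neg_pos mult_nonpos_nonneg add_neg_nonpos)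
    have "neg_points M \<subseteq> {t4, s4, real N}" using 4 xy V.pos W.pos I
      by (auto simp: M_def sign_simps I_def[symmetric])
    then show ?thesis by (rule few)
  qed
qed


text \<open>If the first generator is not recovered exactly, the leftmost points of the two forms
  come in the order opposite to the one in \<open>N_S_generator\<close>. The conflict is exploited
  in \<open>form_S_N_images\<close>.\<close>

lemma S_N_generator_u:
  assumes "form_S N i j k l s1 s2 s3 s4 a1 a2 a3 b1 b2 b3"
    and "form_N N i' j' k' l' t1 t2 t3 t4 c1 c2 c3 d1 d2 d3"
    and Z: "Z \<in> positive_mat 6 (Suc N)" "N \<ge> 5"
    and eq: "Z *\<^sub>v vec (Suc N) (hat_comb (form_S.comb N s1 s2 s3 s4 a1 a2 a3 b1 b2 b3 1 0)) =
      Z *\<^sub>v vec (Suc N) (hat_comb (form_N.comb N t1 t2 t3 t4 c1 c2 c3 d1 d2 d3 \<alpha> \<beta>))"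
    and ne: "vec (Suc N) (hat_comb (form_S.comb N s1 s2 s3 s4 a1 a2 a3 b1 b2 b3 1 0)) \<noteq>
      vec (Suc N) (hat_comb (form_N.comb N t1 t2 t3 t4 c1 c2 c3 d1 d2 d3 \<alpha> \<beta>))"
  shows "t1 < s1"
proof -
  interpret V: form_S N i j k l s1 s2 s3 s4 a1 a2 a3 b1 b2 b3 by fact
  interpret W: form_N N i' j' k' l' t1 t2 t3 t4 c1 c2 c3 d1 d2 d3 by fact
  define I E where "I = \<alpha> * c1 + \<beta> * d1" and "E = \<alpha> * c3 - a3"
  define M where "M = [(s1, a1), (s2, a2), (t1, - I), (t2, - (\<beta> * d2)), (t3, - (\<beta> * d3)), (t4, \<alpha> * c2), (real N, E)]"
  have alt: "alternating (pos_points M) (neg_points M) \<or> alternating (neg_points M) (pos_points M)"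
    by (rule same_image_alternating[OF Z eq ne])
      (use V.order W.order in \<open>auto simp: M_def I_def E_def V.comb_def W.comb_def hat_comb_simps algebra_simps\<close>)
  note alt' = alt[THEN disj_commute[THEN iffD1]]
  have le: "pos_points M \<subseteq> {..real N}" "neg_points M \<subseteq> {..real N}"
    using V.order W.order unfolding M_def by (auto simp: pos_points_def neg_points_def)
  note few = not_alternating_few[OF alt _ le(2)] not_alternating_few[OF alt' _ le(1)]
  consider "\<beta> > 0" "\<alpha> > 0" | "\<beta> > 0" "\<alpha> \<le> 0" | "\<beta> \<le> 0" "\<alpha> \<ge> 0" | "\<beta> \<le> 0" "\<alpha> < 0" by linarith
  then show ?thesis
  proof cases
    case 1
    then have I: "I > 0" using W.pos by (simp add: I_def add_nonneg_pos)
    show ?thesis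
    proof (cases "E > 0")
      case True
      have N3: "neg_points M \<subseteq> {t1, t2, t3}" and P4: "pos_points M \<subseteq> {s1, s2, t4, real N}"
        using 1 True V.pos W.pos I by (auto simp: M_def sign_simps)
      obtain x0 y0 x1 y1 x2 y2 x3 where
        x: "x0 < y0" "y0 < x1" "x1 < y1" "y1 < x2" "x2 < y2" "y2 < x3" "x0 \<in> pos_points M" "x1 \<in> pos_points M"
        "x2 \<in> pos_points M" "x3 \<in> pos_points M" and y: "y0 \<in> {t1, t2, t3}" "y1 \<in> {t1, t2, t3}" "y2 \<in> {t1, t2, t3}"
        using alternating_three[OF alt' N3] .
      \<comment> \<open>The three points before \<open>y2\<close> lie left of \<open>t3\<close>,
        hence left of \<open>t4\<close> and of the last coordinate; only \<open>s1\<close> and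
        \<open>s2\<close> are left for them.\<close>
      have "y2 \<le> t3" using y W.order by auto
      then have "{x0, x1, x2} \<subseteq> {s1, s2}" using x P4 W.order by auto
      then show ?thesis using x by auto
    next
      case False
      have P3: "pos_points M \<subseteq> {s1, s2, t4}" and N4: "neg_points M \<subseteq> {t1..}"
        using 1 False V.pos W.pos W.order I by (auto simp: M_def sign_simps)
      obtain x0 where "x0 \<in> neg_points M" "x0 < s1" "x0 < s2" "x0 < t4"
        using alternating_three_first[OF alt P3] .
      then show ?thesis using N4 by auto
    qed
  next
    case 2
    then have E: "E \<le> 0" using V.pos W.pos mult_nonpos_nonneg[of \<alpha> c3] by (simp add: E_def)
    show ?thesis
    proof (cases "I \<ge> 0")
      case True
      have "pos_points M \<subseteq> {s1, s2, real N}" using 2 True E V.pos W.pos by (auto simp: M_def sign_simps)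
      then show ?thesis by (rule few(1)[THEN FalseE])
    next
      case False
      have P3: "pos_points M \<subseteq> {s1, s2, t1}" and N4: "neg_points M \<subseteq> {t2..}"
        using 2 E False V.pos W.pos W.order by (auto simp: M_def sign_simps)
      obtain x0 where "x0 \<in> neg_points M" "x0 < s1" "x0 < s2" "x0 < t1"
        using alternating_three_first[OF alt P3] .
      then show ?thesis using N4 W.order by auto
    qed
  next
    case 3
    have "neg_points M \<subseteq> {t1, t1, real N}" using 3 V.pos W.pos by (auto simp: M_def sign_simps)
    then show ?thesis by (rule few(2)[THEN FalseE])
  next
    case 4
    then have I: "I < 0" using W.pos by (simp add: I_def mult_neg_pos mult_nonpos_nonneg add_neg_nonpos)
    have "neg_points M \<subseteq> {t4, t4, real N}" using 4 I V.pos W.pos by (auto simp: M_def sign_simps)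
    then show ?thesis by (rule few(2)[THEN FalseE])
  qed
qed

text \<open>The counterpart of \<open>S_N_generator_u\<close> at the right end, again with the order
  opposite to the one in \<open>N_S_generator\<close>.\<close>

lemma S_N_generator_w:
  assumes "form_S N i j k l s1 s2 s3 s4 a1 a2 a3 b1 b2 b3"
    and "form_N N i' j' k' l' t1 t2 t3 t4 c1 c2 c3 d1 d2 d3"
    and Z: "Z \<in> positive_mat 6 (Suc N)" "N \<ge> 5"
    and eq: "Z *\<^sub>v vec (Suc N) (hat_comb (form_S.comb N s1 s2 s3 s4 a1 a2 a3 b1 b2 b3 0 1)) =
      Z *\<^sub>v vec (Suc N) (hat_comb (form_N.comb N t1 t2 t3 t4 c1 c2 c3 d1 d2 d3 \<alpha> \<beta>))"
    and ne: "vec (Suc N) (hat_comb (form_S.comb N s1 s2 s3 s4 a1 a2 a3 b1 b2 b3 0 1)) \<noteq>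
      vec (Suc N) (hat_comb (form_N.comb N t1 t2 t3 t4 c1 c2 c3 d1 d2 d3 \<alpha> \<beta>))"
  shows "s4 < t4"
proof -
  interpret V: form_S N i j k l s1 s2 s3 s4 a1 a2 a3 b1 b2 b3 by fact
  interpret W: form_N N i' j' k' l' t1 t2 t3 t4 c1 c2 c3 d1 d2 d3 by fact
  define I E where "I = \<alpha> * c1 + \<beta> * d1" and "E = \<alpha> * c3 + b3"
  define M where "M = [(s3, b1), (s4, b2), (t1, - I), (t2, - (\<beta> * d2)), (t3, - (\<beta> * d3)), (t4, \<alpha> * c2), (real N, E)]"
  have alt: "alternating (pos_points M) (neg_points M) \<or> alternating (neg_points M) (pos_points M)"
    by (rule same_image_alternating[OF Z eq ne])
      (use V.order W.order in \<open>auto simp: M_def I_def E_def V.comb_def W.comb_def hat_comb_simps algebra_simps\<close>)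
  note alt' = alt[THEN disj_commute[THEN iffD1]]
  have le: "pos_points M \<subseteq> {..real N}" "neg_points M \<subseteq> {..real N}"
    using V.order W.order unfolding M_def by (auto simp: pos_points_def neg_points_def)
  note few = not_alternating_few[OF alt _ le(2)] not_alternating_few[OF alt' _ le(1)]
  consider "\<beta> > 0" "\<alpha> \<ge> 0" | "\<beta> > 0" "\<alpha> < 0" | "\<beta> \<le> 0" "\<alpha> \<ge> 0" | "\<beta> \<le> 0" "\<alpha> < 0" by linarith
  then show ?thesis
  proof cases
    case 1
    then have I: "I > 0" using W.pos by (simp add: I_def add_nonneg_pos)
    have E: "E \<ge> 0" using 1 V.pos W.pos by (simp add: E_def)
    have N3: "neg_points M \<subseteq> {t1, t2, t3}" and P4: "pos_points M \<subseteq> {s3, s4, t4, real N}"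
      using 1 E V.pos W.pos I by (auto simp: M_def sign_simps)
    obtain x0 y0 x1 y1 x2 y2 x3 where
        x: "x0 < y0" "y0 < x1" "x1 < y1" "y1 < x2" "x2 < y2" "y2 < x3" "x0 \<in> pos_points M" "x1 \<in> pos_points M"
        "x2 \<in> pos_points M" "x3 \<in> pos_points M" and y: "y0 \<in> {t1, t2, t3}" "y1 \<in> {t1, t2, t3}" "y2 \<in> {t1, t2, t3}"
        using alternating_three[OF alt' N3] .
    have "y2 \<le> t3" using y W.order by auto
    then have "{x0, x1, x2} \<subseteq> {s3, s4}" using x P4 W.order by auto
    then show ?thesis using x by auto
  next
    case 2
    show ?thesis
    proof (cases "I \<ge> 0")
      case True
      have "pos_points M \<subseteq> {s3, s4, real N}" using 2 True V.pos W.pos by (auto simp: M_def sign_simps)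
      then show ?thesis by (rule few(1)[THEN FalseE])
    next
      case I: False
      show ?thesis
      proof (cases "E > 0")
        case True
        have N3: "neg_points M \<subseteq> {t2, t3, t4}" and P4: "pos_points M \<subseteq> {s3, s4, t1, real N}"
          using 2 I True V.pos W.pos by (auto simp: M_def sign_simps)
        obtain x0 y0 x1 y1 x2 y2 x3 where
        x: "x0 < y0" "y0 < x1" "x1 < y1" "y1 < x2" "x2 < y2" "y2 < x3" "x0 \<in> pos_points M" "x1 \<in> pos_points M"
        "x2 \<in> pos_points M" "x3 \<in> pos_points M" and y: "y0 \<in> {t2, t3, t4}" "y1 \<in> {t2, t3, t4}" "y2 \<in> {t2, t3, t4}"
        using alternating_three[OF alt' N3] .
        have y: "y2 \<le> t4" "t1 < y0" using y W.order by auto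
        then have "{x0, x1, x2} \<subseteq> {s3, s4, t1}" using x P4 W.order by auto
        \<comment> \<open>Three distinct points among \<open>s3\<close>, \<open>s4\<close>,
          \<open>t1\<close> use all of them, so \<open>s4\<close> comes before \<open>y2\<close>,
          which is at most \<open>t4\<close>.\<close>
        then have "s4 \<in> {x0, x1, x2}" using x V.order by auto
        then show ?thesis using x y by auto
      next
        case False
        have P3: "pos_points M \<subseteq> {s3, s4, t1}" and N4: "neg_points M \<subseteq> {t2..}"
          using 2 I False V.pos W.pos W.order by (auto simp: M_def sign_simps)
        obtain x0 where "x0 \<in> neg_points M" "x0 < s3" "x0 < s4" "x0 < t1"
        using alternating_three_first[OF alt P3] .
      then show ?thesis using N4 W.order by auto
      qed
    qed
  next
    case 3
    then have "E \<ge> 0" using V.pos W.pos by (simp add: E_def)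
    have "neg_points M \<subseteq> {t1, t1, real N}" using 3 V.pos W.pos by (auto simp: M_def sign_simps)
    then show ?thesis by (rule few(2)[THEN FalseE])
  next
    case 4
    then have I: "I < 0" using W.pos by (simp add: I_def mult_neg_pos mult_nonpos_nonneg add_neg_nonpos)
    have "neg_points M \<subseteq> {t4, t4, real N}" using 4 I V.pos W.pos by (auto simp: M_def sign_simps)
    then show ?thesis by (rule few(2)[THEN FalseE])
  qed
qed

text \<open>Only \<open>\<alpha> > 0\<close>, \<open>\<beta> < 0\<close> survives the counting. The
  positive points are then \<open>t1\<close>, \<open>s3\<close>, \<open>s4\<close>, so negative
  points must lie before \<open>t1\<close> and between \<open>s3\<close> and \<open>s4\<close>; the
  only candidates give the two inequalities.\<close>

lemma N_S_generator:
  assumes "form_N N i j k l t1 t2 t3 t4 a1 a2 a3 b1 b2 b3"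
    and "form_S N i' j' k' l' s1 s2 s3 s4 c1 c2 c3 d1 d2 d3"
    and Z: "Z \<in> positive_mat 6 (Suc N)" "N \<ge> 5"
    and eq: "Z *\<^sub>v vec (Suc N) (hat_comb (form_N.comb N t1 t2 t3 t4 a1 a2 a3 b1 b2 b3 1 0)) =
      Z *\<^sub>v vec (Suc N) (hat_comb (form_S.comb N s1 s2 s3 s4 c1 c2 c3 d1 d2 d3 \<alpha> \<beta>))"
    and ne: "vec (Suc N) (hat_comb (form_N.comb N t1 t2 t3 t4 a1 a2 a3 b1 b2 b3 1 0)) \<noteq>
      vec (Suc N) (hat_comb (form_S.comb N s1 s2 s3 s4 c1 c2 c3 d1 d2 d3 \<alpha> \<beta>))"
  shows "s1 < t1 \<and> t4 < s4"
proof -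
  interpret V: form_N N i j k l t1 t2 t3 t4 a1 a2 a3 b1 b2 b3 by fact
  interpret W: form_S N i' j' k' l' s1 s2 s3 s4 c1 c2 c3 d1 d2 d3 by fact
  define E where "E = - a3 - (\<beta> * d3 - \<alpha> * c3)"
  define M where "M = [(t1, a1), (t4, - a2), (s1, - (\<alpha> * c1)), (s2, - (\<alpha> * c2)),
    (s3, - (\<beta> * d1)), (s4, - (\<beta> * d2)), (real N, E)]"
  have alt: "alternating (pos_points M) (neg_points M) \<or> alternating (neg_points M) (pos_points M)"
    by (rule same_image_alternating[OF Z eq ne])
      (use V.order W.order in \<open>auto simp: M_def E_def V.comb_def W.comb_def hat_comb_simps algebra_simps\<close>)
  note alt' = alt[THEN disj_commute[THEN iffD1]]
  have le: "pos_points M \<subseteq> {..real N}" "neg_points M \<subseteq> {..real N}"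
    using V.order W.order unfolding M_def by (auto simp: pos_points_def neg_points_def)
  note few = not_alternating_few[OF alt _ le(2)] not_alternating_few[OF alt' _ le(1)]
  consider "\<alpha> \<ge> 0" "\<beta> \<ge> 0" | "\<alpha> \<le> 0" "\<beta> \<le> 0" | "\<alpha> > 0" "\<beta> < 0" | "\<alpha> < 0" "\<beta> > 0" by linarith
  then show ?thesis
  proof cases
    case 1
    have "pos_points M \<subseteq> {t1, t1, real N}" using 1 V.pos W.pos by (auto simp: M_def sign_simps)
    then show ?thesis by (rule few(1)[THEN FalseE])
  next
    case 2
    have "neg_points M \<subseteq> {t4, t4, real N}" using 2 V.pos W.pos by (auto simp: M_def sign_simps)
    then show ?thesis by (rule few(2)[THEN FalseE])
  next
    case 3
    show ?thesis
    proof (cases "E > 0")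
      case True
      have N3: "neg_points M \<subseteq> {s1, s2, t4}" and P4: "pos_points M \<subseteq> {t1, s3, s4, real N}"
        using 3 True V.pos W.pos by (auto simp: M_def sign_simps)
      obtain x0 y0 x1 y1 x2 y2 x3 where
        x: "x0 < y0" "y0 < x1" "x1 < y1" "y1 < x2" "x2 < y2" "y2 < x3" "x0 \<in> pos_points M" "x1 \<in> pos_points M"
        "x2 \<in> pos_points M" "x3 \<in> pos_points M" and y: "y0 \<in> {s1, s2, t4}" "y1 \<in> {s1, s2, t4}" "y2 \<in> {s1, s2, t4}"
        using alternating_three[OF alt' N3] .
      have "x1 < s2" using x(1-5) y W.order by auto
      then have "x0 = t1" "x1 = t1" using x P4 W.order by auto
      then show ?thesis using x by simp
    next
      case False
      have P3: "pos_points M \<subseteq> {t1, s3, s4}" and N4: "neg_points M \<subseteq> {s1, s2, t4, real N}"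
        using 3 False V.pos W.pos by (auto simp: M_def sign_simps)
      obtain x where x: "x \<in> neg_points M" "x < t1" using alternating_three_first[OF alt P3] .
      obtain z where z: "z \<in> neg_points M" "s3 < z" "z < s4"
        using alternating_three_between[OF alt P3 W.order(4)] .
      show ?thesis using x z N4 V.order W.order by auto
    qed
  next
    case 4
    then have "\<beta> * d3 \<ge> 0" "\<alpha> * c3 \<le> 0" using W.pos by (auto simp: mult_nonpos_nonneg)
    then have E: "E < 0" using V.pos by (simp add: E_def)
    have P3: "pos_points M \<subseteq> {t1, s1, s2}" and N4: "neg_points M \<subseteq> {t4, s3, s4, real N}"
      using 4 E V.pos W.pos by (auto simp: M_def sign_simps)
    obtain x0 where "x0 \<in> neg_points M" "x0 < t1" "x0 < s1" "x0 < s2"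
        using alternating_three_first[OF alt P3] .
      then show ?thesis using N4 V.order W.order by auto
  qed
qed

lemma hat_between_if:
  assumes "real i < t" "t < real i + 1"
  shows "hat a t = (if a = i then real i + 1 - t else if a = Suc i then t - real i else 0)"
  using hat_between[OF assms] by auto

text \<open>The negative last entry excludes \<open>\<alpha> \<le> 0\<close>,
  \<open>\<beta> \<ge> 0\<close>. For \<open>\<alpha> > 0\<close>, \<open>\<beta> \<ge> 0\<close>
  there are three positive entries where only two are possible, and for
  \<open>\<alpha> \<le> 0\<close>, \<open>\<beta> < 0\<close> none at \<open>i\<close>. In the last
  case the outer dominoes match, and the inner ones would have to cancel although
  \<open>s2 < s3\<close>.\<close>

lemma form_N_p_notin_form_S:
  assumes "form_N N i j k l t1 t2 t3 t4 a1 a2 a3 b1 b2 b3"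
    and "form_S N i' j' k' l' s1 s2 s3 s4 c1 c2 c3 d1 d2 d3"
  shows "vec (Suc N) (hat_comb (form_N.comb N t1 t2 t3 t4 a1 a2 a3 b1 b2 b3 1 0))
    \<notin> form_S.space N s1 s2 s3 s4 c1 c2 c3 d1 d2 d3"
proof
  interpret V: form_N N i j k l t1 t2 t3 t4 a1 a2 a3 b1 b2 b3 by fact
  interpret W: form_S N i' j' k' l' s1 s2 s3 s4 c1 c2 c3 d1 d2 d3 by fact
  assume "vec (Suc N) (hat_comb (V.comb 1 0)) \<in> W.space"
  then obtain \<alpha> \<beta> where "\<And>a. a \<le> N \<Longrightarrow> hat_comb (V.comb 1 0) a = \<alpha> * hat_comb (W.comb 1 0) a + \<beta> * hat_comb (W.comb 0 1) a"
    unfolding W.space_def by (rule plane_memD) blast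
  then have eq: "a1 * hat a t1 - a2 * hat a t4 - a3 * (if a = N then 1 else 0) =
     \<alpha> * c1 * hat a s1 + \<alpha> * c2 * hat a s2 + \<beta> * d1 * hat a s3 + \<beta> * d2 * hat a s4
      + (\<beta> * d3 - \<alpha> * c3) * (if a = N then 1 else 0)" (is "?p a = ?v a") if "a \<le> N" for a
    using that by (simp add: V.comb_def W.comb_def hat_comb_simps hat_nat algebra_simps)
  note hV = hat_between_if[OF V.t1] hat_between_if[OF V.t4]
  note hW = hat_between_if[OF W.t1] hat_between_if[OF W.t2] hat_between_if[OF W.t3] hat_between_if[OF W.t4]
  have p: "a = i \<or> a = Suc i" if "?p a > 0" for a
    using that V.pos V.t4 V.t1 V.idx unfolding hV by (cases "a = i"; cases "a = Suc i"; cases "a = j"; cases "a = Suc j")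
      (auto split: if_splits simp: mult_less_0_iff)
  have pi: "?p i > 0" using V.pos V.t1 V.idx unfolding hV by simp
  have pneg: "a = j \<or> a = Suc j \<or> a = N" if "?p a < 0" for a
    using that V.pos V.t4 V.t1 V.idx unfolding hV by (cases "a = i"; cases "a = Suc i"; cases "a = j"; cases "a = Suc j")
      (auto split: if_splits simp: mult_less_0_iff)
  have pz: "?p a = 0" if "a \<noteq> i" "a \<noteq> Suc i" "a \<noteq> j" "a \<noteq> Suc j" "a \<noteq> N" for a
    using that unfolding hV by simp
  have "?p N = - a3" using V.idx unfolding hV by simp
  moreover have "?v N = \<beta> * d3 - \<alpha> * c3" using W.idx unfolding hW by simp
  ultimately have "\<beta> * d3 - \<alpha> * c3 < 0" using eq[of N] V.pos by simp
  moreover have "\<beta> * d3 - \<alpha> * c3 \<ge> 0" if "\<alpha> \<le> 0" "\<beta> \<ge> 0"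
    using that W.pos mult_nonpos_nonneg[of \<alpha> c3] mult_nonneg_nonneg[of \<beta> d3] by linarith
  ultimately consider "\<alpha> > 0" "\<beta> \<ge> 0" | "\<alpha> \<le> 0" "\<beta> < 0" | "\<alpha> > 0" "\<beta> < 0" by linarith
  then show False
  proof cases
    case 1
    have "?v i' > 0" "?v (Suc i') > 0" "?v j' > 0"
      using 1 W.pos W.t1 W.t2 W.t3 W.t4 W.idx unfolding hW by (auto intro!: add_pos_nonneg)
    then have pp: "?p i' > 0" "?p (Suc i') > 0" "?p j' > 0"
      using eq[of i'] eq[of "Suc i'"] eq[of j'] W.idx by linarith+
    have "i' = i \<or> i' = Suc i" "Suc i' = i \<or> Suc i' = Suc i" "j' = i \<or> j' = Suc i"
      by (rule p[OF pp(1)], rule p[OF pp(2)], rule p[OF pp(3)])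
    then show False using W.idx by auto
  next
    case 2
    have "\<alpha> * c1 * hat i s1 \<le> 0" "\<alpha> * c2 * hat i s2 \<le> 0" "\<beta> * d1 * hat i s3 \<le> 0" "\<beta> * d2 * hat i s4 \<le> 0"
      using 2 W.pos by (auto intro!: mult_nonpos_nonneg simp: hat_def)
    then show False using pi eq[of i] V.idx by simp
  next
    case 3
    have v: "?v i' = \<alpha> * c1 * hat i' s1" "?v (Suc i') = \<alpha> * c1 * hat (Suc i') s1"
      "?v l' = \<beta> * d2 * hat l' s4" "?v (Suc l') = \<beta> * d2 * hat (Suc l') s4"
      "?v j' = \<alpha> * c2 * (real j' + 1 - s2) + \<beta> * d1 * hat j' s3"
      "?v (Suc j') = \<alpha> * c2 * (s2 - real j') + \<beta> * d1 * hat (Suc j') s3"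
      using W.idx unfolding hW by auto
    have "?v i' > 0" "?v (Suc i') > 0" unfolding v
      using 3 W.pos W.t1 unfolding hW by auto
    then have pp: "?p i' > 0" "?p (Suc i') > 0"
      using eq[of i'] eq[of "Suc i'"] W.idx by linarith+
    have "i' = i \<or> i' = Suc i" "Suc i' = i \<or> Suc i' = Suc i"
      by (rule p[OF pp(1)], rule p[OF pp(2)])
    then have i: "i' = i" by auto
    have "?v l' < 0" "?v (Suc l') < 0" unfolding v
      using 3 W.pos W.t4 unfolding hW by (auto simp: mult_less_0_iff)
    then have pp: "?p l' < 0" "?p (Suc l') < 0"
      using eq[of l'] eq[of "Suc l'"] W.idx by linarith+
    have "l' = j \<or> l' = Suc j" "Suc l' = j \<or> Suc l' = Suc j"
      using pneg[OF pp(1)] pneg[OF pp(2)] W.idx by auto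
    then have l: "l' = j" by auto
    \<comment> \<open>With \<open>i' = i\<close> and \<open>l' = j\<close>, the coordinates
      \<open>j'\<close> and \<open>j' + 1\<close> lie strictly between the two dominoes of the first
      generator.\<close>
    have "?p j' = 0" "?p (Suc j') = 0"
      by (rule pz; use W.idx i l in linarith)+
    then have z: "\<alpha> * c2 * (real j' + 1 - s2) + \<beta> * d1 * hat j' s3 = 0"
      "\<alpha> * c2 * (s2 - real j') + \<beta> * d1 * hat (Suc j') s3 = 0"
      using eq[of j'] eq[of "Suc j'"] v W.idx by auto
    show False
    proof (cases "k' = j'")
      case True
      have h: "hat j' s3 = real j' + 1 - s3" "hat (Suc j') s3 = s3 - real j'" using True W.t3 hat_between by auto
      have "\<alpha> * c2 + \<beta> * d1 = 0" using z unfolding h by (simp add: algebra_simps)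
      then have "\<beta> * d1 = - (\<alpha> * c2)" by simp
      then have "\<alpha> * c2 * (s3 - s2) = 0" using z(1) unfolding h by (simp add: algebra_simps)
      then show False using 3 W.pos W.t23 by simp
    next
      case False
      then have "hat j' s3 = 0" using W.idx unfolding hW by simp
      then show False using z(1) 3 W.pos W.t2 by simp
    qed
  qed
qed

section \<open>Normal forms are determined by their images\<close>

definition is_form :: "nat \<Rightarrow> real vec set \<Rightarrow> bool" where
  "is_form N V \<longleftrightarrow>
    (\<exists>i j k l t1 t2 t3 t4 a1 a2 a3 b1 b2 b3. form_S N i j k l t1 t2 t3 t4 a1 a2 a3 b1 b2 b3 \<and>
       V = form_S.space N t1 t2 t3 t4 a1 a2 a3 b1 b2 b3) \<or>
    (\<exists>i j k l t1 t2 t3 t4 a1 a2 a3 b1 b2 b3. form_N N i j k l t1 t2 t3 t4 a1 a2 a3 b1 b2 b3 \<and>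
       V = form_N.space N t1 t2 t3 t4 a1 a2 a3 b1 b2 b3)"

lemma plane_gens: "vec (Suc N) f \<in> plane N f g" "vec (Suc N) g \<in> plane N f g"
  using plane_memI[of N f 1 f 0 g] plane_memI[of N g 0 f 1 g] by auto

lemma image_subsetD:
  assumes "amplituhedron_map Z V \<subseteq> amplituhedron_map Z W" "v \<in> V"
  obtains w where "w \<in> W" "Z *\<^sub>v v = Z *\<^sub>v w"
  using assms unfolding amplituhedron_map_def by blast

lemma form_S_S_subset:
  assumes "form_S N i j k l t1 t2 t3 t4 a1 a2 a3 b1 b2 b3"
    and "form_S N i' j' k' l' s1 s2 s3 s4 c1 c2 c3 d1 d2 d3"
    and Z: "Z \<in> positive_mat 6 (Suc N)" "N \<ge> 5"
    and im: "amplituhedron_map Z (form_S.space N t1 t2 t3 t4 a1 a2 a3 b1 b2 b3)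
      \<subseteq> amplituhedron_map Z (form_S.space N s1 s2 s3 s4 c1 c2 c3 d1 d2 d3)"
  shows "form_S.space N t1 t2 t3 t4 a1 a2 a3 b1 b2 b3 \<subseteq> form_S.space N s1 s2 s3 s4 c1 c2 c3 d1 d2 d3"
proof -
  interpret V: form_S N i j k l t1 t2 t3 t4 a1 a2 a3 b1 b2 b3 by fact
  interpret W: form_S N i' j' k' l' s1 s2 s3 s4 c1 c2 c3 d1 d2 d3 by fact
  have mem: "vec (Suc N) (hat_comb (V.comb x y)) \<in> W.space" if xy: "x = 1 \<and> y = 0 \<or> x = 0 \<and> y = 1" for x y
  proof -
    have "vec (Suc N) (hat_comb (V.comb x y)) \<in> V.space" unfolding V.space_eq by blast
    from image_subsetD[OF im this] obtain \<alpha> \<beta> where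
      "Z *\<^sub>v vec (Suc N) (hat_comb (V.comb x y)) = Z *\<^sub>v vec (Suc N) (hat_comb (W.comb \<alpha> \<beta>))"
      unfolding W.space_eq by blast
    from S_S_generator[OF assms(1,2) Z xy this] show ?thesis unfolding W.space_eq by blast
  qed
  then show ?thesis unfolding V.space_def
    using mem[of 1 0] mem[of 0 1] unfolding W.space_def by (intro plane_subset) auto
qed

text \<open>The last entries make the factor \<open>\<alpha>\<close> positive. The positive dominoes
  then occupy the same coordinates, and the ratio of their two entries determines the point.\<close>

lemma form_N_same_t1:
  assumes "form_N N i j k l t1 t2 t3 t4 a1 a2 a3 b1 b2 b3"
    and "form_N N i' j' k' l' s1 s2 s3 s4 c1 c2 c3 d1 d2 d3"
    and eq: "\<And>a. a \<le> N \<Longrightarrow> hat_comb (form_N.comb N s1 s2 s3 s4 c1 c2 c3 d1 d2 d3 1 0) a =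
      \<alpha> * hat_comb (form_N.comb N t1 t2 t3 t4 a1 a2 a3 b1 b2 b3 1 0) a"
  shows "t1 = s1"
proof -
  interpret V: form_N N i j k l t1 t2 t3 t4 a1 a2 a3 b1 b2 b3 by fact
  interpret W: form_N N i' j' k' l' s1 s2 s3 s4 c1 c2 c3 d1 d2 d3 by fact
  have eq': "c1 * hat a s1 - c2 * hat a s4 - c3 * (if a = N then 1 else 0) =
    \<alpha> * (a1 * hat a t1 - a2 * hat a t4 - a3 * (if a = N then 1 else 0))" (is "?p a = \<alpha> * ?v a") if "a \<le> N" for a
    using eq[OF that] by (simp add: V.comb_def W.comb_def hat_comb_simps hat_nat algebra_simps)
  note hV = hat_between_if[OF V.t1] hat_between_if[OF V.t4]
  note hW = hat_between_if[OF W.t1] hat_between_if[OF W.t4]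
  have "c3 = \<alpha> * a3" using eq'[of N] V.idx W.idx unfolding hV hW by simp
  then have \<alpha>: "\<alpha> > 0" using V.pos W.pos by (metis zero_less_mult_pos2)
  have p: "a = i' \<or> a = Suc i'" if "?p a > 0" for a
    using that W.pos W.t4 W.t1 W.idx unfolding hW by (cases "a = i'"; cases "a = Suc i'"; cases "a = j'"; cases "a = Suc j'")
      (auto split: if_splits simp: mult_less_0_iff)
  have v: "?v i = a1 * (real i + 1 - t1)" "?v (Suc i) = a1 * (t1 - real i)"
    using V.idx unfolding hV by auto
  have "?v i > 0" "?v (Suc i) > 0" unfolding v using V.pos V.t1 by auto
  then have "\<alpha> * ?v i > 0" "\<alpha> * ?v (Suc i) > 0" using \<alpha> by auto
  then have "?p i > 0" "?p (Suc i) > 0" using eq'[of i] eq'[of "Suc i"] V.idx by linarith+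
  note pp = this
  have "i = i' \<or> i = Suc i'" "Suc i = i' \<or> Suc i = Suc i'" by (rule p[OF pp(1)], rule p[OF pp(2)])
  then have i: "i' = i" by auto
  have w: "?p i = c1 * (real i + 1 - s1)" "?p (Suc i) = c1 * (s1 - real i)"
    using W.idx i unfolding hW by auto
  have e: "c1 * (real i + 1 - s1) = \<alpha> * (a1 * (real i + 1 - t1))" "c1 * (s1 - real i) = \<alpha> * (a1 * (t1 - real i))"
    using eq'[of i] eq'[of "Suc i"] V.idx unfolding v w by auto
  then have "c1 = \<alpha> * a1" by (simp add: algebra_simps)
  then show ?thesis using e(2) \<alpha> V.pos by simp
qed

text \<open>The first generator of each plane lies in the other plane; this uses both inclusions of
  the images. If that of the second plane involves the second generator of the first plane
  (\<open>\<beta> \<noteq> 0\<close>), the latter is a combination of the two first generators.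
  Otherwise these are proportional, so \<open>t1 = s1\<close> and \<open>N_N_generators\<close>
  applies.\<close>

lemma form_N_N_subset:
  assumes "form_N N i j k l t1 t2 t3 t4 a1 a2 a3 b1 b2 b3"
    and "form_N N i' j' k' l' s1 s2 s3 s4 c1 c2 c3 d1 d2 d3"
    and Z: "Z \<in> positive_mat 6 (Suc N)" "N \<ge> 5"
    and im: "amplituhedron_map Z (form_N.space N t1 t2 t3 t4 a1 a2 a3 b1 b2 b3)
      = amplituhedron_map Z (form_N.space N s1 s2 s3 s4 c1 c2 c3 d1 d2 d3)"
  shows "form_N.space N t1 t2 t3 t4 a1 a2 a3 b1 b2 b3 \<subseteq> form_N.space N s1 s2 s3 s4 c1 c2 c3 d1 d2 d3"
proof -
  interpret V: form_N N i j k l t1 t2 t3 t4 a1 a2 a3 b1 b2 b3 by fact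
  interpret W: form_N N i' j' k' l' s1 s2 s3 s4 c1 c2 c3 d1 d2 d3 by fact
  have mem: "vec (Suc N) (hat_comb (V.comb x y)) \<in> W.space"
    if xy: "x = 1 \<and> y = 0 \<or> x = 0 \<and> y = 1 \<and> t1 = s1" for x y
  proof -
    have "vec (Suc N) (hat_comb (V.comb x y)) \<in> V.space" unfolding V.space_eq by blast
    from image_subsetD[OF equalityD1[OF im] this] obtain \<alpha> \<beta> where
      "Z *\<^sub>v vec (Suc N) (hat_comb (V.comb x y)) = Z *\<^sub>v vec (Suc N) (hat_comb (W.comb \<alpha> \<beta>))"
      unfolding W.space_eq by blast
    from N_N_generators[OF assms(1,2) Z xy this] show ?thesis unfolding W.space_eq by blast
  qed
  have "vec (Suc N) (hat_comb (W.comb 1 0)) \<in> V.space"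
  proof -
    have "vec (Suc N) (hat_comb (W.comb 1 0)) \<in> W.space" unfolding W.space_eq by blast
    from image_subsetD[OF equalityD2[OF im] this] obtain \<alpha> \<beta> where
      "Z *\<^sub>v vec (Suc N) (hat_comb (W.comb 1 0)) = Z *\<^sub>v vec (Suc N) (hat_comb (V.comb \<alpha> \<beta>))"
      unfolding V.space_eq by blast
    from N_N_generators[OF assms(2,1) Z _ this] show ?thesis unfolding V.space_eq by blast
  qed
  then obtain \<alpha> \<beta> where ab: "\<And>a. a \<le> N \<Longrightarrow> hat_comb (W.comb 1 0) a = \<alpha> * hat_comb (V.comb 1 0) a + \<beta> * hat_comb (V.comb 0 1) a"
    unfolding V.space_def by (rule plane_memD) blast
  have p: "vec (Suc N) (hat_comb (V.comb 1 0)) \<in> W.space" using mem by simp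
  have q: "vec (Suc N) (hat_comb (V.comb 0 1)) \<in> W.space"
  proof (cases "\<beta> = 0")
    case True
    then have "t1 = s1" using form_N_same_t1[OF assms(1,2), of \<alpha>] ab by simp
    then show ?thesis using mem by simp
  next
    case False
    obtain \<gamma> \<delta> where gd: "\<And>a. a \<le> N \<Longrightarrow> hat_comb (V.comb 1 0) a = \<gamma> * hat_comb (W.comb 1 0) a + \<delta> * hat_comb (W.comb 0 1) a"
      using p unfolding W.space_def by (rule plane_memD) blast
    show ?thesis unfolding W.space_def
    proof (rule plane_memI[of _ _ "(1 - \<alpha> * \<gamma>) / \<beta>" _ "- \<alpha> * \<delta> / \<beta>"])
      fix a assume a: "a \<le> N"
      have "\<beta> * hat_comb (V.comb 0 1) a = hat_comb (W.comb 1 0) a - \<alpha> * hat_comb (V.comb 1 0) a"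
        using ab[OF a] by simp
      also have "\<dots> = (1 - \<alpha> * \<gamma>) * hat_comb (W.comb 1 0) a - \<alpha> * \<delta> * hat_comb (W.comb 0 1) a"
        unfolding gd[OF a] by (simp add: algebra_simps)
      finally have "hat_comb (V.comb 0 1) a
          = ((1 - \<alpha> * \<gamma>) * hat_comb (W.comb 1 0) a - \<alpha> * \<delta> * hat_comb (W.comb 0 1) a) / \<beta>"
        using False by (metis nonzero_mult_div_cancel_left)
      then show "hat_comb (V.comb 0 1) a = (1 - \<alpha> * \<gamma>) / \<beta> * hat_comb (W.comb 1 0) a + - \<alpha> * \<delta> / \<beta> * hat_comb (W.comb 0 1) a"
        by (simp add: diff_divide_distrib add_divide_distrib algebra_simps)
    qed
  qed
  show ?thesis using p q unfolding V.space_def W.space_def by (intro plane_subset) auto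
qed

text \<open>The first nested generator is not in the side-by-side plane, so
  \<open>N_S_generator\<close> orders the outer points. Against this order both side-by-side
  generators must be recovered exactly, and the side-by-side plane lies inside the nested one.
  \<open>N_N_generators\<close>, applied to the nested plane and itself, then puts the first nested
  generator into the side-by-side plane after all.\<close>

lemma form_S_N_images:
  assumes "form_S N i j k l s1 s2 s3 s4 a1 a2 a3 b1 b2 b3"
    and "form_N N i' j' k' l' t1 t2 t3 t4 c1 c2 c3 d1 d2 d3"
    and Z: "Z \<in> positive_mat 6 (Suc N)" "N \<ge> 5"
  shows "amplituhedron_map Z (form_S.space N s1 s2 s3 s4 a1 a2 a3 b1 b2 b3)
      \<noteq> amplituhedron_map Z (form_N.space N t1 t2 t3 t4 c1 c2 c3 d1 d2 d3)"
proof
  interpret V: form_S N i j k l s1 s2 s3 s4 a1 a2 a3 b1 b2 b3 by fact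
  interpret W: form_N N i' j' k' l' t1 t2 t3 t4 c1 c2 c3 d1 d2 d3 by fact
  assume im: "amplituhedron_map Z V.space = amplituhedron_map Z W.space"
  have p: "vec (Suc N) (hat_comb (W.comb 1 0)) \<notin> V.space" by (rule form_N_p_notin_form_S[OF assms(2,1)])
  have "vec (Suc N) (hat_comb (W.comb 1 0)) \<in> W.space" unfolding W.space_eq by blast
  from image_subsetD[OF equalityD2[OF im] this] obtain \<alpha> \<beta> where
    e: "Z *\<^sub>v vec (Suc N) (hat_comb (W.comb 1 0)) = Z *\<^sub>v vec (Suc N) (hat_comb (V.comb \<alpha> \<beta>))"
    unfolding V.space_eq by blast
  have "vec (Suc N) (hat_comb (V.comb \<alpha> \<beta>)) \<in> V.space" unfolding V.space_eq by blast
  then have "vec (Suc N) (hat_comb (W.comb 1 0)) \<noteq> vec (Suc N) (hat_comb (V.comb \<alpha> \<beta>))" using p by metis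
  from N_S_generator[OF assms(2,1) Z e this] have ord: "s1 < t1" "t4 < s4" by auto
  have u: "vec (Suc N) (hat_comb (V.comb 1 0)) \<in> W.space"
  proof -
    have "vec (Suc N) (hat_comb (V.comb 1 0)) \<in> V.space" unfolding V.space_eq by blast
    from image_subsetD[OF equalityD1[OF im] this] obtain \<gamma> \<delta> where
      "Z *\<^sub>v vec (Suc N) (hat_comb (V.comb 1 0)) = Z *\<^sub>v vec (Suc N) (hat_comb (W.comb \<gamma> \<delta>))"
      unfolding W.space_eq by blast
    from S_N_generator_u[OF assms(1,2) Z this] ord(1)
    have "vec (Suc N) (hat_comb (V.comb 1 0)) = vec (Suc N) (hat_comb (W.comb \<gamma> \<delta>))" by fastforce
    then show ?thesis unfolding W.space_eq by blast
  qed
  have w: "vec (Suc N) (hat_comb (V.comb 0 1)) \<in> W.space"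
  proof -
    have "vec (Suc N) (hat_comb (V.comb 0 1)) \<in> V.space" unfolding V.space_eq by blast
    from image_subsetD[OF equalityD1[OF im] this] obtain \<gamma> \<delta> where
      "Z *\<^sub>v vec (Suc N) (hat_comb (V.comb 0 1)) = Z *\<^sub>v vec (Suc N) (hat_comb (W.comb \<gamma> \<delta>))"
      unfolding W.space_eq by blast
    from S_N_generator_w[OF assms(1,2) Z this] ord(2)
    have "vec (Suc N) (hat_comb (V.comb 0 1)) = vec (Suc N) (hat_comb (W.comb \<gamma> \<delta>))" by fastforce
    then show ?thesis unfolding W.space_eq by blast
  qed
  have "V.space \<subseteq> W.space" using u w unfolding V.space_def W.space_def by (intro plane_subset) auto
  then obtain \<gamma> \<delta> where
    gd: "vec (Suc N) (hat_comb (V.comb \<alpha> \<beta>)) = vec (Suc N) (hat_comb (W.comb \<gamma> \<delta>))"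
    using \<open>vec (Suc N) (hat_comb (V.comb \<alpha> \<beta>)) \<in> V.space\<close> unfolding W.space_eq by blast
  have "vec (Suc N) (hat_comb (W.comb 1 0)) = vec (Suc N) (hat_comb (W.comb \<gamma> \<delta>))"
    by (rule N_N_generators[OF assms(2,2) Z _ e[unfolded gd]]) simp
  then show False using gd \<open>vec (Suc N) (hat_comb (V.comb \<alpha> \<beta>)) \<in> V.space\<close> p by metis
qed

theorem amplituhedron_map_forms:
  assumes "is_form N V" "is_form N W" and Z: "Z \<in> positive_mat 6 (Suc N)" "N \<ge> 5"
    and im: "amplituhedron_map Z V = amplituhedron_map Z W"
  shows "V = W"
  using assms(1,2) unfolding is_form_def
proof (elim disjE exE conjE)
qed (use im Z in \<open>blast intro!: equalityI dest: form_S_S_subset form_N_N_subset form_S_N_images\<close>)+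

section \<open>From decorated permutations to signs of minors\<close>

lemma det_2_by_2:
  fixes A :: "real mat"
  assumes "A \<in> carrier_mat 2 2"
  shows "det A = A $$ (0, 0) * A $$ (1, 1) - A $$ (1, 0) * A $$ (0, 1)"
proof -
  have d: "mat_delete A i 0 \<in> carrier_mat 1 1" for i
    using mat_delete_carrier[OF assms] by simp
  have "det A = (\<Sum>i<2. A $$ (i, 0) * cofactor A i 0)"
    by (rule laplace_expansion_column[OF assms]) simp
  also have "\<dots> = A $$ (0, 0) * cofactor A 0 0 + A $$ (1, 0) * cofactor A 1 0"
    by (simp add: numeral_2_eq_2)
  also have "cofactor A 0 0 = A $$ (1, 1)"
    unfolding cofactor_def det_single[OF d] using assms by (simp add: mat_delete_def)
  also have "cofactor A 1 0 = - A $$ (0, 1)"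
    unfolding cofactor_def det_single[OF d] using assms by (simp add: mat_delete_def)
  finally show ?thesis by simp
qed

lemma det_submatrix_two_cols:
  fixes A :: "real mat"
  assumes A: "A \<in> carrier_mat 2 n" and ab: "a < b" "b < n"
  shows "det (submatrix A UNIV {a, b}) = A $$ (0, a) * A $$ (1, b) - A $$ (1, a) * A $$ (0, b)"
proof -
  let ?M = "submatrix A UNIV {a, b}"
  have c: "{j. j < n \<and> j \<in> {a, b}} = {a, b}" using ab by auto
  have M: "?M \<in> carrier_mat 2 2"
  proof (rule carrier_matI)
    show "dim_row ?M = 2" using A by (simp add: dim_submatrix(1))
    show "dim_col ?M = 2" unfolding dim_submatrix(2) using A c ab by (metis carrier_matD(2) card_2_iff less_irrefl)
  qed
  have "{x \<in> {a, b}. x < b} = {a}" "{x \<in> {a, b}. x < a} = {}" using ab by auto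
  note e = this
  have p: "pick {a, b} 0 = a" "pick {a, b} 1 = b"
    by (rule pick_eqI, simp, simp only: e card.empty)
      (rule pick_eqI, simp, simp only: e, simp)
  have idx: "?M $$ (r, j) = A $$ (r, pick {a, b} j)" if "r < 2" "j < 2" for r j
  proof -
    have "r < card {i. i < dim_row A \<and> i \<in> UNIV}" "j < card {j. j < dim_col A \<and> j \<in> {a, b}}"
      using that carrier_matD[OF M] dim_submatrix[of A UNIV "{a, b}"] by (metis (no_types))+
    from submatrix_index[OF this] show ?thesis by (simp add: pick_UNIV)
  qed
  show ?thesis unfolding det_2_by_2[OF M] using idx[of 0 0] idx[of 0 1] idx[of 1 0] idx[of 1 1] p by simp
qed

abbreviation span2 :: "real vec set \<Rightarrow> real vec set" where
  "span2 \<equiv> LinearCombinations.module.span class_ring (module_vec TYPE(real) 2)"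

lemma span2_zero: "0\<^sub>v 2 \<in> span2 S"
proof -
  interpret vec_space "TYPE(real)" 2 .
  show ?thesis by (rule in_spanI[of _ "\<lambda>_. 0" "{}"]) (simp_all add: lincomb_def)
qed

lemma span2_empty: "v \<in> span2 {} \<Longrightarrow> v = 0\<^sub>v 2"
proof -
  interpret vec_space "TYPE(real)" 2 .
  show "v \<in> span2 {} \<Longrightarrow> v = 0\<^sub>v 2" using in_spanE[of v "{}"] by auto
qed

lemma span2_smult:
  assumes "S \<subseteq> carrier_vec 2" "w \<in> S"
  shows "c \<cdot>\<^sub>v w \<in> span2 S"
proof -
  interpret vec_space "TYPE(real)" 2 .
  show ?thesis using smult_in_span[of S w c] in_own_span[of S] assms by auto
qed

lemma span2_mem: "S \<subseteq> carrier_vec 2 \<Longrightarrow> w \<in> S \<Longrightarrow> w \<in> span2 S"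
  using span2_smult[of S w 1] unfolding one_smult_vec by simp

text \<open>The determinant with \<open>w\<close> is a linear functional that vanishes on
  \<open>S\<close>.\<close>

lemma span2_parallel:
  assumes S: "S \<subseteq> {0\<^sub>v 2, w}" "w \<in> carrier_vec 2" and v: "v \<in> span2 S"
  shows "v $ 0 * w $ 1 = v $ 1 * w $ 0"
proof -
  interpret vec_space "TYPE(real)" 2 .
  obtain a A where A: "v = lincomb a A" "finite A" "A \<subseteq> S" using in_spanE[OF v] by blast
  have Ac: "A \<subseteq> carrier_vec 2" using A S by auto
  have "v $ 0 * w $ 1 - v $ 1 * w $ 0 = (\<Sum>u\<in>A. a u * (u $ 0 * w $ 1 - u $ 1 * w $ 0))"
  proof -
    have i: "v $ 0 = (\<Sum>u\<in>A. a u * u $ 0)" "v $ 1 = (\<Sum>u\<in>A. a u * u $ 1)"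
      unfolding A(1) by (rule lincomb_index[OF _ Ac], simp)+
    show ?thesis unfolding i sum_distrib_right sum_subtractf[symmetric]
      by (rule sum.cong) (simp_all add: algebra_simps)
  qed
  also have "\<dots> = 0"
  proof (rule sum.neutral, rule ballI)
    fix u assume "u \<in> A"
    then have "u = 0\<^sub>v 2 \<or> u = w" using A S by auto
    then show "a u * (u $ 0 * w $ 1 - u $ 1 * w $ 0) = 0" by auto
  qed
  finally show ?thesis by simp
qed

text \<open>The empty second component says that there are no white fixed points.\<close>

locale rep2 =
  fixes A :: "real mat" and n :: nat and d :: "nat \<Rightarrow> nat"
  assumes A: "A \<in> carrier_mat 2 n" and dp: "mat_decorated_perm A = (d, {})"
begin

lemma cyclic_col_carrier: "cyclic_col A j \<in> carrier_vec 2"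
  by (rule carrier_vecI) (use A in \<open>simp add: cyclic_col_def\<close>)

lemma cyclic_col_small: "1 \<le> a \<Longrightarrow> a \<le> n \<Longrightarrow> cyclic_col A a = col A (a - 1)"
proof -
  assume "1 \<le> a" "a \<le> n"
  then have "(a - 1) mod n = a - 1" by (intro mod_less) auto
  then show ?thesis using A by (simp add: cyclic_col_def residue1_def)
qed

lemma cyclic_col_add: "1 \<le> a \<Longrightarrow> cyclic_col A (a + n) = cyclic_col A a"
proof -
  assume "1 \<le> a"
  then have "a + n - 1 = (a - 1) + n" by simp
  then show ?thesis using A by (simp add: cyclic_col_def residue1_def)
qed

abbreviation F where "F \<equiv> first_return A"
abbreviation spn where "spn a b \<equiv> span2 (cyclic_col A ` {a + 1..b})"

lemma F_spec:
  assumes "1 \<le> a" "a \<le> n"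
  shows "a \<le> F a" "F a \<le> a + n" "cyclic_col A a \<in> spn a (F a)"
    "\<And>b. a \<le> b \<Longrightarrow> b < F a \<Longrightarrow> cyclic_col A a \<notin> spn a b"
proof -
  let ?P = "\<lambda>j. a \<le> j \<and> cyclic_col A a \<in> LinearCombinations.module.span class_ring
         (module_vec TYPE(real) (dim_row A)) (cyclic_col A ` {a + 1..j})"
  have r: "dim_row A = 2" using A by simp
  have P: "?P j = (a \<le> j \<and> cyclic_col A a \<in> spn a j)" for j unfolding r ..
  have F: "F a = (LEAST j. ?P j)" by (simp only: first_return_def)
  \<comment> \<open>Column \<open>a\<close> recurs at \<open>a + n\<close>, so the minimum in
    \<open>first_return\<close> exists.\<close>
  have w: "?P (a + n)" unfolding P
  proof
    have "cyclic_col A a \<in> cyclic_col A ` {a + 1..a + n}"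
      using assms by (intro image_eqI[of _ _ "a + n"]) (auto simp: cyclic_col_add)
    then show "cyclic_col A a \<in> spn a (a + n)"
      using cyclic_col_carrier by (intro span2_mem) auto
  qed simp
  have 1: "?P (F a)" unfolding F by (rule LeastI[of ?P, OF w])
  show "a \<le> F a" "cyclic_col A a \<in> spn a (F a)" using 1 unfolding P by auto
  show "F a \<le> a + n" unfolding F by (rule Least_le[of ?P, OF w])
  show "cyclic_col A a \<notin> spn a b" if "a \<le> b" "b < F a" for b
    using not_less_Least[of b ?P] that unfolding F P by auto
qed

text \<open>Without white fixed points \<open>F a\<close> differs from \<open>a + n\<close>, and
  then its residue determines it.\<close>

lemma F_perm:
  assumes a: "1 \<le> a" "a \<le> n"
  shows "F a = a \<and> d a = a \<or> a < d a \<and> F a = d a \<or> d a < a \<and> F a = d a + n" "1 \<le> d a" "d a \<le> n"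
proof -
  have r: "residue1 n (F a) = d a" and w: "F a \<noteq> a + n"
    using dp a A by (auto simp: mat_decorated_perm_def Let_def)
  then show "F a = a \<and> d a = a \<or> a < d a \<and> F a = d a \<or> d a < a \<and> F a = d a + n" "1 \<le> d a" "d a \<le> n"
  proof -
    have F: "a \<le> F a" "F a < a + n" using F_spec[OF a] w by auto
    consider "F a \<le> n" | "n < F a" by linarith
    then have "d a = (if F a \<le> n then F a else F a - n)"
    proof cases
      case 1
      then have "(F a - 1) mod n = F a - 1" using F a by (intro mod_less) auto
      then show ?thesis using 1 r F a by (simp add: residue1_def)
    next
      case 2
      have "(F a - 1) mod n = (F a - n - 1 + n) mod n" using 2 by simp
      also have "\<dots> = F a - n - 1"
      proof -
        have "F a - n - 1 < n" using 2 F a by linarith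
        then show ?thesis by (metis mod_add_self2 mod_less)
      qed
      finally show ?thesis using 2 r F a by (simp add: residue1_def)
    qed
    then show "F a = a \<and> d a = a \<or> a < d a \<and> F a = d a \<or> d a < a \<and> F a = d a + n" "1 \<le> d a" "d a \<le> n"
      using F a by auto
  qed
qed

definition x where "x a = A $$ (0, a - 1)"
definition y where "y a = A $$ (1, a - 1)"

lemma cyclic_col_index: "1 \<le> a \<Longrightarrow> a \<le> n \<Longrightarrow> cyclic_col A a $ 0 = x a \<and> cyclic_col A a $ 1 = y a"
proof -
  assume a: "1 \<le> a" "a \<le> n"
  then have "a - 1 < n" by simp
  then show ?thesis unfolding cyclic_col_small[OF a] x_def y_def using A by simp
qed

lemma cyclic_col_0: "1 \<le> a \<Longrightarrow> a \<le> n \<Longrightarrow> cyclic_col A a = 0\<^sub>v 2 \<longleftrightarrow> x a = 0 \<and> y a = 0"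
proof
  assume "1 \<le> a" "a \<le> n" "x a = 0 \<and> y a = 0"
  then show "cyclic_col A a = 0\<^sub>v 2"
    using cyclic_col_carrier[of a] cyclic_col_index[of a] by (intro eq_vecI) (auto simp: less_2_cases_iff)
next
  assume "1 \<le> a" "a \<le> n" "cyclic_col A a = 0\<^sub>v 2"
  then show "x a = 0 \<and> y a = 0" using cyclic_col_index[of a] by simp
qed

lemma fixed_iff_zero:
  assumes a: "1 \<le> a" "a \<le> n"
  shows "d a = a \<longleftrightarrow> x a = 0 \<and> y a = 0"
proof
  assume "d a = a"
  then have "F a = a" using F_perm[OF a] by auto
  then show "x a = 0 \<and> y a = 0" using F_spec(3)[OF a] span2_empty cyclic_col_0[OF a] by auto
next
  assume "x a = 0 \<and> y a = 0"
  then have "cyclic_col A a = 0\<^sub>v 2" using cyclic_col_0[OF a] by simp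
  then have "cyclic_col A a \<in> spn a a" using span2_zero by simp
  then have "\<not> a < F a" using F_spec(4)[OF a, of a] by auto
  then show "d a = a" using F_perm[OF a] a by auto
qed

text \<open>The columns strictly between are zero, so column \<open>a\<close> is regained from
  column \<open>b\<close> alone.\<close>

lemma link:
  assumes a: "1 \<le> a" and b: "a < b" "b \<le> n" and z: "\<And>c. a < c \<Longrightarrow> c < b \<Longrightarrow> d c = c" and d: "d a = b"
  shows "x a * y b = y a * x b"
proof -
  have an: "a \<le> n" using b by simp
  have "F a = b" using F_perm[OF a an] b d by auto
  then have v: "cyclic_col A a \<in> spn a b" using F_spec(3)[OF a an] by simp
  have "cyclic_col A ` {a + 1..b} \<subseteq> {0\<^sub>v 2, cyclic_col A b}"
  proof
    fix u assume "u \<in> cyclic_col A ` {a + 1..b}"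
    then obtain c where "c \<in> {a + 1..b}" "u = cyclic_col A c" by blast
    then have c: "a < c" "c \<le> b" "u = cyclic_col A c" by auto
    show "u \<in> {0\<^sub>v 2, cyclic_col A b}"
    proof (cases "c = b")
      case False
      then have "d c = c" using z c by simp
      then show ?thesis using c b a cyclic_col_0[of c] fixed_iff_zero[of c] by simp
    qed (use c in simp)
  qed
  from span2_parallel[OF this cyclic_col_carrier v] show ?thesis
    using cyclic_col_index[of a] cyclic_col_index[of b] a b by simp
qed

text \<open>A nonzero column parallel to column \<open>a\<close> and met before the first return
  would already span it. The separate index \<open>c\<close> admits the periodic copy
  \<open>b + n\<close>.\<close>

lemma not_parallel:
  assumes a: "1 \<le> a" "a \<le> n" and b: "1 \<le> b" "b \<le> n" "d b \<noteq> b"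
    and c: "cyclic_col A c = cyclic_col A b" "a < c" "c < F a"
  shows "x a * y b \<noteq> y a * x b"
proof
  assume eq: "x a * y b = y a * x b"
  have v: "cyclic_col A a \<notin> spn a c" using F_spec(4)[OF a, of c] c by simp
  have "x b \<noteq> 0 \<or> y b \<noteq> 0" using fixed_iff_zero[of b] b by auto
  then obtain r where r: "x a = r * x b" "y a = r * y b"
  proof (cases "x b = 0")
    case True
    then show ?thesis using eq \<open>x b \<noteq> 0 \<or> y b \<noteq> 0\<close> that[of "y a / y b"] by auto
  next
    case False
    then show ?thesis using eq that[of "x a / x b"] by (auto simp: field_simps)
  qed
  have "cyclic_col A a = r \<cdot>\<^sub>v cyclic_col A c"
  proof (rule eq_vecI)
    show "dim_vec (cyclic_col A a) = dim_vec (r \<cdot>\<^sub>v cyclic_col A c)"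
      using cyclic_col_carrier[of a] cyclic_col_carrier[of c] by auto
    fix i assume "i < dim_vec (r \<cdot>\<^sub>v cyclic_col A c)"
    then have "i < 2" using cyclic_col_carrier[of c] by auto
    then show "cyclic_col A a $ i = (r \<cdot>\<^sub>v cyclic_col A c) $ i"
      using r c(1) cyclic_col_index[of a] cyclic_col_index[of b] a b cyclic_col_carrier[of b]
      by (auto simp: less_2_cases_iff)
  qed
  moreover have "r \<cdot>\<^sub>v cyclic_col A c \<in> spn a c"
  proof (rule span2_smult)
    show "cyclic_col A c \<in> cyclic_col A ` {a + 1..c}" using c(2) by (intro imageI) simp
  qed (use cyclic_col_carrier in blast)
  ultimately show False using v by simp
qed

lemma nonlink:
  assumes a: "1 \<le> a" and b: "a < b" "b \<le> n" and d: "d a > b \<or> d a < a" "d b \<noteq> b"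
  shows "x a * y b \<noteq> y a * x b"
proof (rule not_parallel[of a b b])
  show "b < F a" using F_perm[of a] a b d by auto
qed (use a b d in auto)

text \<open>Column \<open>a\<close> returns only after passing \<open>n\<close>, and meets the copy
  \<open>b + n\<close> of column \<open>b\<close> before that.\<close>

lemma nonlink_wrap:
  assumes b: "1 \<le> b" "b < d a" "d b \<noteq> b" and a: "d a < a" "a \<le> n"
  shows "x a * y b \<noteq> y a * x b"
proof (rule not_parallel[of a b "b + n"])
  show "b + n < F a" using F_perm[of a] a b by auto
qed (use a b cyclic_col_add in auto)

end

lemma row_space_2:
  fixes A :: "real mat"
  assumes A: "A \<in> carrier_mat 2 n"
  shows "vec_space.row_space n A = {vec n (\<lambda>a. \<alpha> * A $$ (0, a) + \<beta> * A $$ (1, a)) | \<alpha> \<beta>. True}"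
proof -
  interpret vec_space "TYPE(real)" n .
  have eq: "A\<^sup>T *\<^sub>v v = vec n (\<lambda>a. v $ 0 * A $$ (0, a) + v $ 1 * A $$ (1, a))" if "v \<in> carrier_vec 2" for v
    using A that by (intro eq_vecI) (auto simp: scalar_prod_def numeral_2_eq_2)
  show ?thesis
  proof (intro equalityI subsetI)
    fix w assume "w \<in> row_space A"
    then obtain v where "v \<in> carrier_vec 2" "A\<^sup>T *\<^sub>v v = w" using A unfolding row_space_eq[OF A] by auto
    then show "w \<in> {vec n (\<lambda>a. \<alpha> * A $$ (0, a) + \<beta> * A $$ (1, a)) | \<alpha> \<beta>. True}" using eq by blast
  next
    fix w assume "w \<in> {vec n (\<lambda>a. \<alpha> * A $$ (0, a) + \<beta> * A $$ (1, a)) | \<alpha> \<beta>. True}"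
    then obtain \<alpha> \<beta> where w: "w = vec n (\<lambda>a. \<alpha> * A $$ (0, a) + \<beta> * A $$ (1, a))" by blast
    let ?v = "vec_of_list [\<alpha>, \<beta>]"
    have v: "?v \<in> carrier_vec 2" by (simp add: carrier_vecI)
    have "A\<^sup>T *\<^sub>v ?v = w" unfolding eq[OF v] w by (simp add: vec_of_list_index)
    then show "w \<in> row_space A" unfolding row_space_eq[OF A] using v A w by auto
  qed
qed

text \<open>All that is used later about a point of a cell: a basis with nonnegative minors, and the
  minors that the permutation forces to vanish or to be positive. The last clause stems from returns
  that wrap around past \<open>n\<close>.\<close>

definition sequence_data :: "nat \<Rightarrow> (nat \<Rightarrow> nat) \<Rightarrow> real vec set \<Rightarrow> (nat \<Rightarrow> real) \<Rightarrow> (nat \<Rightarrow> real) \<Rightarrow> bool" where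
  "sequence_data n d V x y \<longleftrightarrow>
     V = {vec n (\<lambda>a. \<alpha> * x (a + 1) + \<beta> * y (a + 1)) | \<alpha> \<beta>. True} \<and>
     (\<forall>a b. 1 \<le> a \<and> a < b \<and> b \<le> n \<longrightarrow> x a * y b - y a * x b \<ge> 0) \<and>
     (\<forall>a. 1 \<le> a \<and> a \<le> n \<longrightarrow> (d a = a \<longleftrightarrow> x a = 0 \<and> y a = 0)) \<and>
     (\<forall>a b. 1 \<le> a \<and> a < b \<and> b \<le> n \<and> (\<forall>c. a < c \<and> c < b \<longrightarrow> d c = c) \<and> d a = b \<longrightarrow> x a * y b - y a * x b = 0) \<and>
     (\<forall>a b. 1 \<le> a \<and> a < b \<and> b \<le> n \<and> (d a > b \<or> d a < a) \<and> d b \<noteq> b \<longrightarrow> x a * y b - y a * x b > 0) \<and>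
     (\<forall>a b. 1 \<le> b \<and> b < d a \<and> d b \<noteq> b \<and> d a < a \<and> a \<le> n \<longrightarrow> x b * y a - y b * x a > 0)"

text \<open>The matrix chosen in \<open>decorated_perm_of\<close> need not be the one with
  nonnegative minors. Its rows are combinations of the rows of the latter, with a coefficient
  determinant that multiplies all minors; if this is negative, \<open>x\<close> and \<open>y\<close>
  are exchanged.\<close>

lemma positroid_cell_sequence:
  assumes "V \<in> positroid_cell 2 n (d, {})"
  obtains x y where "sequence_data n d V x y"
proof -
  have V: "V \<in> nonneg_grassmannian 2 n" "decorated_perm_of 2 n V = (d, {})"
    using assms by (auto simp: positroid_cell_def)
  then obtain B where B: "B \<in> carrier_mat 2 n" "vec_space.row_space n B = V"
    and minors: "\<And>J. J \<subseteq> {0..<n} \<Longrightarrow> card J = 2 \<Longrightarrow> det (submatrix B UNIV J) \<ge> 0"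
    by (auto simp: nonneg_grassmannian_def)
  define A where "A = (SOME A. A \<in> carrier_mat 2 n \<and> vec_space.row_space n A = V)"
  have AV: "A \<in> carrier_mat 2 n" "vec_space.row_space n A = V"
    using someI[of "\<lambda>A. A \<in> carrier_mat 2 n \<and> vec_space.row_space n A = V" B] B unfolding A_def by auto
  interpret rep2 A n d
  proof
    show "A \<in> carrier_mat 2 n" by (rule AV(1))
    show "mat_decorated_perm A = (d, {})" using V(2) unfolding decorated_perm_of_def A_def .
  qed
  have row: "\<exists>p q. \<forall>a<n. A $$ (r, a) = p * B $$ (0, a) + q * B $$ (1, a)" if r: "r < 2" for r
  proof -
    have "vec n (\<lambda>a. A $$ (r, a)) \<in> vec_space.row_space n A"
    proof (cases "r = 0")
      case True
      have "vec n (\<lambda>a. A $$ (r, a)) = vec n (\<lambda>a. 1 * A $$ (0, a) + 0 * A $$ (1, a))" by (simp add: True)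
      then show ?thesis unfolding row_space_2[OF AV(1)] by blast
    next
      case False
      then have "r = 1" using r by simp
      then have "vec n (\<lambda>a. A $$ (r, a)) = vec n (\<lambda>a. 0 * A $$ (0, a) + 1 * A $$ (1, a))" by simp
      then show ?thesis unfolding row_space_2[OF AV(1)] by blast
    qed
    then have "vec n (\<lambda>a. A $$ (r, a)) \<in> vec_space.row_space n B" unfolding AV(2) B(2) .
    then obtain p q where e: "vec n (\<lambda>a. A $$ (r, a)) = vec n (\<lambda>a. p * B $$ (0, a) + q * B $$ (1, a))"
      unfolding row_space_2[OF B(1)] by blast
    have "A $$ (r, a) = p * B $$ (0, a) + q * B $$ (1, a)" if "a < n" for a
      using arg_cong[OF e, of "\<lambda>v. v $ a"] that by simp
    then show ?thesis by blast
  qed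
  obtain p q where pq: "\<And>a. a < n \<Longrightarrow> A $$ (0, a) = p * B $$ (0, a) + q * B $$ (1, a)" using row[of 0] by auto
  obtain r s where rs: "\<And>a. a < n \<Longrightarrow> A $$ (1, a) = r * B $$ (0, a) + s * B $$ (1, a)" using row[of 1] by auto
  have D: "x a * y b - y a * x b = (p * s - q * r) * det (submatrix B UNIV {a - 1, b - 1})"
    and Dge: "det (submatrix B UNIV {a - 1, b - 1}) \<ge> 0" if ab: "1 \<le> a" "a < b" "b \<le> n" for a b
  proof -
    have lt: "a - 1 < b - 1" "b - 1 < n" "a - 1 < n" using ab by auto
    show "x a * y b - y a * x b = (p * s - q * r) * det (submatrix B UNIV {a - 1, b - 1})"
      unfolding det_submatrix_two_cols[OF B(1) lt(1,2)] x_def y_def pq[OF lt(2)] pq[OF lt(3)] rs[OF lt(2)] rs[OF lt(3)]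
      by (simp add: algebra_simps)
    show "det (submatrix B UNIV {a - 1, b - 1}) \<ge> 0" by (rule minors) (use lt in auto)
  qed
  have V_eq: "V = {vec n (\<lambda>a. \<alpha> * x (a + 1) + \<beta> * y (a + 1)) | \<alpha> \<beta>. True}"
    using AV(2) unfolding row_space_2[OF AV(1)] x_def y_def by simp
  show ?thesis
  proof (cases "p * s - q * r \<ge> 0")
    case True
    have ge: "x a * y b - y a * x b \<ge> 0" if "1 \<le> a" "a < b" "b \<le> n" for a b
      unfolding D[OF that] using Dge[OF that] True by simp
    have gt: "x a * y b - y a * x b > 0" if "1 \<le> a" "a < b" "b \<le> n" "d a > b \<or> d a < a" "d b \<noteq> b" for a b
      using nonlink[OF that] ge[OF that(1-3)] by simp
    have wrap: "x b * y a - y b * x a > 0" if "1 \<le> b" "b < d a" "d b \<noteq> b" "d a < a" "a \<le> n" for a b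
      using nonlink_wrap[OF that] ge[of b a] that by (simp add: mult.commute)
    have "sequence_data n d V x y" unfolding sequence_data_def
      using V_eq ge gt wrap fixed_iff_zero link by auto
    then show ?thesis by (rule that)
  next
    case False
    have ge: "y a * x b - x a * y b \<ge> 0" if "1 \<le> a" "a < b" "b \<le> n" for a b
    proof -
      have "x a * y b - y a * x b \<le> 0" unfolding D[OF that] using Dge[OF that] False by (simp add: mult_nonpos_nonneg)
      then show ?thesis by simp
    qed
    have gt: "y a * x b - x a * y b > 0" if "1 \<le> a" "a < b" "b \<le> n" "d a > b \<or> d a < a" "d b \<noteq> b" for a b
      using nonlink[OF that] ge[OF that(1-3)] by simp
    have V_eq': "V = {vec n (\<lambda>a. \<alpha> * y (a + 1) + \<beta> * x (a + 1)) | \<alpha> \<beta>. True}"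
    proof -
      have swap: "vec n (\<lambda>a. \<alpha> * x (a + 1) + \<beta> * y (a + 1)) = vec n (\<lambda>a. \<beta> * y (a + 1) + \<alpha> * x (a + 1))" for \<alpha> \<beta>
        by (simp add: add.commute)
      show ?thesis unfolding V_eq swap by blast
    qed
    have wrap: "y b * x a - x b * y a > 0" if "1 \<le> b" "b < d a" "d b \<noteq> b" "d a < a" "a \<le> n" for a b
      using nonlink_wrap[OF that] ge[of b a] that by (simp add: mult.commute)
    have "sequence_data n d V y x" unfolding sequence_data_def
      using V_eq' ge gt wrap fixed_iff_zero link by auto
    then show ?thesis by (rule that)
  qed
qed

section \<open>From entries of the generators to normal forms\<close>

text \<open>Two adjacent positive entries become one point: the two hats have the ratio
  \<open>f : g\<close> exactly at the fraction \<open>g / (f + g)\<close>.\<close>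

lemma hat_domino:
  fixes f g :: real and i :: nat
  assumes "f > 0" "g > 0"
  defines "t \<equiv> real i + g / (f + g)"
  shows "real i < t" "t < real i + 1" "(f + g) * hat a t = (if a = i then f else if a = Suc i then g else 0)"
proof -
  have s: "f + g > 0" using assms by simp
  show t: "real i < t" "t < real i + 1" using assms by (auto simp: t_def field_simps)
  have "(f + g) * (real i + 1 - t) = f" "(f + g) * (t - real i) = g"
    using s by (auto simp: t_def field_simps)
  then show "(f + g) * hat a t = (if a = i then f else if a = Suc i then g else 0)"
    unfolding hat_between_if[OF t] by simp
qed

lemma domino_position_less:
  fixes a b c e :: real
  assumes "a > 0" "b > 0" "c > 0" "e > 0" "b * c < e * a"
  shows "b / (a + b) < e / (c + e)"
proof (rule mult_imp_div_pos_less)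
  have "b * (c + e) < e * (a + b)" using assms(5) by (simp add: algebra_simps)
  then have "b < e * (a + b) / (c + e)" using assms by (intro mult_imp_less_div_pos) auto
  then show "b < e / (c + e) * (a + b)" by simp
qed (use assms in simp)

lemma plane_cong:
  "(\<And>a. a \<le> N \<Longrightarrow> f a = f' a) \<Longrightarrow> (\<And>a. a \<le> N \<Longrightarrow> g a = g' a) \<Longrightarrow> plane N f g = plane N f' g'"
  by (intro equalityI plane_subset plane_memI[of _ _ 1 _ 0] plane_memI[of _ _ 0 _ 1]) auto

text \<open>Every pair of positive neighbours is turned into a point; for \<open>j = k\<close> the
  inequality \<open>fg\<close> says which of the two inner points is further left.\<close>

lemma form_S_I:
  fixes f g :: "nat \<Rightarrow> real"
  assumes idx: "i + 2 \<le> j" "j \<le> k" "k + 2 \<le> l" "l + 1 < N"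
    and f: "f i > 0" "f (Suc i) > 0" "f j > 0" "f (Suc j) > 0" "f N \<le> 0"
      "\<And>a. a < N \<Longrightarrow> a \<noteq> i \<Longrightarrow> a \<noteq> Suc i \<Longrightarrow> a \<noteq> j \<Longrightarrow> a \<noteq> Suc j \<Longrightarrow> f a = 0"
    and g: "g k > 0" "g (Suc k) > 0" "g l > 0" "g (Suc l) > 0" "g N \<ge> 0"
      "\<And>a. a < N \<Longrightarrow> a \<noteq> k \<Longrightarrow> a \<noteq> Suc k \<Longrightarrow> a \<noteq> l \<Longrightarrow> a \<noteq> Suc l \<Longrightarrow> g a = 0"
    and fg: "j = k \<Longrightarrow> f j * g (Suc j) > f (Suc j) * g j"
  shows "is_form N (plane N f g)"
proof -
  define t1 where "t1 = real i + f (Suc i) / (f i + f (Suc i))"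
  define t2 where "t2 = real j + f (Suc j) / (f j + f (Suc j))"
  define t3 where "t3 = real k + g (Suc k) / (g k + g (Suc k))"
  define t4 where "t4 = real l + g (Suc l) / (g l + g (Suc l))"
  note D1 = hat_domino[OF f(1,2), where i = i, folded t1_def]
  note D2 = hat_domino[OF f(3,4), where i = j, folded t2_def]
  note D3 = hat_domino[OF g(1,2), where i = k, folded t3_def]
  note D4 = hat_domino[OF g(3,4), where i = l, folded t4_def]
  have t23: "t2 < t3"
  proof (cases "j = k")
    case True
    then show ?thesis using fg f g by (simp add: t2_def t3_def field_simps)
  next
    case False
    then have "real j + 1 \<le> real k" using idx by linarith
    then show ?thesis using D2(2) D3(1) by linarith
  qed
  interpret form_S N i j k l t1 t2 t3 t4 "f i + f (Suc i)" "f j + f (Suc j)" "- f N" "g k + g (Suc k)" "g l + g (Suc l)" "g N"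
    by unfold_locales (use idx f(1-5) g(1-5) t23 D1(1,2) D2(1,2) D3(1,2) D4(1,2) in auto)
  have "hat_comb (comb 1 0) a = f a" if "a \<le> N" for a
    using idx f(6)[of a] that by (cases "a = N") (auto simp: comb_def hat_comb_simps D1(3) D2(3) D3(3) D4(3) hat_nat)
  moreover have "hat_comb (comb 0 1) a = g a" if "a \<le> N" for a
    using idx g(6)[of a] that by (cases "a = N") (auto simp: comb_def hat_comb_simps D1(3) D2(3) D3(3) D4(3) hat_nat)
  ultimately have "plane N f g = space" unfolding space_def by (intro plane_cong) auto
  then show ?thesis unfolding is_form_def using form_S_axioms by blast
qed

text \<open>The three parts of \<open>fg\<close> say that the dominoes at \<open>i\<close> are
  proportional if nothing overlaps them, that an overlap leaves a positive rest at \<open>k\<close>,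
  and that \<open>t3 < t4\<close> if \<open>l = j\<close>.\<close>

lemma form_N_I:
  fixes f g :: "nat \<Rightarrow> real"
  assumes idx: "i < k" "k + 2 \<le> l" "l \<le> j" "j + 1 < N"
    and f: "f i > 0" "f (Suc i) > 0" "f j < 0" "f (Suc j) < 0" "f N < 0"
      "\<And>a. a < N \<Longrightarrow> a \<noteq> i \<Longrightarrow> a \<noteq> Suc i \<Longrightarrow> a \<noteq> j \<Longrightarrow> a \<noteq> Suc j \<Longrightarrow> f a = 0"
    and g: "g i > 0" "g (Suc i) > 0" "g k > 0" "g (Suc k) > 0" "g l > 0" "g (Suc l) > 0"
      "\<And>a. a \<le> N \<Longrightarrow> a \<noteq> i \<Longrightarrow> a \<noteq> Suc i \<Longrightarrow> a \<noteq> k \<Longrightarrow> a \<noteq> Suc k \<Longrightarrow> a \<noteq> l \<Longrightarrow> a \<noteq> Suc l \<Longrightarrow> g a = 0"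
    and fg: "Suc i < k \<Longrightarrow> g i * f (Suc i) = g (Suc i) * f i" "Suc i = k \<Longrightarrow> g k * f i > g i * f k"
      "l = j \<Longrightarrow> g j * f (Suc j) < g (Suc j) * f j"
  shows "is_form N (plane N f g)"
proof -
  \<comment> \<open>\<open>r\<close> scales the domino of \<open>f\<close> at \<open>i\<close> to
    that of \<open>g\<close>. If \<open>k = i + 1\<close>, coordinate \<open>k\<close> also carries
    the right half of this domino, and only the rest \<open>h\<close> belongs to the domino at
    \<open>k\<close>.\<close>
  define r where "r = g i / f i"
  define h where "h = (if k = Suc i then g k - r * f k else g k)"
  have r: "r > 0" "r * f i = g i" using f g by (auto simp: r_def)
  have h: "h > 0" using fg(2) f g by (auto simp: h_def r_def field_simps)
  have nf: "- f j > 0" "- f (Suc j) > 0" using f by auto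
  define t1 where "t1 = real i + f (Suc i) / (f i + f (Suc i))"
  define t2 where "t2 = real k + g (Suc k) / (h + g (Suc k))"
  define t3 where "t3 = real l + g (Suc l) / (g l + g (Suc l))"
  define t4 where "t4 = real j + - f (Suc j) / (- f j + - f (Suc j))"
  note D1 = hat_domino[OF f(1,2), where i = i, folded t1_def]
  note D2 = hat_domino[OF h g(4), where i = k, folded t2_def]
  note D3 = hat_domino[OF g(5,6), where i = l, folded t3_def]
  note D4 = hat_domino[OF nf, where i = j, folded t4_def]
  have t34: "t3 < t4"
  proof (cases "l = j")
    case True
    have "g (Suc j) / (g j + g (Suc j)) < - f (Suc j) / (- f j + - f (Suc j))"
      using domino_position_less[of "g j" "g (Suc j)" "- f j" "- f (Suc j)"] fg(3)[OF True] f(3,4) g(5,6) True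
      by (simp add: mult.commute)
    then show ?thesis using True by (simp add: t3_def t4_def)
  next
    case False
    then have "real l + 1 \<le> real j" using idx by linarith
    then show ?thesis using D3(2) D4(1) by linarith
  qed
  interpret form_N N i j k l t1 t2 t3 t4 "f i + f (Suc i)" "- f j + - f (Suc j)" "- f N"
      "r * (f i + f (Suc i))" "h + g (Suc k)" "g l + g (Suc l)"
    by unfold_locales (use idx f(1-5) g(1-6) h r(1) t34 D1(1,2) D2(1,2) D3(1,2) D4(1,2) in auto)
  have A: "r * (f i + f (Suc i)) * hat a t1 = r * (if a = i then f i else if a = Suc i then f (Suc i) else 0)" for a
    unfolding D1(3)[of a, symmetric] by simp
  have B: "- 1 * (- f j + - f (Suc j)) * hat a t4 = - (if a = j then - f j else if a = Suc j then - f (Suc j) else 0)" for a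
    unfolding D4(3)[of a, symmetric] by (simp only: mult_minus_left mult_1 mult.assoc)
  have "hat_comb (comb 1 0) a = f a" if "a \<le> N" for a
  proof -
    have "hat_comb (comb 1 0) a = (f i + f (Suc i)) * hat a t1 + - 1 * (- f j + - f (Suc j)) * hat a t4 + f N * hat a (real N)"
      unfolding comb_def hat_comb_simps by simp
    also have "\<dots> = f a" unfolding B D1(3) hat_nat
      using idx f(6)[of a] that by (cases "a = N") auto
    finally show ?thesis .
  qed
  moreover have "hat_comb (comb 0 1) a = g a" if "a \<le> N" for a
  proof -
    have "hat_comb (comb 0 1) a = r * (f i + f (Suc i)) * hat a t1 + (h + g (Suc k)) * hat a t2 + (g l + g (Suc l)) * hat a t3"
      unfolding comb_def hat_comb_simps by simp
    also have "\<dots> = g a"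
    proof (cases "k = Suc i")
      case True
      then show ?thesis unfolding A D2(3) D3(3) using idx g(7)[of a] that r(2) by (auto simp: h_def)
    next
      case False
      then have "r * f (Suc i) = g (Suc i)" using fg(1) idx f by (auto simp: r_def field_simps)
      then show ?thesis unfolding A D2(3) D3(3) using idx g(7)[of a] that r(2) False by (auto simp: h_def)
    qed
    finally show ?thesis .
  qed
  ultimately have "plane N f g = space" unfolding space_def by (intro plane_cong) auto
  then show ?thesis unfolding is_form_def by (intro disjI2 exI conjI) (rule form_N_axioms, assumption)
qed

section \<open>The two families of permutations and their cells\<close>

text \<open>When the positions are distinct, this and \<open>perm_N\<close> are both the nine-cycle
  \<open>i\<close>, \<open>i + 1\<close>, \<open>j\<close>, \<open>j + 1\<close>, \<open>n\<close>,
  \<open>k\<close>, \<open>k + 1\<close>, \<open>l\<close>, \<open>l + 1\<close>. The other branches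
  treat overlaps of the inner dominoes, \<open>j = k\<close> and \<open>j + 1 = k\<close>.\<close>

definition perm_S :: "nat \<Rightarrow> nat \<Rightarrow> nat \<Rightarrow> nat \<Rightarrow> nat \<Rightarrow> nat \<Rightarrow> nat" where
  "perm_S n i j k l x =
    (if x = i then i + 1 else if x = i + 1 then (if j = k then j + 1 else j)
     else if x = j then (if j = k then l else if j + 1 = k then k + 1 else j + 1)
     else if x = j + 1 then n else if x = n then k else if x = k then k + 1
     else if x = k + 1 then l else if x = l then l + 1 else if x = l + 1 then i else x)"

text \<open>Here overlaps occur at the left for \<open>k = i + 1\<close>, and at the right for
  \<open>l = j\<close> and \<open>l + 1 = j\<close>.\<close>

definition perm_N :: "nat \<Rightarrow> nat \<Rightarrow> nat \<Rightarrow> nat \<Rightarrow> nat \<Rightarrow> nat \<Rightarrow> nat" where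
  "perm_N n i j k l x =
    (if x = i then (if k = i + 1 then k + 1 else i + 1) else if x = i + 1 then j
     else if x = k then k + 1 else if x = k + 1 then (if l = j then j + 1 else l)
     else if x = l + 1 then i else if x = l then (if l = j then n else if l + 1 = j then j + 1 else l + 1)
     else if x = j then j + 1 else if x = j + 1 then n else if x = n then k else x)"

locale sequences =
  fixes n :: nat and d :: "nat \<Rightarrow> nat" and V x y
  assumes data: "sequence_data n d V x y"
begin

definition D where "D a b = x a * y b - y a * x b"

lemma D_anti: "D b a = - D a b" by (simp add: D_def)

lemma D_nonneg: "1 \<le> a \<Longrightarrow> a < b \<Longrightarrow> b \<le> n \<Longrightarrow> D a b \<ge> 0"
  using data unfolding sequence_data_def D_def by blast

lemma D_zero: "1 \<le> a \<Longrightarrow> a \<le> n \<Longrightarrow> d a = a \<Longrightarrow> D a b = 0 \<and> D b a = 0"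
  using data unfolding sequence_data_def D_def by fastforce

lemma D_link: "1 \<le> a \<Longrightarrow> a < b \<Longrightarrow> b \<le> n \<Longrightarrow> d a = b \<Longrightarrow> (\<And>c. a < c \<Longrightarrow> c < b \<Longrightarrow> d c = c) \<Longrightarrow> D a b = 0"
  using data unfolding sequence_data_def D_def by blast

lemma D_nonlink: "1 \<le> a \<Longrightarrow> a < b \<Longrightarrow> b \<le> n \<Longrightarrow> d a > b \<or> d a < a \<Longrightarrow> d b \<noteq> b \<Longrightarrow> D a b > 0"
  using data unfolding sequence_data_def D_def by blast

lemma D_wrap: "1 \<le> b \<Longrightarrow> b < d a \<Longrightarrow> d b \<noteq> b \<Longrightarrow> d a < a \<Longrightarrow> a \<le> n \<Longrightarrow> D b a > 0"
  using data unfolding sequence_data_def D_def by blast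

lemma nonzero: "1 \<le> a \<Longrightarrow> a \<le> n \<Longrightarrow> d a \<noteq> a \<Longrightarrow> x a \<noteq> 0 \<or> y a \<noteq> 0"
  using data unfolding sequence_data_def by blast

lemma parallel_multiple:
  assumes "D a b = 0" "1 \<le> b" "b \<le> n" "d b \<noteq> b"
  obtains c where "x a = c * x b" "y a = c * y b"
proof (cases "x b = 0")
  case True
  then show ?thesis using assms nonzero[OF assms(2-4)] that[of "y a / y b"] by (auto simp: D_def)
next
  case False
  then show ?thesis using assms that[of "x a / x b"] by (auto simp: D_def field_simps)
qed

lemma parallel_zero:
  assumes "D a b = 0" "1 \<le> b" "b \<le> n" "d b \<noteq> b" "D b c = 0"
  shows "D a c = 0" "D c a = 0"
proof -
  obtain r where "x a = r * x b" "y a = r * y b" by (rule parallel_multiple[OF assms(1-4)])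
  then have "D a c = r * D b c" by (simp add: D_def algebra_simps)
  then show "D a c = 0" "D c a = 0" using assms(5) D_anti[of a c] by auto
qed

definition supp where "supp a \<longleftrightarrow> 1 \<le> a \<and> a \<le> n \<and> d a \<noteq> a"

lemma zero_sym: "D a b = 0 \<Longrightarrow> D b a = 0" by (simp add: D_anti[of a b])

lemma par_zero: "D a b = 0 \<Longrightarrow> supp b \<Longrightarrow> D b c = 0 \<Longrightarrow> D a c = 0"
  using parallel_zero(1)[of a b c] by (simp add: supp_def)

text \<open>A vanishing minor would pass on to the parallel column; the sign comes from the order of
  the indices.\<close>

lemma par_left:
  assumes "D a b = 0" "supp a" "D b c > 0" "a < c" "c \<le> n"
  shows "D a c > 0"
proof -
  have "D a c \<noteq> 0" using par_zero[OF zero_sym[OF assms(1)] assms(2), of c] assms(3) by auto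
  then show ?thesis using D_nonneg[of a c] assms by (auto simp: supp_def)
qed

lemma par_right:
  assumes "D b c = 0" "supp c" "D a b > 0" "1 \<le> a" "a < c"
  shows "D a c > 0"
proof -
  have "D c a \<noteq> 0" using par_zero[OF assms(1,2), of a] assms(3) D_anti[of b a] by auto
  then have "D a c \<noteq> 0" using zero_sym by blast
  then show ?thesis using D_nonneg[of a c] assms by (auto simp: supp_def)
qed

lemma nonlink: "supp a \<Longrightarrow> supp b \<Longrightarrow> d a > b \<or> d a < a \<Longrightarrow> a < b \<Longrightarrow> D a b > 0"
  using D_nonlink[of a b] by (simp add: supp_def)

text \<open>Otherwise column \<open>c\<close> is \<open>r\<close> times column \<open>a\<close>. The
  minor of \<open>b\<close> and \<open>c\<close> then gives \<open>r \<le> 0\<close>, while that of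
  \<open>c\<close> and \<open>e\<close> needs \<open>r > 0\<close>.\<close>

lemma D_pos_forward:
  assumes "supp a" "D a b > 0" "D c e > 0" "a < b" "b < c" "c < e" "e \<le> n"
  shows "D a c > 0"
proof (rule ccontr)
  assume neg: "\<not> ?thesis"
  have a: "1 \<le> a" "a \<le> n" "d a \<noteq> a" using assms(1) by (auto simp: supp_def)
  have "D a c \<ge> 0" by (rule D_nonneg) (use assms a in linarith)+
  then have "D a c = 0" using neg by linarith
  from parallel_multiple[OF zero_sym[OF this] a] obtain r where r: "x c = r * x a" "y c = r * y a" .
  have "D b c = - r * D a b" "D c e = r * D a e" using r by (auto simp: D_def algebra_simps)
  moreover have "D b c \<ge> 0" "D a e \<ge> 0" by (rule D_nonneg; use assms a in linarith)+
  ultimately have "r \<le> 0" using assms(2) by (simp add: mult_le_0_iff)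
  then have "D c e \<le> 0" using \<open>D c e = r * D a e\<close> \<open>D a e \<ge> 0\<close> by (simp add: mult_nonpos_nonneg)
  then show False using assms(3) by simp
qed

text \<open>As in \<open>D_pos_forward\<close>, but with a reference column \<open>w\<close> on the
  left: it gives \<open>r \<ge> 0\<close>, while \<open>D b c > 0\<close> needs
  \<open>r < 0\<close>.\<close>

lemma D_pos_backward:
  assumes "supp a" "D w a > 0" "D b c > 0" "1 \<le> w" "w < a" "a < b" "b < c" "c \<le> n"
  shows "D a c > 0"
proof (rule ccontr)
  assume neg: "\<not> ?thesis"
  have a: "1 \<le> a" "a \<le> n" "d a \<noteq> a" using assms(1) by (auto simp: supp_def)
  have "D a c \<ge> 0" by (rule D_nonneg) (use assms a in linarith)+
  then have "D a c = 0" using neg by linarith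
  from parallel_multiple[OF zero_sym[OF this] a] obtain r where r: "x c = r * x a" "y c = r * y a" .
  have "D b c = - r * D a b" "D w c = r * D w a" using r by (auto simp: D_def algebra_simps)
  moreover have "D w c \<ge> 0" "D a b \<ge> 0" by (rule D_nonneg; use assms a in linarith)+
  ultimately have "r \<ge> 0" using assms(2) by (simp add: zero_le_mult_iff)
  then have "D b c \<le> 0" using \<open>D b c = - r * D a b\<close> \<open>D a b \<ge> 0\<close> by simp
  then show False using assms(3) by simp
qed

lemma plucker: "D a c * D b e = D a b * D c e + D a e * D b c"
  by (simp add: D_def algebra_simps)

text \<open>Cramer's rule. A generator made of the minors against a fixed column vanishes at all
  columns parallel to it, so a good choice of two reference columns gives sparse generators.\<close>

lemma plane_minors:
  assumes n: "n = Suc N" and nz: "D b c \<noteq> 0" and s: "s = 1 \<or> s = - 1"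
  shows "V = plane N (\<lambda>a. D (Suc a) c) (\<lambda>a. s * D (Suc a) b)" (is "_ = plane N ?f ?g")
proof -
  have V: "V = plane N (\<lambda>a. x (Suc a)) (\<lambda>a. y (Suc a))" (is "_ = plane N ?x ?y")
    using data unfolding sequence_data_def plane_def n by simp
  show ?thesis unfolding V
  proof
    have key: "D b c * x a = x b * D a c - x c * D a b" "D b c * y a = y b * D a c - y c * D a b" for a
      by (simp_all add: D_def algebra_simps)
    have "x (Suc a) = x b / D b c * D (Suc a) c + - s * x c / D b c * (s * D (Suc a) b)"
      "y (Suc a) = y b / D b c * D (Suc a) c + - s * y c / D b c * (s * D (Suc a) b)" for a
      using s nz key(1)[of "Suc a"] key(2)[of "Suc a"] by (auto simp: field_simps)
    then show "plane N ?x ?y \<subseteq> plane N ?f ?g" by (intro plane_subset plane_memI)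
    show "plane N ?f ?g \<subseteq> plane N ?x ?y"
      by (intro plane_subset plane_memI[of _ _ "y c" _ "- x c"] plane_memI[of _ _ "s * y b" _ "- s * x b"])
        (simp_all add: D_def algebra_simps)
  qed
qed

text \<open>Minors against \<open>?L\<close> vanish on the second chord, those against
  \<open>?I\<close> on the first, except where the inner dominoes overlap.\<close>

lemma perm_S_form:
  assumes n: "n = Suc N" and idx: "i + 2 \<le> j" "j \<le> k" "k + 2 \<le> l" "l + 1 < N"
    and d: "d = perm_S n (Suc i) (Suc j) (Suc k) (Suc l)"
  shows "is_form N V"
proof -
  let ?I = "Suc i" and ?I' = "Suc (Suc i)" and ?J = "Suc j" and ?J' = "Suc (Suc j)"
    and ?K = "Suc k" and ?K' = "Suc (Suc k)" and ?L = "Suc l" and ?L' = "Suc (Suc l)"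
  have fx: "d a = a" if "a \<notin> {?I, ?I', ?J, ?J', ?K, ?K', ?L, ?L', n}" for a
    using that by (simp add: d perm_S_def)
  have v: "d ?I = ?I'" "d ?I' = (if j = k then ?J' else ?J)"
    "d ?J = (if j = k then ?L else if Suc j = k then ?K' else ?J')" "d ?J' = n" "d n = ?K"
    "Suc j < k \<Longrightarrow> d ?K = ?K'" "j < k \<Longrightarrow> d ?K' = ?L" "d ?L = ?L'" "d ?L' = ?I"
    using idx n by (auto simp: d perm_S_def)
  have nf: "d ?I \<noteq> ?I" "d ?I' \<noteq> ?I'" "d ?J \<noteq> ?J" "d ?J' \<noteq> ?J'" "d ?L \<noteq> ?L" "d ?L' \<noteq> ?L'" "d n \<noteq> n"
    using v idx n by auto
  have nfK: "d ?K \<noteq> ?K" "d ?K' \<noteq> ?K'"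
    using v idx n by (cases "j = k"; cases "Suc j = k"; auto)+
  note nf = nf nfK
  have nn: "Suc (Suc l) < n" using idx n by simp
  have sI: "supp ?I" using nf(1) idx nn by (simp add: supp_def)
  have sI': "supp ?I'" using nf(2) idx nn by (simp add: supp_def)
  have sJ: "supp ?J" using nf(3) idx nn by (simp add: supp_def)
  have sJ': "supp ?J'" using nf(4) idx nn by (simp add: supp_def)
  have sL: "supp ?L" using nf(5) idx nn by (simp add: supp_def)
  have sL': "supp ?L'" using nf(6) idx nn by (simp add: supp_def)
  have sn: "supp n" using nf(7) idx nn by (simp add: supp_def)
  have sK: "supp ?K" using nf(8) idx nn by (simp add: supp_def)
  have sK': "supp ?K'" using nf(9) idx nn by (simp add: supp_def)
  have l1: "D ?I ?I' = 0" by (rule D_link) (use v(1) idx nn  in auto)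
  have l6: "D ?L ?L' = 0" by (rule D_link) (use v(8) idx nn  in auto)
  have n7: "D ?L' n > 0" by (rule nonlink[OF sL' sn]) (use v(9) idx nn  in auto)
  have n8: "D ?L n > 0" by (rule par_left[OF l6 sL n7]) (use idx nn  in auto)
  \<comment> \<open>These signs depend on whether the inner dominoes are disjoint, share one column
    or coincide. Each is derived by transporting positivity along parallel columns and across
    \<open>D_pos_forward\<close>.\<close>
  have facts: "D ?I ?L > 0 \<and> D ?I' ?L > 0 \<and> D ?J ?L > 0 \<and> D ?J' ?L > 0
      \<and> D ?I ?K > 0 \<and> D ?I ?K' > 0 \<and> D ?I ?L' > 0
      \<and> (j < k \<longrightarrow> D ?I ?J = 0) \<and> (Suc j < k \<longrightarrow> D ?I ?J' = 0)
      \<and> (j < k \<longrightarrow> D ?K' ?L = 0) \<and> (Suc j < k \<longrightarrow> D ?K ?L = 0)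
      \<and> (j = k \<longrightarrow> D ?J ?J' > 0)"
  proof -
    consider (a) "Suc j < k" | (b) "Suc j = k" | (c) "j = k" using idx by linarith
    then show ?thesis
    proof cases
      case a
      have l2: "D ?I' ?J = 0" by (rule D_link) (use v(2) idx nn a in \<open>auto intro!: fx\<close>)
      have l3: "D ?J ?J' = 0" by (rule D_link) (use v(3) idx nn a in auto)
      have l4: "D ?K ?K' = 0" by (rule D_link) (use v(6) idx nn a in auto)
      have l5: "D ?K' ?L = 0" by (rule D_link) (use v(7) idx nn a in \<open>auto intro!: fx\<close>)
      have kl: "D ?K ?L = 0" by (rule par_zero[OF l4 sK' l5])
      have p1: "D ?J' ?K > 0" by (rule nonlink[OF sJ' sK]) (use v(4) idx nn a in auto)
      have p2: "D ?J ?K > 0" by (rule par_left[OF l3 sJ p1]) (use idx nn a in auto)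
      have p3: "D ?I' ?K > 0" by (rule par_left[OF l2 sI' p2]) (use idx nn a in auto)
      have p4: "D ?I ?K > 0" by (rule par_left[OF l1 sI p3]) (use idx nn a in auto)
      have r: "D x ?L > 0" if "D x ?K > 0" "1 \<le> x" "x < ?L" for x
        by (rule par_right[OF kl sL that(1,2)]) (use that in auto)
      have p5: "D ?I ?K' > 0" by (rule par_right[OF l4 sK' p4]) (use idx nn a in auto)
      have p6: "D ?I ?L > 0" by (rule r) (use p4 idx in auto)
      have p7: "D ?I ?L' > 0" by (rule par_right[OF l6 sL' p6]) (use idx nn a in auto)
      have z1: "D ?I ?J = 0" by (rule par_zero[OF l1 sI' l2])
      have z2: "D ?I ?J' = 0" by (rule par_zero[OF z1 sJ l3])
      show ?thesis using p4 p5 p6 p7 z1 z2 l5 kl r[of ?I'] r[of ?J] r[of ?J'] p1 p2 p3 a idx by auto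
    next
      case b
      have l2: "D ?I' ?J = 0" by (rule D_link) (use v(2) idx nn b in \<open>auto intro!: fx\<close>)
      have l5: "D ?K' ?L = 0" by (rule D_link) (use v(7) idx nn b in \<open>auto intro!: fx\<close>)
      have p1: "D ?J ?K > 0" by (rule nonlink[OF sJ sK]) (use v(3) idx nn b in auto)
      have dK: "d ?K = n" using v(4) b by simp
      have p2: "D ?K ?K' > 0" by (rule nonlink[OF sK sK']) (use dK idx nn b in auto)
      have p3: "D ?K ?L > 0" by (rule par_right[OF l5 sL p2]) (use idx nn b in auto)
      have p4: "D ?J ?L > 0" by (rule D_pos_forward[OF sJ p1 n8]) (use idx nn b in auto)
      have p5: "D ?I' ?L > 0" by (rule par_left[OF l2 sI' p4]) (use idx nn b in auto)
      have p6: "D ?I ?L > 0" by (rule par_left[OF l1 sI p5]) (use idx nn b in auto)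
      have p7: "D ?I' ?K > 0" by (rule par_left[OF l2 sI' p1]) (use idx nn b in auto)
      have p8: "D ?I ?K > 0" by (rule par_left[OF l1 sI p7]) (use idx nn b in auto)
      have p9: "D ?I ?K' > 0" by (rule par_right[OF zero_sym[OF l5] sK' p6]) (use idx nn b in auto)
      have p10: "D ?I ?L' > 0" by (rule par_right[OF l6 sL' p6]) (use idx nn b in auto)
      have z1: "D ?I ?J = 0" by (rule par_zero[OF l1 sI' l2])
      show ?thesis using p3 p4 p5 p6 p8 p9 p10 z1 l5 b by auto
    next
      case c
      have p1: "D ?I' ?J > 0" by (rule nonlink[OF sI' sJ]) (use v(2) idx nn c in auto)
      have p2: "D ?J ?J' > 0" by (rule nonlink[OF sJ sJ']) (use v(3) idx nn c in auto)
      have p3: "D ?J' ?L > 0" by (rule nonlink[OF sJ' sL]) (use v(4) idx nn c in auto)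
      have p4: "D ?J ?L > 0" by (rule D_pos_forward[OF sJ p2 n8]) (use idx nn c in auto)
      have p5: "D ?I' ?L > 0" by (rule D_pos_forward[OF sI' p1 n8]) (use idx nn c in auto)
      have p6: "D ?I ?L > 0" by (rule par_left[OF l1 sI p5]) (use idx nn c in auto)
      have p7: "D ?I ?J > 0" by (rule par_left[OF l1 sI p1]) (use idx nn c in auto)
      have p8: "D ?I ?J' > 0" by (rule D_pos_forward[OF sI p7 p3]) (use idx nn c in auto)
      have p9: "D ?I ?L' > 0" by (rule par_right[OF l6 sL' p6]) (use idx nn c in auto)
      show ?thesis using p2 p3 p4 p5 p6 p7 p8 p9 c by auto
    qed
  qed
  have z: "D a b = 0" "D b a = 0" if "a \<notin> {?I, ?I', ?J, ?J', ?K, ?K', ?L, ?L', n}" "1 \<le> a" "a \<le> n" for a b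
    using D_zero[OF that(2,3) fx[OF that(1)]] by auto
  have V: "V = plane N (\<lambda>a. D (Suc a) ?L) (\<lambda>a. - 1 * D (Suc a) ?I)"
    by (rule plane_minors[OF n]) (use facts in auto)
  show ?thesis unfolding V
  proof (rule form_S_I[OF idx])
    show "D ?I ?L > 0" "D ?I' ?L > 0" "D ?J ?L > 0" "D ?J' ?L > 0" using facts by auto
    show "- 1 * D ?K ?I > 0" "- 1 * D ?K' ?I > 0" "- 1 * D ?L ?I > 0" "- 1 * D ?L' ?I > 0"
      using facts D_anti[of ?I] by auto
    show "D (Suc N) ?L \<le> 0" using n8 D_anti[of ?L "Suc N"] n by simp
    show "- 1 * D (Suc N) ?I \<ge> 0" using D_nonneg[of ?I "Suc N"] D_anti[of ?I "Suc N"] n idx by simp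
    show "D (Suc a) ?L = 0" if a: "a < N" "a \<noteq> i" "a \<noteq> Suc i" "a \<noteq> j" "a \<noteq> Suc j" for a
    proof (cases "a \<in> {k, Suc k, l, Suc l}")
      case True
      have "D ?L ?L = 0" by (simp add: D_def)
      moreover have "Suc j < k" if "a = k" using a idx that by linarith
      moreover have "j < k" if "a = Suc k" using a idx that by linarith
      ultimately show ?thesis using True facts zero_sym[OF l6] by auto
    next
      case False
      then show ?thesis using a n by (intro z) auto
    qed
    show "- 1 * D (Suc a) ?I = 0" if a: "a < N" "a \<noteq> k" "a \<noteq> Suc k" "a \<noteq> l" "a \<noteq> Suc l" for a
    proof (cases "a \<in> {i, Suc i, j, Suc j}")
      case True
      have "D ?I ?I = 0" by (simp add: D_def)
      moreover have "D ?J ?I = 0" if "a = j"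
      proof -
        have c: "j < k" using a idx that by linarith
        show ?thesis by (rule zero_sym) (use facts c in blast)
      qed
      moreover have "D ?J' ?I = 0" if "a = Suc j"
      proof -
        have c: "Suc j < k" using a idx that by linarith
        show ?thesis by (rule zero_sym) (use facts c in blast)
      qed
      ultimately show ?thesis using True zero_sym[OF l1] by auto
    next
      case False
      then show ?thesis using a n z[of "Suc a" ?I] by auto
    qed
    show "D ?J ?L * (- 1 * D ?J' ?I) > D ?J' ?L * (- 1 * D ?J ?I)" if "j = k"
    proof -
      \<comment> \<open>By the three-term Pluecker relation this product is the difference of the
        two sides.\<close>
      have "D ?I ?L * D ?J ?J' > 0" using facts that by auto
      then show ?thesis using plucker[of ?I ?J' ?J ?L] D_anti[of ?I ?J'] D_anti[of ?I ?J]
        by (simp add: algebra_simps)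
    qed
  qed
qed

text \<open>Minors against \<open>?K'\<close> vanish on the inner chord and give the outer
  generator; minors against \<open>n\<close> vanish at the right end of the outer chord. Overlaps
  are again the exception.\<close>

lemma perm_N_form:
  assumes n: "n = Suc N" and idx: "i < k" "k + 2 \<le> l" "l \<le> j" "j + 1 < N"
    and d: "d = perm_N n (Suc i) (Suc j) (Suc k) (Suc l)"
  shows "is_form N V"
proof -
  let ?I = "Suc i" and ?I' = "Suc (Suc i)" and ?J = "Suc j" and ?J' = "Suc (Suc j)"
    and ?K = "Suc k" and ?K' = "Suc (Suc k)" and ?L = "Suc l" and ?L' = "Suc (Suc l)"
  have fx: "d a = a" if "a \<notin> {?I, ?I', ?J, ?J', ?K, ?K', ?L, ?L', n}" for a
    using that by (simp add: d perm_N_def)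
  have v: "d ?I = (if k = Suc i then ?K' else ?I')" "d ?I' = ?J" "Suc i < k \<Longrightarrow> d ?K = ?K'"
    "d ?K' = (if l = j then ?J' else ?L)" "d ?L' = ?I"
    "d ?L = (if l = j then n else if Suc l = j then ?J' else ?L')" "Suc l < j \<Longrightarrow> d ?J = ?J'"
    "l < j \<Longrightarrow> d ?J' = n" "d n = ?K"
    using idx n by (auto simp: d perm_N_def)
  have nf: "d ?I \<noteq> ?I" "d ?I' \<noteq> ?I'" "d ?K' \<noteq> ?K'" "d ?L \<noteq> ?L" "d ?L' \<noteq> ?L'" "d n \<noteq> n"
    using v idx n by auto
  have nf': "d ?K \<noteq> ?K" "d ?J \<noteq> ?J" "d ?J' \<noteq> ?J'"
  proof -
    show "d ?K \<noteq> ?K" using v(3) nf(2) idx by (cases "Suc i = k") auto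
    consider (a) "Suc l < j" | (b) "Suc l = j" | (c) "l = j" using idx by linarith
    then show "d ?J \<noteq> ?J"
    proof cases
      case a
      then show ?thesis using v(7) by simp
    next
      case b
      then show ?thesis using nf(5) by simp
    next
      case c
      then show ?thesis using nf(4) by simp
    qed
    show "d ?J' \<noteq> ?J'" using v(8) nf(5) idx n by (cases "l = j") auto
  qed
  note nf = nf nf'
  have nn: "Suc (Suc j) < n" using idx n by simp
  have sI: "supp ?I" using nf(1) idx nn by (simp add: supp_def)
  have sI': "supp ?I'" using nf(2) idx nn by (simp add: supp_def)
  have sK': "supp ?K'" using nf(3) idx nn by (simp add: supp_def)
  have sL: "supp ?L" using nf(4) idx nn by (simp add: supp_def)
  have sL': "supp ?L'" using nf(5) idx nn by (simp add: supp_def)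
  have sn: "supp n" using nf(6) idx nn by (simp add: supp_def)
  have sK: "supp ?K" using nf(7) idx nn by (simp add: supp_def)
  have sJ: "supp ?J" using nf(8) idx nn by (simp add: supp_def)
  have sJ': "supp ?J'" using nf(9) idx nn by (simp add: supp_def)
  \<comment> \<open>\<open>n\<close> is sent to \<open>?K\<close>, which is beyond
    \<open>?I\<close>, so the return of column \<open>n\<close> wraps around past column
    \<open>?I\<close>.\<close>
  have w1: "D ?I n > 0" by (rule D_wrap) (use v(9) idx nn sI in \<open>auto simp: supp_def\<close>)
  \<comment> \<open>The left part, with or without overlap at \<open>k = i + 1\<close>. It also
    supplies a column left of \<open>?K'\<close> and not parallel to it, the reference that
    \<open>D_pos_backward\<close> asks for.\<close>
  have A: "D ?K ?K' \<ge> 0 \<and> (\<exists>w. 1 \<le> w \<and> w < ?K' \<and> D w ?K' > 0) \<and> (Suc i < k \<longrightarrow> D ?I' ?K > 0 \<and> D ?I ?I' = 0 \<and> D ?K ?K' = 0) \<and>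
      (k = Suc i \<longrightarrow> D ?I ?K > 0 \<and> D ?K ?K' > 0)"
  proof (cases "k = Suc i")
    case True
    have p1: "D ?I ?K > 0" by (rule nonlink[OF sI sK]) (use v(1) idx nn True in auto)
    have "d ?K = ?J" using v(2) True by simp
    then have p2: "D ?K ?K' > 0" by (intro nonlink[OF sK sK']) (use idx nn True in auto)
    show ?thesis using p1 p2 True by (auto intro!: exI[of _ ?K])
  next
    case False
    have p1: "D ?I' ?K > 0" by (rule nonlink[OF sI' sK]) (use v(2) idx nn False in auto)
    have l1: "D ?I ?I' = 0" by (rule D_link) (use v(1) idx nn False in auto)
    have l2: "D ?K ?K' = 0" by (rule D_link) (use v(3) idx nn False in auto)
    have "D ?I' ?K' > 0" by (rule par_right[OF l2 sK' p1]) (use idx nn False in auto)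
    then show ?thesis using p1 l1 l2 False idx by (auto intro!: exI[of _ ?I'])
  qed
  then obtain w0 where w0: "1 \<le> w0" "w0 < ?K'" "D w0 ?K' > 0" by blast
  \<comment> \<open>The right part, according to whether the dominoes at \<open>l\<close> and
    \<open>j\<close> are disjoint, share one column or coincide.\<close>
  have B: "D ?K' ?J > 0 \<and> D ?K' ?J' > 0 \<and> D ?K' n > 0 \<and> D ?L n > 0 \<and> D ?L' n > 0
    \<and> (Suc l < j \<longrightarrow> D ?J n = 0) \<and> (l < j \<longrightarrow> D ?J' n = 0) \<and> (l < j \<longrightarrow> D ?K' ?L = 0)
    \<and> (Suc l < j \<longrightarrow> D ?K' ?L' = 0) \<and> (l = j \<longrightarrow> D ?J ?J' > 0)"
  proof -
    consider (a) "Suc l < j" | (b) "Suc l = j" | (c) "l = j" using idx by linarith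
    then show ?thesis
    proof cases
      case a
      have l1: "D ?K' ?L = 0" by (rule D_link) (use v(4) idx nn a in \<open>auto intro!: fx\<close>)
      have l2: "D ?L ?L' = 0" by (rule D_link) (use v(6) idx nn a in auto)
      have l3: "D ?J ?J' = 0" by (rule D_link) (use v(7) idx nn a in auto)
      have l4: "D ?J' n = 0" by (rule D_link) (use v(8) idx nn a in \<open>auto intro!: fx\<close>)
      have l5: "D ?J n = 0" by (rule par_zero[OF l3 sJ' l4])
      have l6: "D ?K' ?L' = 0" by (rule par_zero[OF l1 sL l2])
      have p1: "D ?L' ?J > 0" by (rule nonlink[OF sL' sJ]) (use v(5) idx nn a in auto)
      have p2: "D ?K' ?J > 0" by (rule par_left[OF l6 sK' p1]) (use idx nn a in auto)
      have p3: "D ?K' ?J' > 0" by (rule par_right[OF l3 sJ' p2]) (use idx nn a in auto)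
      have p4: "D ?K' n > 0" by (rule par_right[OF l5 sn p2]) (use idx nn a in auto)
      have p5: "D ?L n > 0" by (rule par_left[OF zero_sym[OF l1] sL p4]) (use idx nn a in auto)
      have p6: "D ?L' n > 0" by (rule par_left[OF zero_sym[OF l6] sL' p4]) (use idx nn a in auto)
      show ?thesis using p2 p3 p4 p5 p6 l1 l4 l5 l6 a by auto
    next
      case b
      have l1: "D ?K' ?L = 0" by (rule D_link) (use v(4) idx nn b in \<open>auto intro!: fx\<close>)
      have l4: "D ?J' n = 0" by (rule D_link) (use v(8) idx nn b in \<open>auto intro!: fx\<close>)
      have dJ: "d ?J = ?I" using v(5) b by simp
      have p1: "D ?L ?J > 0" by (rule nonlink[OF sL sJ]) (use v(6) idx nn b in auto)
      have p2: "D ?J ?J' > 0" by (rule nonlink[OF sJ sJ']) (use dJ idx nn b in auto)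
      have p3: "D ?K' ?J > 0" by (rule par_left[OF l1 sK' p1]) (use idx nn b in auto)
      have p4: "D ?J n > 0" by (rule par_right[OF l4 sn p2]) (use idx nn b in auto)
      have p5: "D ?K' ?J' > 0" by (rule D_pos_backward[OF sK' w0(3) p2]) (use idx nn w0(1,2) b in auto)
      have p6: "D ?K' n > 0" by (rule D_pos_backward[OF sK' w0(3) p4]) (use idx nn w0(1,2) b in auto)
      have p7: "D ?L n > 0" by (rule par_left[OF zero_sym[OF l1] sL p6]) (use idx nn b in auto)
      show ?thesis using p3 p4 p5 p6 p7 l1 l4 b by auto
    next
      case c
      have dJ: "d ?J = n" "d ?J' = ?I" using v(5,6) c by auto
      have p1: "D ?K' ?J > 0" by (rule nonlink[OF sK' sJ]) (use v(4) idx nn c in auto)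
      have p2: "D ?J ?J' > 0" by (rule nonlink[OF sJ sJ']) (use dJ idx nn c in auto)
      have p3: "D ?J' n > 0" by (rule nonlink[OF sJ' sn]) (use dJ idx nn c in auto)
      have p5: "D ?K' ?J' > 0" by (rule D_pos_backward[OF sK' w0(3) p2]) (use idx nn w0(1,2) c in auto)
      have p6: "D ?K' n > 0" by (rule D_pos_backward[OF sK' w0(3) p3]) (use idx nn w0(1,2) c in auto)
      have p7: "D ?J n > 0" by (rule D_pos_backward[OF sJ p1 p3]) (use idx nn  c in auto)
      show ?thesis using p1 p2 p3 p5 p6 p7 c by auto
    qed
  qed
  have C: "D ?I ?K' > 0 \<and> D ?I' ?K' > 0 \<and> D ?I' n > 0 \<and> D ?K n > 0"
  proof (cases "k = Suc i")
    case True
    have A': "D ?I ?K > 0" "D ?K ?K' > 0" and B': "D ?K' n > 0" using A B True by blast+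
    have p1: "D ?I ?K' > 0" by (rule D_pos_forward[OF sI A'(1) B']) (use idx nn in auto)
    have p2: "D ?K n > 0" by (rule D_pos_backward[OF sK A'(1) B']) (use idx nn in auto)
    show ?thesis using p1 p2 A True by auto
  next
    case False
    then have lt: "Suc i < k" using idx by simp
    have A': "D ?I' ?K > 0" "D ?I ?I' = 0" "D ?K ?K' = 0" and B': "D ?K' n > 0" using A B lt by blast+
    have p1: "D ?I' ?K' > 0" by (rule par_right[OF A'(3) sK' A'(1)]) (use idx nn lt in auto)
    have p2: "D ?I ?K' > 0" by (rule par_left[OF A'(2) sI p1]) (use idx nn lt in auto)
    have p3: "D ?I' n > 0" by (rule D_wrap) (use v(9) idx nn sI' lt in \<open>auto simp: supp_def\<close>)
    have p4: "D ?K n > 0" by (rule par_left[OF A'(3) sK B']) (use idx nn lt in auto)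
    show ?thesis using p1 p2 p3 p4 by auto
  qed
  have z: "D a b = 0" "D b a = 0" if "a \<notin> {?I, ?I', ?J, ?J', ?K, ?K', ?L, ?L', n}" "1 \<le> a" "a \<le> n" for a b
    using D_zero[OF that(2,3) fx[OF that(1)]] by auto
  have V: "V = plane N (\<lambda>a. D (Suc a) ?K') (\<lambda>a. 1 * D (Suc a) n)"
    by (rule plane_minors[OF n]) (use B D_anti[of ?K' n] in auto)
  show ?thesis unfolding V
  proof (rule form_N_I[OF idx])
    show "D ?I ?K' > 0" "D ?I' ?K' > 0" using C by auto
    show "D ?J ?K' < 0" "D ?J' ?K' < 0" "D (Suc N) ?K' < 0"
      using B D_anti[of ?K'] n by auto
    show "1 * D ?I n > 0" "1 * D ?I' n > 0" "1 * D ?K n > 0" "1 * D ?K' n > 0" "1 * D ?L n > 0" "1 * D ?L' n > 0"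
      using w1 B C by auto
    show "D (Suc a) ?K' = 0" if a: "a < N" "a \<noteq> i" "a \<noteq> Suc i" "a \<noteq> j" "a \<noteq> Suc j" for a
    proof (cases "a \<in> {k, Suc k, l, Suc l}")
      case True
      have "D ?K' ?K' = 0" by (simp add: D_def)
      moreover have "D ?K ?K' = 0" if "a = k"
      proof -
        have "Suc i < k" using a idx that by linarith
        then show ?thesis using A by blast
      qed
      moreover have "D ?L ?K' = 0" if "a = l"
      proof -
        have c: "l < j" using a idx that by linarith
        show ?thesis by (rule zero_sym) (use B c in blast)
      qed
      moreover have "D ?L' ?K' = 0" if "a = Suc l"
      proof -
        have c: "Suc l < j" using a idx that by linarith
        show ?thesis by (rule zero_sym) (use B c in blast)
      qed
      ultimately show ?thesis using True by auto
    next
      case False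
      then show ?thesis using a n by (intro z) auto
    qed
    show "1 * D (Suc a) n = 0"
      if a: "a \<le> N" "a \<noteq> i" "a \<noteq> Suc i" "a \<noteq> k" "a \<noteq> Suc k" "a \<noteq> l" "a \<noteq> Suc l" for a
    proof (cases "a \<in> {j, Suc j, N}")
      case True
      have "D n n = 0" by (simp add: D_def)
      moreover have "D ?J n = 0" if "a = j"
      proof -
        have "Suc l < j" using a idx that by linarith
        then show ?thesis using B by blast
      qed
      moreover have "D ?J' n = 0" if "a = Suc j"
      proof -
        have "l < j" using a idx that by linarith
        then show ?thesis using B by blast
      qed
      ultimately show ?thesis using True n by auto
    next
      case False
      then show ?thesis using a n z[of "Suc a" n] by auto
    qed
    show "1 * D ?I n * D ?I' ?K' = 1 * D ?I' n * D ?I ?K'" if "Suc i < k"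
      using plucker[of ?I ?K' ?I' n] plucker[of ?I ?I' ?K' n] A that D_anti[of ?I' ?K'] by (simp add: algebra_simps)
    show "1 * D ?K n * D ?I ?K' > 1 * D ?I n * D ?K ?K'" if "Suc i = k"
    proof -
      have "D ?I ?K * D ?K' n > 0" using A B that by auto
      then show ?thesis using plucker[of ?I ?K' ?K n] by (simp add: algebra_simps)
    qed
    show "1 * D ?J n * D ?J' ?K' < 1 * D ?J' n * D ?J ?K'" if "l = j"
    proof -
      have "D ?K' n * D ?J ?J' > 0" using B that by auto
      then show ?thesis using plucker[of ?K' ?J' ?J n] D_anti[of ?K' ?J] D_anti[of ?K' ?J'] by (simp add: algebra_simps)
    qed
  qed
qed

end

section \<open>Trips as runs along half-edges\<close>

text \<open>\<open>a\<close> is the half-edge at the vertex just reached, \<open>g\<close> the one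
  along which the trip goes on; at a black vertex \<open>g\<close> is the clockwise predecessor of
  \<open>a\<close>.\<close>

definition turn :: "plabic \<Rightarrow> nat \<Rightarrow> nat \<Rightarrow> bool" where
  "turn G a g \<longleftrightarrow> g \<in> halves G \<and>
     ((\<exists>t. vert G a = Internal t White \<and> g = cw G a) \<or> (\<exists>t. vert G a = Internal t Black \<and> cw G g = a))"

text \<open>\<open>run G mk h L a\<close>: the trip leaving along \<open>h\<close> reaches its end vertex along an edge whose half
  there is \<open>a\<close>; on the way it collects the marks \<open>mk\<close> of the half-edges after \<open>h\<close>.\<close>

inductive run :: "plabic \<Rightarrow> (nat \<Rightarrow> nat list) \<Rightarrow> nat \<Rightarrow> nat list \<Rightarrow> nat \<Rightarrow> bool" for G mk where
  stop: "run G mk h [] (opp G h)"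
| step: "turn G (opp G h) g \<Longrightarrow> run G mk g L a \<Longrightarrow> run G mk h (mk g @ L) a"

lemma run_append:
  assumes "run G mk h L a" "turn G a g" "run G mk g L' a'"
  shows "run G mk h (L @ mk g @ L') a'"
  using assms(1,2)
proof (induction rule: run.induct)
  case (stop h)
  then show ?case using run.step[OF _ assms(3)] by simp
next
  case (step h g' L a)
  then show ?case using run.step[of G h g' mk] by simp
qed

lemma run_step_nil: "turn G (opp G h) g \<Longrightarrow> mk g = [] \<Longrightarrow> run G mk g L a \<Longrightarrow> run G mk h L a"
  using run.step[of G h g mk L a] by simp

lemma run_trip_ends:
  assumes "run G mk h L a" "vert G a = Boundary j"
  shows "trip_ends G h j"
  using assms
proof (induction rule: run.induct)
  case (stop h)
  then show ?case by (simp add: trip_ends.boundary)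
next
  case (step h g L a)
  then show ?case unfolding turn_def by (metis trip_ends.white trip_ends.black)
qed

text \<open>At black vertices the continuation is only given as a preimage under \<open>cw\<close>,
  which injectivity makes unique.\<close>

lemma trip_ends_unique:
  assumes "inj_on (cw G) (halves G)" "trip_ends G h j" "trip_ends G h j'"
  shows "j = j'"
  using assms(2,3)
proof (induction arbitrary: j' rule: trip_ends.induct)
  case (boundary h j)
  from boundary(2) show ?case by (cases rule: trip_ends.cases) (use boundary(1) in auto)
next
  case (white h t j)
  from white.prems have "trip_ends G (cw G (opp G h)) j'"
    by (cases rule: trip_ends.cases) (use white.hyps(1) in simp_all)
  then show ?case by (rule white.IH)
next
  case (black h t g j)
  from black.prems obtain g' where g': "g' \<in> halves G" "cw G g' = opp G h" "trip_ends G g' j'"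
    by (cases rule: trip_ends.cases) (use black.hyps(1) in simp_all)
  have "g' = g" using g' black.hyps(2,3) assms(1) by (metis inj_onD)
  then show ?case using g'(3) black.IH by blast
qed

text \<open>The invariant kept by blowing up, with \<open>out b\<close> the half-edge at boundary
  vertex \<open>b\<close>. The places where blowing up is allowed are the boundary vertices strictly
  between 1 and \<open>N\<close>. Their neighbours are internal and pairwise distinct, and each has
  one marked half-edge, so the marks of a trip tell where it can be cut.\<close>

locale plabic_data =
  fixes G :: plabic and N :: nat and out :: "nat \<Rightarrow> nat" and col :: "nat \<Rightarrow> color"
    and mk :: "nat \<Rightarrow> nat list"
  assumes num: "num_boundary G = N" and N4: "4 \<le> N"
    and opp_in: "h \<in> halves G \<Longrightarrow> opp G h \<in> halves G"
    and opp_opp: "h \<in> halves G \<Longrightarrow> opp G (opp G h) = h"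
    and cw_in: "h \<in> halves G \<Longrightarrow> cw G h \<in> halves G"
    and vert_cw: "h \<in> halves G \<Longrightarrow> vert G (cw G h) = vert G h"
    and cw_inj: "inj_on (cw G) (halves G)"
    and bdry: "h \<in> halves G \<Longrightarrow> vert G h = Boundary b \<Longrightarrow> 1 \<le> b \<and> b \<le> N \<and> h = out b"
    and out: "1 \<le> b \<Longrightarrow> b \<le> N \<Longrightarrow> out b \<in> halves G \<and> vert G (out b) = Boundary b"
    and leaf: "2 \<le> b \<Longrightarrow> b < N \<Longrightarrow> \<exists>t. vert G (opp G (out b)) = Internal t (col b)"
    and leaf_inj: "2 \<le> b \<Longrightarrow> b < N \<Longrightarrow> 2 \<le> b' \<Longrightarrow> b' < N \<Longrightarrow>
      vert G (opp G (out b)) = vert G (opp G (out b')) \<Longrightarrow> b = b'"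
    and mk_thr: "2 \<le> b \<Longrightarrow> b < N \<Longrightarrow>
      mk (if col b = Black then cw G (opp G (out b)) else cw G (cw G (opp G (out b)))) = [b]"
    and mk_other: "(\<And>b. 2 \<le> b \<Longrightarrow> b < N \<Longrightarrow>
      g \<noteq> (if col b = Black then cw G (opp G (out b)) else cw G (cw G (opp G (out b))))) \<Longrightarrow> mk g = []"
begin

text \<open>The half-edge along which the trip through the vertex at the boundary vertex \<open>b\<close>, but not
  along the boundary edge, leaves this vertex. It carries the mark \<open>b\<close>.\<close>

definition thr :: "nat \<Rightarrow> nat" where
  "thr b = (if col b = Black then cw G (opp G (out b)) else cw G (cw G (opp G (out b))))"

lemma mk_thr': "2 \<le> b \<Longrightarrow> b < N \<Longrightarrow> mk (thr b) = [b]" using mk_thr by (simp add: thr_def)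

lemma mk_other': "(\<And>b. 2 \<le> b \<Longrightarrow> b < N \<Longrightarrow> g \<noteq> thr b) \<Longrightarrow> mk g = []"
  using mk_other[of g] by (simp add: thr_def)

lemma mk_cases: "mk g = [] \<or> (\<exists>b. 2 \<le> b \<and> b < N \<and> g = thr b \<and> mk g = [b])"
proof (cases "\<exists>b. 2 \<le> b \<and> b < N \<and> g = thr b")
  case True
  then show ?thesis using mk_thr' by blast
next
  case False
  then have "mk g = []" by (intro mk_other') blast
  then show ?thesis ..
qed

lemma leaf_half: "2 \<le> b \<Longrightarrow> b < N \<Longrightarrow> opp G (out b) \<in> halves G"
  using out[of b] opp_in by simp

lemma vert_thr: "2 \<le> b \<Longrightarrow> b < N \<Longrightarrow> vert G (thr b) = vert G (opp G (out b))"
  using leaf_half[of b] vert_cw cw_in by (simp add: thr_def)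

lemma thr_half: "2 \<le> b \<Longrightarrow> b < N \<Longrightarrow> thr b \<in> halves G"
  using leaf_half[of b] cw_in by (simp add: thr_def)

text \<open>Supplies the two pieces into which blowing up at \<open>b\<close> cuts the transverse
  trip.\<close>

lemma run_split:
  assumes "run G mk h L a" "L = l1 @ b # l2" "b \<notin> set l1" "2 \<le> b" "b < N"
  shows "\<exists>g. run G mk h l1 (opp G g) \<and> turn G (opp G g) (thr b) \<and> run G mk (thr b) l2 a"
  using assms
proof (induction arbitrary: l1 rule: run.induct)
  case (step h g L a)
  from mk_cases[of g] show ?case
  proof
    assume "mk g = []"
    then show ?case using step.IH[of l1] step.prems step.hyps run_step_nil[of G h g mk] by auto
  next
    assume "\<exists>c. 2 \<le> c \<and> c < N \<and> g = thr c \<and> mk g = [c]"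
    then obtain c where c: "g = thr c" "mk g = [c]" by blast
    show ?case
    proof (cases l1)
      case Nil
      then have "c = b" "L = l2" using c step.prems by auto
      then show ?thesis using c Nil step.hyps run.stop[of G mk h] by blast
    next
      case (Cons c' l1')
      then have L: "L = l1' @ b # l2" and c': "c' = c" using c step.prems by auto
      then obtain g0 where g0: "run G mk g l1' (opp G g0)" "turn G (opp G g0) (thr b)" "run G mk (thr b) l2 a"
        using step.IH[of l1'] step.prems Cons by auto
      have "run G mk h (mk g @ l1') (opp G g0)" by (rule run.step[OF step.hyps(1) g0(1)])
      then show ?thesis using g0 c Cons c' by auto
    qed
  qed
qed simp

lemma run_from_leaf:
  assumes "run G mk (opp G (out b)) L a" "1 \<le> b" "b \<le> N"
  shows "L = [] \<and> a = out b"
proof -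
  have o: "opp G (opp G (out b)) = out b" using out[OF assms(2,3)] opp_opp by simp
  from assms(1) show ?thesis
  proof (cases rule: run.cases)
    case (step g L')
    then show ?thesis using o out[OF assms(2,3)] by (simp add: turn_def)
  qed (use o in auto)
qed

text \<open>Boundary vertex \<open>b\<close> is entered only through its boundary edge. Removing
  this last step, which carries no mark, isolates the piece to be rerouted.\<close>

lemma run_last:
  assumes "run G mk h L a" "a = out b" "h \<in> halves G" "h \<noteq> opp G (out b)" "1 \<le> b" "b \<le> N" "mk (opp G (out b)) = []"
  shows "\<exists>g. run G mk h L (opp G g) \<and> turn G (opp G g) (opp G (out b))"
  using assms
proof (induction rule: run.induct)
  case (stop h)
  then have "opp G (opp G h) = opp G (out b)" by simp
  then show ?case using opp_opp[of h] stop by simp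
next
  case (step h g L a)
  show ?case
  proof (cases "g = opp G (out b)")
    case True
    then have "L = []" using run_from_leaf step by simp
    then show ?thesis using True step run.stop[of G mk h] by auto
  next
    case False
    have "g \<in> halves G" using step by (simp add: turn_def)
    then obtain g0 where "run G mk g L (opp G g0)" "turn G (opp G g0) (opp G (out b))"
      using step False by blast
    then show ?thesis using run.step[OF step.hyps(1)] by blast
  qed
qed

lemma trip_perm_run:
  assumes b: "1 \<le> b" "b \<le> N" "1 \<le> q" "q \<le> N" and run: "run G mk (out b) L (out q)"
  shows "trip_perm G b = q"
proof -
  have "trip_ends G (out b) q" using run_trip_ends[OF run] out[OF b(3,4)] by simp
  moreover have "h = out b" if "h \<in> halves G" "vert G h = Boundary b" for h using bdry that by blast
  ultimately have "(THE j. \<exists>h \<in> halves G. vert G h = Boundary b \<and> trip_ends G h j) = q"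
    using out[OF b(1,2)] trip_ends_unique[OF cw_inj] by (intro the_equality) blast+
  then show ?thesis using b num by (simp add: trip_perm_def)
qed

end

section \<open>Trips through a blown-up vertex\<close>

locale blow_up_step = plabic_data G N out col mk
  for G N out col mk +
  fixes i x e f y z ab ba bc cb cd dc da ad :: nat and t ta tb tc td :: nat and c :: color and H :: plabic
  assumes i: "2 \<le> i" "i < N" and x: "x = opp G (out i)" "vert G x = Internal t c" and c: "c = col i"
    and ef: "e = cw G x" "f = cw G e" "cw G f = x" "distinct [x, e, f]"
    and halves_v: "{h \<in> halves G. vert G h = Internal t c} = {x, e, f}"
    and dnew: "distinct [y, z, ab, ba, bc, cb, cd, dc, da, ad]"
    and new: "{y, z, ab, ba, bc, cb, cd, dc, da, ad} \<inter> halves G = {}"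
    and dvert: "distinct [Internal ta Black, Internal tb White, Internal tc Black, Internal td White]"
    and newvert: "{Internal ta Black, Internal tb White, Internal tc Black, Internal td White} \<inter> vert G ` halves G = {}"
    and H: "H = \<lparr> num_boundary = num_boundary G + 1,
           halves = halves G \<union> {y, z, ab, ba, bc, cb, cd, dc, da, ad},
           vert = (\<lambda>h. shift_boundary i (vert G h))
             (e := Internal ta Black, ab := Internal ta Black, ad := Internal ta Black,
              f := Internal tb White, bc := Internal tb White, ba := Internal tb White,
              x := Internal tc Black, cd := Internal tc Black, cb := Internal tc Black,
              y := Internal td White, da := Internal td White, dc := Internal td White, z := Boundary (i + 1)),
           opp = (opp G)
             (y := z, z := y,  ab := ba, ba := ab,  bc := cb, cb := bc,
              cd := dc, dc := cd,  da := ad, ad := da),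
           cw = (cw G)
             (e := ab, ab := ad, ad := e,  f := bc, bc := ba, ba := f,
              x := cd, cd := cb, cb := x,  y := da, da := dc, dc := y,  z := z) \<rparr>"
begin

lemma xef_in: "x \<in> halves G" "e \<in> halves G" "f \<in> halves G"
  using leaf_half[OF i] x cw_in ef by auto

lemma old_not_new:
  assumes "h \<in> halves G"
  shows "h \<noteq> y" "h \<noteq> z" "h \<noteq> ab" "h \<noteq> ba" "h \<noteq> bc" "h \<noteq> cb" "h \<noteq> cd" "h \<noteq> dc" "h \<noteq> da" "h \<noteq> ad"
  using new assms by auto

lemmas xef_not_new = old_not_new[OF xef_in(1)] old_not_new[OF xef_in(2)] old_not_new[OF xef_in(3)]

lemma new_distinct:
  "y \<noteq> z" "y \<noteq> ab" "y \<noteq> ba" "y \<noteq> bc" "y \<noteq> cb" "y \<noteq> cd" "y \<noteq> dc" "y \<noteq> da" "y \<noteq> ad"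
  "z \<noteq> ab" "z \<noteq> ba" "z \<noteq> bc" "z \<noteq> cb" "z \<noteq> cd" "z \<noteq> dc" "z \<noteq> da" "z \<noteq> ad"
  "ab \<noteq> ba" "ab \<noteq> bc" "ab \<noteq> cb" "ab \<noteq> cd" "ab \<noteq> dc" "ab \<noteq> da" "ab \<noteq> ad"
  "ba \<noteq> bc" "ba \<noteq> cb" "ba \<noteq> cd" "ba \<noteq> dc" "ba \<noteq> da" "ba \<noteq> ad"
  "bc \<noteq> cb" "bc \<noteq> cd" "bc \<noteq> dc" "bc \<noteq> da" "bc \<noteq> ad"
  "cb \<noteq> cd" "cb \<noteq> dc" "cb \<noteq> da" "cb \<noteq> ad"
  "cd \<noteq> dc" "cd \<noteq> da" "cd \<noteq> ad" "dc \<noteq> da" "dc \<noteq> ad" "da \<noteq> ad"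
  "x \<noteq> e" "x \<noteq> f" "e \<noteq> f"
  using dnew ef(4) by auto

lemmas neqs = xef_not_new xef_not_new[symmetric] new_distinct new_distinct[symmetric]

lemma halves_H: "halves H = halves G \<union> {y, z, ab, ba, bc, cb, cd, dc, da, ad}"
  by (simp add: H)

lemma vert_H:
  "vert H e = Internal ta Black" "vert H ab = Internal ta Black" "vert H ad = Internal ta Black"
  "vert H f = Internal tb White" "vert H bc = Internal tb White" "vert H ba = Internal tb White"
  "vert H x = Internal tc Black" "vert H cd = Internal tc Black" "vert H cb = Internal tc Black"
  "vert H y = Internal td White" "vert H da = Internal td White" "vert H dc = Internal td White"
  "vert H z = Boundary (i + 1)"
  by (simp_all add: H neqs)

lemma opp_H: "opp H y = z" "opp H z = y" "opp H ab = ba" "opp H ba = ab" "opp H bc = cb" "opp H cb = bc"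
  "opp H cd = dc" "opp H dc = cd" "opp H da = ad" "opp H ad = da"
  by (simp_all add: H neqs)

lemma cw_H: "cw H e = ab" "cw H ab = ad" "cw H ad = e" "cw H f = bc" "cw H bc = ba" "cw H ba = f"
  "cw H x = cd" "cw H cd = cb" "cw H cb = x" "cw H y = da" "cw H da = dc" "cw H dc = y" "cw H z = z"
  by (simp_all add: H neqs)

lemma old_H:
  assumes "h \<in> halves G"
  shows "opp H h = opp G h" "h \<notin> {x, e, f} \<Longrightarrow> vert H h = shift_boundary i (vert G h)"
    "h \<notin> {x, e, f} \<Longrightarrow> cw H h = cw G h"
  using old_not_new[OF assms] by (auto simp: H)

definition out' where "out' b = (if b \<le> i then out b else if b = i + 1 then z else out (b - 1))"
definition col' where "col' b = (if b < i then col b else if b = i then Black else if b = i + 1 then White else col (b - 1))"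
definition sh where "sh b = (if b \<le> i then b else b + 1)"
text \<open>The transverse trip leaves the black vertex next to \<open>i\<close> along
  \<open>cd\<close> and the white vertex next to \<open>i + 1\<close> along \<open>dc\<close>. The
  mark of the replaced vertex disappears.\<close>

definition mk' where
  "mk' g = (if g = cd then [i] else if g = dc then [i + 1] else if g = thr i then [] else map sh (mk g))"

lemma xef_vert: "vert G x = Internal t c" "vert G e = Internal t c" "vert G f = Internal t c"
  using x(2) ef(1,2) vert_cw xef_in by auto

lemma xef_cw: "cw G x = e" "cw G e = f" "cw G f = x"
  using ef by auto

lemma cw_eq_iff: "g \<in> halves G \<Longrightarrow> cw G g \<in> {x, e, f} \<longleftrightarrow> g \<in> {x, e, f}"
proof
  assume g: "g \<in> halves G" and "cw G g \<in> {x, e, f}"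
  then have "cw G g = cw G f \<or> cw G g = cw G x \<or> cw G g = cw G e" unfolding xef_cw by blast
  then show "g \<in> {x, e, f}" using inj_onD[OF cw_inj _ g] xef_in by blast
next
  assume "g \<in> {x, e, f}"
  then show "cw G g \<in> {x, e, f}" using xef_cw by blast
qed

lemma thr_i: "thr i = (if c = Black then e else f)"
  using x(1) c ef(1,2) by (simp add: thr_def)

lemma internal_not_out: "1 \<le> b \<Longrightarrow> b \<le> N \<Longrightarrow> vert G h = Internal t' c' \<Longrightarrow> h \<noteq> out b"
  using out[of b] by auto

lemma leaf_other:
  assumes "2 \<le> b" "b < N" "b \<noteq> i"
  shows "opp G (out b) \<notin> {x, e, f}" "cw G (opp G (out b)) \<notin> {x, e, f}" "thr b \<notin> {x, e, f}" "thr b \<noteq> thr i"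
proof -
  have ne: "vert G (opp G (out b)) \<noteq> Internal t c"
    using leaf_inj[OF assms(1,2) i] assms(3) x by auto
  have h: "opp G (out b) \<in> halves G" by (rule leaf_half[OF assms(1,2)])
  show "opp G (out b) \<notin> {x, e, f}" using ne xef_vert by auto
  show "cw G (opp G (out b)) \<notin> {x, e, f}" using ne xef_vert vert_cw[OF h] by auto
  show t: "thr b \<notin> {x, e, f}" using ne xef_vert vert_thr[OF assms(1,2)] by auto
  show "thr b \<noteq> thr i" using t thr_i by (auto split: if_splits)
qed

lemma mk_xef: "g \<in> {x, e, f} \<Longrightarrow> g \<noteq> thr i \<Longrightarrow> mk g = []"
proof -
  assume g: "g \<in> {x, e, f}" "g \<noteq> thr i"
  have "g \<noteq> thr b" if "2 \<le> b" "b < N" for b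
    using leaf_other(3)[OF that] g by (cases "b = i") auto
  then show ?thesis by (intro mk_other') blast
qed

lemma turn_H_old:
  assumes "turn G a g" "a \<in> halves G" "a \<notin> {x, e, f}"
  shows "turn H a g" "g \<notin> {x, e, f}"
proof -
  have g: "g \<in> halves G" using assms by (simp add: turn_def)
  show n: "g \<notin> {x, e, f}" using assms cw_eq_iff[of a] cw_eq_iff[of g] g by (auto simp: turn_def)
  show "turn H a g" using assms g n old_H(2,3)[OF assms(2)] old_H(3)[OF g] by (auto simp: turn_def halves_H)
qed

text \<open>A passage through the replaced vertex comes from \<open>i\<close>, goes to
  \<open>i\<close>, or uses \<open>thr i\<close> and leaves the mark \<open>i\<close>. A run with
  none of these avoids that vertex, and elsewhere the turns are unchanged.\<close>

lemma run_preserved: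
  assumes "run G mk h L a" "h \<in> halves G" "h \<noteq> out i" "a \<noteq> out i" "i \<notin> set L"
  shows "run H mk' h (map sh L) a"
  using assms
proof (induction rule: run.induct)
  case (stop h)
  then show ?case using run.stop[of H mk' h] old_H(1) by simp
next
  case (step h g L a)
  have g: "g \<in> halves G" using step.hyps(1) by (simp add: turn_def)
  have ah: "opp G h \<in> halves G" by (rule opp_in[OF step.prems(1)])
  have gx: "g \<noteq> x"
    using run_from_leaf[of i L a] step.hyps(2) step.prems(3) i x(1) by auto
  have gt: "g \<noteq> thr i" using step.prems(4) mk_thr'[OF i] by auto
  have ax: "opp G h \<noteq> x" using opp_opp[OF step.prems(1)] opp_opp[of "out i"] out[of i] i x(1) step.prems(2) by auto
  have a: "opp G h \<notin> {x, e, f}"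
  proof
    assume "opp G h \<in> {x, e, f}"
    then have "opp G h = e \<or> opp G h = f" using ax by auto
    then show False
    proof
      assume ae: "opp G h = e"
      show False
      proof (cases "c = Black")
        case True
        then have "cw G g = cw G x" using step.hyps(1) ae xef_vert xef_cw by (simp add: turn_def)
        then show False using gx g xef_in(1) cw_inj by (auto dest: inj_onD)
      next
        case False
        then show False using step.hyps(1) ae xef_vert xef_cw gt thr_i by (simp add: turn_def)
      qed
    next
      assume af: "opp G h = f"
      show False
      proof (cases "c = Black")
        case True
        then have "cw G g = cw G e" using step.hyps(1) af xef_vert xef_cw by (simp add: turn_def)
        then show False using gt thr_i True g xef_in(2) cw_inj by (auto dest: inj_onD)
      next
        case False
        then show False using step.hyps(1) af xef_vert xef_cw gx by (simp add: turn_def)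
      qed
    qed
  qed
  have t: "turn H (opp H h) g" using turn_H_old[OF step.hyps(1) ah a] old_H(1)[OF step.prems(1)] by simp
  have "mk' g = map sh (mk g)" using gt old_not_new[OF g] by (simp add: mk'_def)
  moreover have "g \<noteq> out i"
  proof -
    have "vert G g = vert G (opp G h)" using step.hyps(1) vert_cw[OF g] vert_cw[OF ah] by (auto simp: turn_def)
    then show ?thesis using step.hyps(1) internal_not_out[of i g] i by (auto simp: turn_def)
  qed
  moreover have "i \<notin> set L" using step.prems(4) by simp
  ultimately show ?case using run.step[OF t step.IH[OF g _ step.prems(3)]] by simp
qed

end

context blow_up_step
begin

lemma mk'_simps: "mk' cd = [i]" "mk' dc = [i + 1]" "mk' e = []" "mk' f = []" "mk' x = []"
  "mk' cb = []" "mk' ba = []" "mk' da = []" "mk' ab = []" "mk' ad = []" "mk' bc = []" "mk' y = []"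
proof -
  have new0: "mk g = []" if "g \<notin> halves G" for g using mk_cases[of g] thr_half that by blast
  have m_new: "mk cb = []" "mk ba = []" "mk da = []" "mk ab = []" "mk ad = []" "mk bc = []" "mk y = []"
    using new by (auto intro!: new0)
  have m_xef: "x \<noteq> thr i \<Longrightarrow> mk x = []" "e \<noteq> thr i \<Longrightarrow> mk e = []" "f \<noteq> thr i \<Longrightarrow> mk f = []"
    by (rule mk_xef; simp)+
  show "mk' cd = [i]" "mk' dc = [i + 1]" "mk' e = []" "mk' f = []" "mk' x = []"
    "mk' cb = []" "mk' ba = []" "mk' da = []" "mk' ab = []" "mk' ad = []" "mk' bc = []" "mk' y = []"
    by (simp_all add: mk'_def neqs m_xef m_new)
qed

text \<open>All turns inside the square. From \<open>i\<close> a trip leaves along \<open>e\<close>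
  and from \<open>i + 1\<close> along \<open>f\<close>, in both cases without a mark. A trip
  arriving at \<open>e\<close> collects the mark \<open>i + 1\<close> and ends at \<open>i\<close>;
  one arriving at \<open>f\<close> collects \<open>i\<close> and ends at
  \<open>i + 1\<close>.\<close>

lemma turn_H:
  "turn H x cb" "turn H bc ba" "turn H ab e" "turn H y da" "turn H ad ab" "turn H ba f"
  "turn H e ad" "turn H da dc" "turn H cd x" "turn H f bc" "turn H cb cd" "turn H dc y"
  by (auto simp: turn_def halves_H xef_in vert_H cw_H)

lemma run_H_out:
  assumes "run G mk e L a" "a \<noteq> out i" "i \<notin> set L"
  shows "run H mk' (out i) (map sh L) a"
proof -
  have o: "opp H (out i) = x" using old_H(1) out[of i] i x(1) by simp
  have "run H mk' e (map sh L) a"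
    by (rule run_preserved[OF assms(1) xef_in(2) _ assms(2,3)]) (use internal_not_out[of i e] xef_vert i in auto)
  then show ?thesis using o turn_H opp_H mk'_simps
    by (intro run_step_nil[of H "out i" cb mk'] run_step_nil[of H cb ba mk'] run_step_nil[of H ba e mk']) auto
qed

lemma run_H_new:
  assumes "run G mk f L a" "a \<noteq> out i" "i \<notin> set L"
  shows "run H mk' z (map sh L) a"
proof -
  have "run H mk' f (map sh L) a"
    by (rule run_preserved[OF assms(1) xef_in(3) _ assms(2,3)]) (use internal_not_out[of i f] xef_vert i in auto)
  then show ?thesis using turn_H opp_H mk'_simps
    by (intro run_step_nil[of H z da mk'] run_step_nil[of H da ab mk'] run_step_nil[of H ab f mk']) auto
qed

lemma run_H_into_e:
  assumes "run G mk h L e" "h \<in> halves G" "h \<noteq> out i" "i \<notin> set L"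
  shows "run H mk' h (map sh L @ [i + 1]) (out i)"
proof -
  have r: "run H mk' h (map sh L) e"
    by (rule run_preserved[OF assms(1-3) _ assms(4)]) (use internal_not_out[of i e] xef_vert i in auto)
  have o: "opp H x = out i" using old_H(1)[OF xef_in(1)] opp_opp out[of i] i x(1) by simp
  have "run H mk' dc [] (out i)" using run.stop[of H mk' x] o turn_H opp_H mk'_simps
    by (intro run_step_nil[of H dc x mk']) auto
  then have "run H mk' ad (mk' dc @ []) (out i)" using turn_H opp_H by (intro run.step) auto
  then show ?thesis using run_append[OF r turn_H(7)] mk'_simps by simp
qed

lemma run_H_into_f:
  assumes "run G mk h L f" "h \<in> halves G" "h \<noteq> out i" "i \<notin> set L"
  shows "run H mk' h (map sh L @ [i]) z"
proof -
  have r: "run H mk' h (map sh L) f"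
    by (rule run_preserved[OF assms(1-3) _ assms(4)]) (use internal_not_out[of i f] xef_vert i in auto)
  have "run H mk' cd [] z" using run.stop[of H mk' y] turn_H opp_H mk'_simps
    by (intro run_step_nil[of H cd y mk']) auto
  then have "run H mk' bc (mk' cd @ []) z" using turn_H opp_H by (intro run.step) auto
  then show ?thesis using run_append[OF r turn_H(10)] mk'_simps by simp
qed

lemma boundary_cases:
  assumes "1 \<le> b" "b \<le> N + 1"
  shows "b = i \<or> b = i + 1 \<or> (\<exists>b0. 1 \<le> b0 \<and> b0 \<le> N \<and> b0 \<noteq> i \<and> b = sh b0 \<and> out' b = out b0 \<and> col' b = col b0
    \<and> (2 \<le> b \<and> b < N + 1 \<longrightarrow> 2 \<le> b0 \<and> b0 < N))"
proof -
  have "b < i \<Longrightarrow> ?thesis" using assms i by (intro disjI2 exI[of _ b]) (auto simp: sh_def out'_def col'_def)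
  moreover have "b > i + 1 \<Longrightarrow> ?thesis"
    using assms i by (intro disjI2 exI[of _ "b - 1"]) (auto simp: sh_def out'_def col'_def)
  moreover have "b < i \<or> b = i \<or> b = i + 1 \<or> b > i + 1" by linarith
  ultimately show ?thesis by blast
qed

lemma out'_sh: "b \<noteq> i \<Longrightarrow> out' (sh b) = out b" "out' i = out i" "out' (i + 1) = z"
  by (auto simp: sh_def out'_def)

lemma thr_H:
  assumes "2 \<le> b" "b < N" "b \<noteq> i"
  shows "(if col b = Black then cw H (opp H (out b)) else cw H (cw H (opp H (out b)))) = thr b"
  using leaf_other[OF assms] old_H[OF leaf_half[OF assms(1,2)]] old_H(3)[OF cw_in[OF leaf_half[OF assms(1,2)]]]
    old_H(1)[of "out b"] out[of b] assms by (simp add: thr_def)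

lemma leaf_H:
  assumes "2 \<le> b" "b < N + 1"
  shows "b = i \<and> opp H (out' b) = x \<and> col' b = Black \<or> b = i + 1 \<and> opp H (out' b) = y \<and> col' b = White \<or>
    (\<exists>b0. 2 \<le> b0 \<and> b0 < N \<and> b0 \<noteq> i \<and> b = sh b0 \<and> col' b = col b0 \<and>
      opp H (out' b) = opp G (out b0) \<and> vert H (opp H (out' b)) = vert G (opp G (out b0)) \<and>
      (if col' b = Black then cw H (opp H (out' b)) else cw H (cw H (opp H (out' b)))) = thr b0)"
proof -
  have "opp H (out' i) = x" "col' i = Black" "opp H (out' (i + 1)) = y" "col' (i + 1) = White"
    using old_H(1)[of "out i"] out[of i] i x(1) opp_H by (auto simp: out'_def col'_def)
  moreover have "opp H (out b0) = opp G (out b0) \<and> vert H (opp H (out b0)) = vert G (opp G (out b0))"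
    if b0: "2 \<le> b0" "b0 < N" "b0 \<noteq> i" for b0
    using old_H(1)[of "out b0"] out[of b0] b0 leaf[OF b0(1,2)] leaf_other(1)[OF b0] old_H(2)[OF leaf_half[OF b0(1,2)]] by auto
  moreover note thr_H boundary_cases[of b] assms
  ultimately show ?thesis by (smt (verit, best) le_trans one_le_numeral less_imp_le Suc_eq_plus1 less_Suc_eq_le)
qed

text \<open>The neighbours of the boundary are the old ones, except at \<open>i\<close>, and two
  fresh vertices of the square, so they remain distinct.\<close>

lemma data_H: "plabic_data H (N + 1) out' col' mk'"
proof
  show "num_boundary H = N + 1" "4 \<le> N + 1" using num N4 by (simp_all add: H)
  fix h assume h: "h \<in> halves H"
  then consider "h \<in> halves G" | "h \<in> {y, z, ab, ba, bc, cb, cd, dc, da, ad}" unfolding halves_H by blast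
  note hc = this
  show "opp H h \<in> halves H" using hc by cases (auto simp: halves_H old_H opp_in opp_H)
  show "opp H (opp H h) = h" using hc by cases (auto simp: old_H opp_in opp_H opp_opp)
  have hx: "h \<in> {x, e, f} \<or> h \<in> halves G \<and> h \<notin> {x, e, f} \<or> h \<in> {y, z, ab, ba, bc, cb, cd, dc, da, ad}"
    using hc by blast
  have oldcw: "cw G h \<notin> {x, e, f}" if "h \<in> halves G" "h \<notin> {x, e, f}" using cw_eq_iff that by blast
  show "cw H h \<in> halves H" using hx by (auto simp: halves_H cw_H xef_in old_H cw_in)
  show "vert H (cw H h) = vert H h"
    using hx
  proof (elim disjE conjE)
    assume "h \<in> halves G" "h \<notin> {x, e, f}"
    then show ?thesis using old_H cw_in oldcw vert_cw by simp
  qed (auto simp: cw_H vert_H)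
  fix b assume vb: "vert H h = Boundary b"
  show "1 \<le> b \<and> b \<le> N + 1 \<and> h = out' b"
    using hx
  proof (elim disjE conjE)
    assume a: "h \<in> halves G" "h \<notin> {x, e, f}"
    then obtain b0 where b0: "vert G h = Boundary b0" "b = (if b0 \<le> i then b0 else b0 + 1)"
      using vb old_H(2) by (cases "vert G h") auto
    then show ?thesis using bdry[OF a(1) b0(1)] by (auto simp: out'_def)
  next
    assume "h \<in> {y, z, ab, ba, bc, cb, cd, dc, da, ad}"
    then have "h = z \<and> b = i + 1" using vb by (auto simp: vert_H)
    then show ?thesis using i by (auto simp: out'_def)
  qed (use vb in \<open>auto simp: vert_H\<close>)
next
  show "inj_on (cw H) (halves H)"
  proof (rule inj_onI)
    have old: "cw H h = cw G h \<and> cw G h \<in> halves G - {x, e, f}" if "h \<in> halves G" "h \<notin> {x, e, f}" for h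
      using that old_H(3) cw_in cw_eq_iff by blast
    let ?S = "{x, e, f, y, z, ab, ba, bc, cb, cd, dc, da, ad}"
    have spec: "cw H h \<in> ?S" if "h \<in> ?S" for h using that by (auto simp: cw_H)
    have disj: "halves G \<inter> {y, z, ab, ba, bc, cb, cd, dc, da, ad} = {}" using new by blast
    have "cw H (cw H (cw H h)) = h" if "h \<in> ?S" for h using that by (auto simp: cw_H)
    then have injS: "inj_on (cw H) ?S" by (rule inj_on_inverseI)
    fix h h' assume hh: "h \<in> halves H" "h' \<in> halves H" "cw H h = cw H h'"
    show "h = h'"
    proof (cases "h \<in> ?S"; cases "h' \<in> ?S")
      assume "h \<in> ?S" "h' \<in> ?S"
      then show ?thesis by (rule inj_onD[OF injS hh(3)])
    next
      assume a: "h \<in> ?S" "h' \<notin> ?S"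
      then have "cw H h' \<in> halves G - {x, e, f}" using old[of h'] hh(2) unfolding halves_H by auto
      then show ?thesis using spec[OF a(1)] hh(3) disj by auto
    next
      assume a: "h \<notin> ?S" "h' \<in> ?S"
      then have "cw H h \<in> halves G - {x, e, f}" using old[of h] hh(1) unfolding halves_H by auto
      then show ?thesis using spec[OF a(2)] hh(3) disj by auto
    next
      assume "h \<notin> ?S" "h' \<notin> ?S"
      then have "h \<in> halves G" "h' \<in> halves G" "cw G h = cw G h'"
        using hh old[of h] old[of h'] unfolding halves_H by auto
      then show ?thesis using inj_onD[OF cw_inj] by blast
    qed
  qed
next
  fix b assume b: "1 \<le> b" "b \<le> N + 1"
  from boundary_cases[OF b] show "out' b \<in> halves H \<and> vert H (out' b) = Boundary b"
  proof (elim disjE exE conjE)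
    fix b0 assume b0: "1 \<le> b0" "b0 \<le> N" "b0 \<noteq> i" "b = sh b0" "out' b = out b0"
    have "out b0 \<notin> {x, e, f}" using internal_not_out[OF b0(1,2)] xef_vert by blast
    then show ?thesis using b0 out[OF b0(1,2)] old_H(2)[of "out b0"] by (auto simp: halves_H sh_def)
  next
    assume "b = i"
    have "out i \<notin> {x, e, f}" using internal_not_out[of i] i xef_vert by auto
    then show ?thesis using \<open>b = i\<close> out[of i] i old_H(2)[of "out i"] by (auto simp: halves_H out'_def)
  next
    assume "b = i + 1"
    then show ?thesis by (simp add: out'_def halves_H vert_H)
  qed
next
  fix b assume b: "2 \<le> b" "b < N + 1"
  from leaf_H[OF b] show "\<exists>t. vert H (opp H (out' b)) = Internal t (col' b)"
    using leaf vert_H by (elim disjE exE conjE) auto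
  from leaf_H[OF b]
  show "mk' (if col' b = Black then cw H (opp H (out' b)) else cw H (cw H (opp H (out' b)))) = [b]"
  proof (elim disjE exE conjE)
    fix b0 assume b0: "2 \<le> b0" "b0 < N" "b0 \<noteq> i" "b = sh b0"
      and t: "(if col' b = Black then cw H (opp H (out' b)) else cw H (cw H (opp H (out' b)))) = thr b0"
    show ?thesis unfolding t
      using b0(4) mk_thr'[OF b0(1,2)] leaf_other(4)[OF b0(1-3)] old_not_new[OF thr_half[OF b0(1,2)]] by (simp add: mk'_def)
  qed (use mk'_simps cw_H in simp_all)
  fix b' assume b': "2 \<le> b'" "b' < N + 1" and eq: "vert H (opp H (out' b)) = vert H (opp H (out' b'))"
  have fresh: "vert G (opp G (out b0)) \<notin> {Internal tc Black, Internal td White}" if "2 \<le> b0" "b0 < N" for b0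
    using newvert leaf_half[OF that] by blast
  have "Internal tc Black \<noteq> Internal td White" by simp
  then show "b = b'"
    using leaf_H[OF b] leaf_H[OF b'] eq leaf_inj fresh vert_H(7,10) by (elim disjE exE conjE) auto
next
  fix g assume g: "\<And>b. 2 \<le> b \<Longrightarrow> b < N + 1 \<Longrightarrow>
      g \<noteq> (if col' b = Black then cw H (opp H (out' b)) else cw H (cw H (opp H (out' b))))"
  have gcd: "g \<noteq> cd"
    using g[of i] i old_H(1)[of "out i"] out[of i] x(1) cw_H by (simp add: out'_def col'_def)
  have gdc: "g \<noteq> dc" using g[of "i + 1"] i opp_H cw_H by (simp add: out'_def col'_def)
  have "g = thr i \<or> mk g = []"
  proof (rule ccontr)
    assume "\<not> ?thesis"
    then obtain b0 where b0: "2 \<le> b0" "b0 < N" "g = thr b0" "b0 \<noteq> i" using mk_cases[of g] by auto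
    have cb0: "col' (sh b0) = col b0" "2 \<le> sh b0" "sh b0 < N + 1" using b0 i by (auto simp: sh_def col'_def)
    show False
      using g[OF cb0(2,3), unfolded cb0(1) out'_sh(1)[OF b0(4)] thr_H[OF b0(1,2,4)]] b0(3) by simp
  qed
  then show "mk' g = []" using gcd gdc by (auto simp: mk'_def)
qed

end

section \<open>The effect of blowing up on all trips\<close>

definition trip_data :: "plabic \<Rightarrow> nat \<Rightarrow> (nat \<Rightarrow> color) \<Rightarrow> (nat \<Rightarrow> nat list) \<Rightarrow> (nat \<Rightarrow> nat) \<Rightarrow> bool" where
  "trip_data G N cl Ls \<pi> \<longleftrightarrow> (\<exists>out mk. plabic_data G N out cl mk \<and>
     (\<forall>b. 1 \<le> b \<and> b \<le> N \<longrightarrow> 1 \<le> \<pi> b \<and> \<pi> b \<le> N \<and> run G mk (out b) (Ls b) (out (\<pi> b))))"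

lemma (in plabic_data) run_end_half:
  "run G mk h L a \<Longrightarrow> h \<in> halves G \<Longrightarrow> a \<in> halves G"
  by (induction rule: run.induct) (auto simp: opp_in turn_def)

lemma trip_data_trip_perm:
  fixes col :: "nat \<Rightarrow> color"
  assumes "trip_data G N col Ls \<pi>" "1 \<le> b" "b \<le> N"
  shows "trip_perm G b = \<pi> b"
proof -
  obtain out mk where "plabic_data G N out col mk" "1 \<le> \<pi> b \<and> \<pi> b \<le> N \<and> run G mk (out b) (Ls b) (out (\<pi> b))"
    using assms unfolding trip_data_def by blast
  then show ?thesis using plabic_data.trip_perm_run[of G N out col mk b "\<pi> b" "Ls b"] assms by blast
qed

text \<open>The relabelling \<open>sh\<close> of \<open>blow_up_step\<close>, made available outside
  that locale.\<close>

definition shift :: "nat \<Rightarrow> nat \<Rightarrow> nat" where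
  "shift i b = (if b \<le> i then b else b + 1)"

text \<open>Blowing up at \<open>i\<close> cuts the trip through the vertex at \<open>i\<close>, with marks \<open>l1 @ i # l2\<close>, and the
  two trips starting and ending at \<open>i\<close>, and reconnects their pieces.\<close>

lemma trip_data_blow_up:
  fixes col :: "nat \<Rightarrow> color"
  assumes T: "trip_data G N col Ls \<pi>" and bu: "blow_up i c G H" and i: "i \<noteq> 1" "i \<noteq> N"
    and p: "1 \<le> p" "p \<le> N" "Ls p = l1 @ i # l2" "i \<notin> set l1" "i \<notin> set l2" "p \<noteq> i" "\<pi> p \<noteq> i"
    and r: "1 \<le> r" "r \<le> N" "\<pi> r = i" "\<pi> i \<noteq> i"
    and others: "\<And>b. 1 \<le> b \<Longrightarrow> b \<le> N \<Longrightarrow> b \<noteq> p \<Longrightarrow> i \<notin> set (Ls b)"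
      "\<And>b. 1 \<le> b \<Longrightarrow> b \<le> N \<Longrightarrow> b \<noteq> r \<Longrightarrow> \<pi> b \<noteq> i"
    and new: "\<And>b. 1 \<le> b \<Longrightarrow> b \<le> N \<Longrightarrow> b \<noteq> i \<Longrightarrow> b \<noteq> p \<Longrightarrow> b \<noteq> r \<Longrightarrow>
        Ls' (shift i b) = map (shift i) (Ls b) \<and> \<pi>' (shift i b) = shift i (\<pi> b)"
    and black: "c = Black \<Longrightarrow>
        Ls' (shift i p) = map (shift i) l1 @ [i] \<and> \<pi>' (shift i p) = i + 1 \<and>
        Ls' (shift i r) = map (shift i) (Ls r) @ [i + 1] \<and> \<pi>' (shift i r) = i \<and>
        Ls' i = map (shift i) l2 \<and> \<pi>' i = shift i (\<pi> p) \<and>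
        Ls' (i + 1) = map (shift i) (Ls i) \<and> \<pi>' (i + 1) = shift i (\<pi> i)"
    and white: "c = White \<Longrightarrow>
        Ls' (shift i p) = map (shift i) l1 @ [i + 1] \<and> \<pi>' (shift i p) = i \<and>
        Ls' (shift i r) = map (shift i) (Ls r) @ [i] \<and> \<pi>' (shift i r) = i + 1 \<and>
        Ls' i = map (shift i) (Ls i) \<and> \<pi>' i = shift i (\<pi> i) \<and>
        Ls' (i + 1) = map (shift i) l2 \<and> \<pi>' (i + 1) = shift i (\<pi> p)"
  shows "2 \<le> i \<and> i < N \<and> col i = c \<and> trip_data H (N + 1)
    (\<lambda>b. if b < i then col b else if b = i then Black else if b = i + 1 then White else col (b - 1)) Ls' \<pi>'"
proof -
  obtain out mk where D: "plabic_data G N out col mk"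
    and R: "\<And>b. 1 \<le> b \<Longrightarrow> b \<le> N \<Longrightarrow> 1 \<le> \<pi> b \<and> \<pi> b \<le> N \<and> run G mk (out b) (Ls b) (out (\<pi> b))"
    using T unfolding trip_data_def by blast
  interpret plabic_data G N out col mk by (rule D)
  show ?thesis using bu
  proof (cases rule: blow_up.cases)
    case (1 x t e f y z ab ba bc cb cd dc da ad a ta b tb c' tc d td)
    have i2: "2 \<le> i" "i < N" using 1(1) i num by auto
    have "opp G x = out i" using bdry[OF opp_in[OF 1(2)] 1(3)] by simp
    then have x: "x = opp G (out i)" using opp_opp[OF 1(2)] by simp
    have c: "c = col i" using leaf[OF i2] 1(4) x by auto
    interpret S: blow_up_step G N out col mk i x e f y z ab ba bc cb cd dc da ad t ta tb tc td c H
      by unfold_locales (use i2 x c 1 in \<open>simp_all\<close>)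
    have sh: "S.sh = shift i" by (rule ext) (simp add: S.sh_def shift_def)
    have out_ne: "out b \<noteq> out i" if "1 \<le> b" "b \<le> N" "b \<noteq> i" for b
      using out[OF that(1,2)] out[of i] i2 that(3) by auto
    have mkx: "mk x = []"
      by (rule S.mk_xef) (use S.thr_i S.neqs in auto)
    have x_ne: "out b \<noteq> x" if "1 \<le> b" "b \<le> N" for b
      using S.internal_not_out[OF that, of x] 1(4) by auto
    \<comment> \<open>The transverse trip arrives at the replaced vertex by \<open>g1\<close> and
      leaves it along \<open>thr i\<close>.\<close>
    obtain g1 where g1: "run G mk (out p) l1 (opp G g1)" "turn G (opp G g1) (thr i)" "run G mk (thr i) l2 (out (\<pi> p))"
      using run_split[of "out p" "Ls p" _ l1 i l2] R[OF p(1,2)] p i2 by blast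
    have r_run: "run G mk (out r) (Ls r) (out i)" using R[OF r(1,2)] r(3) by simp
    have "\<exists>g. run G mk (out r) (Ls r) (opp G g) \<and> turn G (opp G g) (opp G (out i))"
      by (rule run_last[OF r_run refl]) (use out[OF r(1,2)] x_ne[OF r(1,2)] mkx x i2 in auto)
    then obtain g2 where g2: "run G mk (out r) (Ls r) (opp G g2)" "turn G (opp G g2) x" using x by auto
    have i_run: "run G mk (out i) (Ls i) (out (\<pi> i))" using R[of i] i2 by simp
    \<comment> \<open>The trip from \<open>i\<close> first reaches \<open>x\<close>, which is not at
      the boundary, so it has a further step out of the replaced vertex.\<close>
    have start: "\<exists>g. turn G x g \<and> (mk g = [] \<longrightarrow> run G mk g (Ls i) (out (\<pi> i)))"
      using i_run
    proof (cases rule: run.cases)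
      case stop
      then have "x = out (\<pi> i)" using x by simp
      then show ?thesis using x_ne[of "\<pi> i"] R[of i] i2 by auto
    next
      case (step g L)
      then show ?thesis using x by auto
    qed
    then obtain g3 where g3: "turn G x g3" "mk g3 = [] \<Longrightarrow> run G mk g3 (Ls i) (out (\<pi> i))" by blast
    have pi: "1 \<le> \<pi> b" "\<pi> b \<le> N" if "1 \<le> b" "b \<le> N" for b using R[OF that] by auto
    have rp: "r \<noteq> p" "r \<noteq> i" using r p by auto
    have iLi: "i \<notin> set (Ls i)" "i \<notin> set (Ls r)" using others(1) i2 p(6) r rp by auto
    have step_back: "g = g'" if "cw G g = cw G g'" "g \<in> halves G" "g' \<in> halves G" for g g'
      using inj_onD[OF cw_inj that] .
    note fin = S.run_H_out S.run_H_new S.run_H_into_e S.run_H_into_f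
    have main: "run H S.mk' (out i) (Ls' i) (S.out' (\<pi>' i)) \<and> run H S.mk' z (Ls' (i + 1)) (S.out' (\<pi>' (i + 1)))
      \<and> run H S.mk' (out p) (Ls' (shift i p)) (S.out' (\<pi>' (shift i p)))
      \<and> run H S.mk' (out r) (Ls' (shift i r)) (S.out' (\<pi>' (shift i r)))"
    proof -
      have o: "S.out' (shift i (\<pi> b)) = out (\<pi> b)" if "\<pi> b \<noteq> i" for b
        using S.out'_sh(1)[OF that] by (simp add: sh)
      note os = S.out'_sh(2,3)
      have oi: "out (\<pi> i) \<noteq> out i" "out (\<pi> p) \<noteq> out i" "out p \<noteq> out i" "out r \<noteq> out i"
        using out_ne pi[of i] pi[of p] r p i2 rp by auto
      have oh: "out p \<in> halves G" "out r \<in> halves G" using out p r by auto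
      have gh: "opp G g1 \<in> halves G" "opp G g2 \<in> halves G"
        using run_end_half[OF g1(1)] run_end_half[OF g2(1)] oh by auto
      have vert_back: "g \<in> {x, e, f} \<Longrightarrow> vert G g' = Internal t c" if "turn G g' g" "g' \<in> halves G" for g g'
      proof -
        assume g: "g \<in> {x, e, f}"
        have "vert G g = vert G g'" using that vert_cw[of g'] vert_cw[of g] by (auto simp: turn_def)
        then show ?thesis using g S.xef_vert by auto
      qed
      have thr_xef: "thr i \<in> {x, e, f}" "x \<in> {x, e, f}" using S.thr_i by auto
      note vert_back = vert_back[OF _ _ thr_xef(1)] vert_back[OF _ _ thr_xef(2)]
      show ?thesis
      proof (cases "c = Black")
        case True
        \<comment> \<open>The turns at a black vertex lead from \<open>f\<close> to
          \<open>e\<close>, from \<open>e\<close> to \<open>x\<close> and from \<open>x\<close> to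
          \<open>f\<close>.\<close>
        have t: "thr i = e" using S.thr_i True by simp
        have "opp G g1 = f" "opp G g2 = e"
          using vert_back(1)[OF g1(2) gh(1)] vert_back(2)[OF g2(2) gh(2)] g1(2) g2(2) True S.xef_cw t by (auto simp: turn_def)
        moreover have "g3 = f"
          using g3(1) True S.xef_vert S.xef_cw S.xef_in step_back[of g3 f] by (auto simp: turn_def)
        moreover have "mk f = []" using S.mk_xef[of f] t S.neqs by auto
        ultimately show ?thesis
          using black[OF True] fin(1)[of l2 "out (\<pi> p)"] fin(2)[of "Ls i" "out (\<pi> i)"] fin(3)[of "out r" "Ls r"] fin(4)[of "out p" l1]
            g1 g2 g3 t oi oh iLi p r o os by (simp add: sh)
      next
        case False
        then have W: "c = White" by (cases c) auto
        \<comment> \<open>The turns at a white vertex lead from \<open>e\<close> to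
          \<open>f\<close>, from \<open>f\<close> to \<open>x\<close> and from \<open>x\<close> to
          \<open>e\<close>.\<close>
        have t: "thr i = f" using S.thr_i False by simp
        have "cw G (opp G g1) = cw G e" "cw G (opp G g2) = cw G f"
          using vert_back(1)[OF g1(2) gh(1)] vert_back(2)[OF g2(2) gh(2)] g1(2) g2(2) W S.xef_cw t by (auto simp: turn_def)
        then have "opp G g1 = e" "opp G g2 = f" using step_back gh S.xef_in by blast+
        moreover have "g3 = e"
          using g3(1) W S.xef_vert S.xef_cw by (auto simp: turn_def)
        moreover have "mk e = []" using S.mk_xef[of e] t S.neqs by auto
        ultimately show ?thesis
          using white[OF W] fin(1)[of "Ls i" "out (\<pi> i)"] fin(2)[of l2 "out (\<pi> p)"] fin(3)[of "out p" l1] fin(4)[of "out r" "Ls r"]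
            g1 g2 g3 t oi oh iLi p r o os by (simp add: sh)
      qed
    qed
    have "1 \<le> \<pi>' b \<and> \<pi>' b \<le> N + 1 \<and> run H S.mk' (S.out' b) (Ls' b) (S.out' (\<pi>' b))" if b: "1 \<le> b" "b \<le> N + 1" for b
    proof -
      have bnd: "1 \<le> shift i q \<and> shift i q \<le> N + 1" if "1 \<le> q" "q \<le> N" for q using that by (auto simp: shift_def)
      have bnds: "1 \<le> \<pi>' q \<and> \<pi>' q \<le> N + 1" if "q \<in> {i, i + 1, shift i p, shift i r}" for q
        using that black white bnd[OF pi[of p]] bnd[OF pi[of i]] p r i2 by (cases c) auto
      from S.boundary_cases[OF b] show ?thesis
      proof (elim disjE exE conjE)
        assume "b = i"
        then show ?thesis using main bnds S.out'_sh by auto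
      next
        assume "b = i + 1"
        then show ?thesis using main bnds S.out'_sh by auto
      next
        fix b0 assume b0: "1 \<le> b0" "b0 \<le> N" "b0 \<noteq> i" "b = S.sh b0" "S.out' b = out b0"
        show ?thesis
        proof (cases "b0 = p \<or> b0 = r")
          case True
          then show ?thesis using main bnds b0 by (auto simp: sh)
        next
          case False
          then have n: "Ls' b = map (shift i) (Ls b0)" "\<pi>' b = shift i (\<pi> b0)" using new[OF b0(1-3)] b0(4) sh by auto
          have ne: "\<pi> b0 \<noteq> i" "i \<notin> set (Ls b0)" using others b0 False by auto
          have "run H S.mk' (out b0) (map (shift i) (Ls b0)) (out (\<pi> b0))"
            unfolding sh[symmetric]
            by (rule S.run_preserved) (use R[OF b0(1,2)] out[OF b0(1,2)] out_ne[OF b0(1-3)] out_ne[of "\<pi> b0"] ne in auto)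
          then show ?thesis using n b0 bnd[OF pi[OF b0(1,2)]] S.out'_sh(1)[OF ne(1)] by (simp add: sh)
        qed
      qed
    qed
    then have "trip_data H (N + 1) S.col' Ls' \<pi>'" unfolding trip_data_def using S.data_H by blast
    then show ?thesis using i2 c unfolding S.col'_def by simp
  qed
qed

lemma trip_data_leaf:
  fixes cl :: "nat \<Rightarrow> color"
  assumes T: "trip_data G N cl Ls \<pi>" and bu: "blow_up i c G H" and i: "i \<noteq> 1" "i \<noteq> N"
  shows "2 \<le> i \<and> i < N \<and> cl i = c"
proof -
  obtain out mk where D: "plabic_data G N out cl mk" using T unfolding trip_data_def by blast
  interpret plabic_data G N out cl mk by (rule D)
  show ?thesis using bu
  proof (cases rule: blow_up.cases)
    case (1 x t e f y z ab ba bc cb cd dc da ad a ta b tb c' tc d td)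
    have i2: "2 \<le> i" "i < N" using 1(1) i num by auto
    have "opp G x = out i" using bdry[OF opp_in[OF 1(2)] 1(3)] by simp
    then have "x = opp G (out i)" using opp_opp[OF 1(2)] by simp
    then show ?thesis using leaf[OF i2] 1(4) i2 by auto
  qed
qed

section \<open>The order of the marks on each trip\<close>

text \<open>The order of white marks is what allows a trip to be cut at a white vertex. The flag
  \<open>sw\<close> gives it up once only black blow-ups remain to be followed.\<close>

definition marked :: "nat \<Rightarrow> (nat \<Rightarrow> color) \<Rightarrow> (nat \<Rightarrow> nat list) \<Rightarrow> (nat \<Rightarrow> nat) \<Rightarrow> bool \<Rightarrow> bool" where
  "marked N cl Ls src sw \<longleftrightarrow> (\<forall>b. 1 \<le> b \<and> b \<le> N \<longrightarrow>
     distinct (Ls b) \<and> (\<forall>j. j \<in> set (Ls b) \<longleftrightarrow> 2 \<le> j \<and> j < N \<and> src j = b) \<and>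
     sorted_wrt (<) (filter (\<lambda>j. cl j = Black) (Ls b)) \<and>
     (sw \<longrightarrow> sorted_wrt (>) (filter (\<lambda>j. cl j = White) (Ls b))))"

text \<open>\<open>src j\<close> is the start of the trip through the vertex at \<open>j\<close> but not along its boundary edge.
  Each trip meets the black ones of these vertices in increasing and, if \<open>sw\<close>, the white ones in
  decreasing order.\<close>

definition trip_state :: "plabic \<Rightarrow> nat \<Rightarrow> (nat \<Rightarrow> color) \<Rightarrow> (nat \<Rightarrow> nat) \<Rightarrow> (nat \<Rightarrow> nat) \<Rightarrow> bool \<Rightarrow> bool" where
  "trip_state G N cl src \<pi> sw \<longleftrightarrow> (\<exists>Ls. trip_data G N cl Ls \<pi> \<and> marked N cl Ls src sw)"

lemma marked_cong:
  assumes "marked N cl Ls src sw" "\<And>j. 2 \<le> j \<Longrightarrow> j < N \<Longrightarrow> src j = src' j"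
  shows "marked N cl Ls src' sw"
  using assms unfolding marked_def by metis

lemma trip_state_cong:
  assumes "trip_state G N cl src \<pi> sw" "\<And>j. 2 \<le> j \<Longrightarrow> j < N \<Longrightarrow> src j = src' j" "cl = cl'"
  shows "trip_state G N cl' src' \<pi> sw"
  using assms marked_cong unfolding trip_state_def by blast

lemma shift_less_iff: "shift i a < shift i b \<longleftrightarrow> a < b" and shift_eq_iff: "shift i a = shift i b \<longleftrightarrow> a = b"
  by (auto simp: shift_def)

lemma sorted_map_shift:
  "sorted_wrt (<) (map (shift i) L) \<longleftrightarrow> sorted_wrt (<) L" "sorted_wrt (>) (map (shift i) L) \<longleftrightarrow> sorted_wrt (>) L"
  by (simp_all add: sorted_wrt_map shift_less_iff)

lemma distinct_map_shift: "distinct (map (shift i) L) \<longleftrightarrow> distinct L"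
  by (simp add: distinct_map inj_on_def shift_eq_iff)

text \<open>The order of the marks decides on which piece of the cut trip a vertex of the color of
  \<open>i\<close> lies; vertices of the other color on that trip are left open. The second piece
  starts at \<open>u\<close>, the former trip from \<open>i\<close> at \<open>w\<close>. Since the
  mark \<open>w\<close> is appended to the trip from \<open>r\<close>, \<open>hb\<close> and
  \<open>hw\<close> are what keeps that trip ordered.\<close>

lemma trip_state_blow_up:
  fixes cl :: "nat \<Rightarrow> color"
  assumes S: "trip_state G N cl src \<pi> sw" and bu: "blow_up i c G H" and i: "i \<noteq> 1" "i \<noteq> N"
    and uw: "(u, w) = (if c = Black then (i, i + 1) else (i + 1, i))"
    and p: "1 \<le> src i" "src i \<le> N" "src i \<noteq> i" "\<pi> (src i) \<noteq> i"
    and r: "1 \<le> r" "r \<le> N" "\<pi> r = i" "\<pi> i \<noteq> i"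
    and cw: "c = White \<Longrightarrow> sw"
    and \<pi>': "\<pi>' (shift i (src i)) = w" "\<pi>' (shift i r) = u" "\<pi>' u = shift i (\<pi> (src i))" "\<pi>' w = shift i (\<pi> i)"
    and others: "\<And>b. 1 \<le> b \<Longrightarrow> b \<le> N \<Longrightarrow> (\<pi> b = i \<longrightarrow> b = r) \<and>
        (b \<noteq> i \<longrightarrow> b \<noteq> src i \<longrightarrow> b \<noteq> r \<longrightarrow> \<pi>' (shift i b) = shift i (\<pi> b))"
    and hb: "\<And>j. c = White \<Longrightarrow> 2 \<le> j \<Longrightarrow> j < N \<Longrightarrow> cl j = Black \<Longrightarrow> src j = r \<Longrightarrow> j < i"
    and hw: "\<And>j. c = Black \<Longrightarrow> sw' \<Longrightarrow> 2 \<le> j \<Longrightarrow> j < N \<Longrightarrow> cl j = White \<Longrightarrow> src j = r \<Longrightarrow> j > i"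
    and sw': "sw' \<Longrightarrow> sw"
  shows "\<exists>src'. trip_state H (N + 1)
      (\<lambda>b. if b < i then cl b else if b = i then Black else if b = i + 1 then White else cl (b - 1)) src' \<pi>' sw' \<and>
    src' u = shift i (src i) \<and> src' w = shift i r \<and>
    (\<forall>j. 2 \<le> j \<longrightarrow> j < N \<longrightarrow> j \<noteq> i \<longrightarrow> cl j = c \<or> src j \<noteq> src i \<longrightarrow> src' (shift i j) =
      (if src j = src i then (if (if c = Black then j < i else j > i) then shift i (src i) else u)
       else if src j = i then w else shift i (src j)))"
proof -
  obtain Ls where T: "trip_data G N cl Ls \<pi>" and M: "marked N cl Ls src sw" using S unfolding trip_state_def by blast
  have i2: "2 \<le> i" "i < N" and ci: "cl i = c" using trip_data_leaf[OF T bu i] by auto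
  define p where "p = src i"
  note p' = p[folded p_def] and \<pi>p = \<pi>'[folded p_def] and op = others[folded p_def]
  have Md: "distinct (Ls b)" and Mm: "\<And>j. j \<in> set (Ls b) \<longleftrightarrow> 2 \<le> j \<and> j < N \<and> src j = b"
    and Mb: "sorted_wrt (<) (filter (\<lambda>j. cl j = Black) (Ls b))"
    and Mw: "sw \<Longrightarrow> sorted_wrt (>) (filter (\<lambda>j. cl j = White) (Ls b))" if "1 \<le> b" "b \<le> N" for b
    using M that unfolding marked_def by blast+
  have "i \<in> set (Ls p)" using Mm[OF p'(1,2)] i2 by (simp add: p_def)
  then obtain l1 l2 where l: "Ls p = l1 @ i # l2" by (meson split_list)
  have nl: "i \<notin> set l1" "i \<notin> set l2" "set l1 \<inter> set l2 = {}" using Md[OF p'(1,2)] l by auto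
  have other_i: "i \<notin> set (Ls b)" if "1 \<le> b" "b \<le> N" "b \<noteq> p" for b
    using Mm[OF that(1,2), of i] that(3) by (auto simp: p_def)
  have rp: "r \<noteq> p" "r \<noteq> i" using r p' by auto
  have order: "j \<in> set l1 \<longleftrightarrow> (if c = Black then j < i else j > i)" if "j \<in> set (Ls p)" "cl j = c" "j \<noteq> i" for j
  proof (cases "c = Black")
    case True
    have s: "sorted_wrt (<) (filter (\<lambda>j. cl j = Black) (l1 @ i # l2))" using Mb[OF p'(1,2)] l by simp
    then have "\<forall>a\<in>set l1. cl a = Black \<longrightarrow> a < i" "\<forall>a\<in>set l2. cl a = Black \<longrightarrow> i < a"
      using ci True by (auto simp: sorted_wrt_append)
    then show ?thesis using that l True by fastforce
  next
    case False
    then have W: "c = White" by (cases c) auto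
    have s: "sorted_wrt (>) (filter (\<lambda>j. cl j = White) (l1 @ i # l2))" using Mw[OF p'(1,2) cw[OF W]] l by simp
    then have "\<forall>a\<in>set l1. cl a = White \<longrightarrow> a > i" "\<forall>a\<in>set l2. cl a = White \<longrightarrow> i > a"
      using ci W by (auto simp: sorted_wrt_append)
    then show ?thesis using that l W False by fastforce
  qed
  define Ls' where "Ls' y = (if y = u then map (shift i) l2 else if y = w then map (shift i) (Ls i)
    else let b = (if y < i then y else y - 1) in
      if b = p then map (shift i) l1 @ [u] else if b = r then map (shift i) (Ls r) @ [w] else map (shift i) (Ls b))" for y
  have uw': "u \<noteq> w" "{u, w} = {i, i + 1}" using uw by (auto split: if_splits)
  have Lsh: "Ls' (shift i b) = (if b = p then map (shift i) l1 @ [u] else if b = r then map (shift i) (Ls r) @ [w]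
      else map (shift i) (Ls b))" if "b \<noteq> i" for b
  proof -
    have "shift i b \<noteq> i \<and> shift i b \<noteq> i + 1" using that by (auto simp: shift_def)
    then have "shift i b \<noteq> u" "shift i b \<noteq> w" using uw' by blast+
    moreover have "(if shift i b < i then shift i b else shift i b - 1) = b" using that by (auto simp: shift_def)
    ultimately show ?thesis by (simp only: Ls'_def if_False Let_def)
  qed
  have Lu: "Ls' u = map (shift i) l2" "Ls' w = map (shift i) (Ls i)" using uw' by (auto simp: Ls'_def)
  define col' where "col' b = (if b < i then cl b else if b = i then Black else if b = i + 1 then White else cl (b - 1))" for b
  have TH: "trip_data H (N + 1) col' Ls' \<pi>'"
  proof -
    have "2 \<le> i \<and> i < N \<and> cl i = c \<and> trip_data H (N + 1)
      (\<lambda>b. if b < i then cl b else if b = i then Black else if b = i + 1 then White else cl (b - 1)) Ls' \<pi>'"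
    proof (rule trip_data_blow_up[OF T bu i p'(1,2) l nl(1,2) p'(3,4) r])
      show "i \<notin> set (Ls b)" if "1 \<le> b" "b \<le> N" "b \<noteq> p" for b using other_i that by blast
      show "\<pi> b \<noteq> i" if "1 \<le> b" "b \<le> N" "b \<noteq> r" for b using op that by blast
      show "Ls' (shift i b) = map (shift i) (Ls b) \<and> \<pi>' (shift i b) = shift i (\<pi> b)"
        if "1 \<le> b" "b \<le> N" "b \<noteq> i" "b \<noteq> p" "b \<noteq> r" for b using Lsh[OF that(3)] op[OF that(1,2)] that by simp
      show "Ls' (shift i p) = map (shift i) l1 @ [i] \<and> \<pi>' (shift i p) = i + 1 \<and>
        Ls' (shift i r) = map (shift i) (Ls r) @ [i + 1] \<and> \<pi>' (shift i r) = i \<and>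
        Ls' i = map (shift i) l2 \<and> \<pi>' i = shift i (\<pi> p) \<and>
        Ls' (i + 1) = map (shift i) (Ls i) \<and> \<pi>' (i + 1) = shift i (\<pi> i)" if "c = Black"
        using uw that Lsh[OF p'(3)] Lsh[OF rp(2)] rp Lu \<pi>p by simp
      show "Ls' (shift i p) = map (shift i) l1 @ [i + 1] \<and> \<pi>' (shift i p) = i \<and>
        Ls' (shift i r) = map (shift i) (Ls r) @ [i] \<and> \<pi>' (shift i r) = i + 1 \<and>
        Ls' i = map (shift i) (Ls i) \<and> \<pi>' i = shift i (\<pi> i) \<and>
        Ls' (i + 1) = map (shift i) l2 \<and> \<pi>' (i + 1) = shift i (\<pi> p)" if "c = White"
        using uw that Lsh[OF p'(3)] Lsh[OF rp(2)] rp Lu \<pi>p by simp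
    qed
    then show ?thesis unfolding col'_def by blast
  qed
  define unsh where "unsh j = (if j < i then j else j - 1)" for j
  have unsh: "unsh (shift i j) = j" if "j \<noteq> i" for j using that by (auto simp: unsh_def shift_def)
  define src' where "src' j = (if j = u then shift i p else if j = w then shift i r
    else let j0 = unsh j in if src j0 = p then (if j0 \<in> set l1 then shift i p else u)
      else if src j0 = i then w else shift i (src j0))" for j
  have shuw: "shift i j \<noteq> u" "shift i j \<noteq> w" if "j \<noteq> i" for j
  proof -
    have "shift i j \<noteq> i \<and> shift i j \<noteq> i + 1" using that by (auto simp: shift_def)
    then show "shift i j \<noteq> u" "shift i j \<noteq> w" using uw' by blast+
  qed
  have ssh: "src' (shift i j) = (if src j = p then (if j \<in> set l1 then shift i p else u)
      else if src j = i then w else shift i (src j))" if "j \<noteq> i" for j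
    using shuw[OF that] unsh[OF that] by (simp add: src'_def)
  have suw: "src' u = shift i p" "src' w = shift i r" using uw' by (auto simp: src'_def)
  have colsh: "col' (shift i j) = cl j" if "j \<noteq> i" for j using that by (auto simp: col'_def shift_def)
  have coluw: "col' i = Black" "col' (i + 1) = White" by (auto simp: col'_def)
  have split: "y \<in> {u, w} \<or> (\<exists>b. b \<noteq> i \<and> y = shift i b \<and> (1 \<le> y \<longrightarrow> y \<le> N + 1 \<longrightarrow> 1 \<le> b \<and> b \<le> N)
      \<and> (2 \<le> y \<and> y < N + 1 \<longleftrightarrow> 2 \<le> b \<and> b < N))" for y
  proof -
    have "y < i \<Longrightarrow> ?thesis" using i2 by (intro disjI2 exI[of _ y]) (auto simp: shift_def)
    moreover have "y > i + 1 \<Longrightarrow> ?thesis" using i2 by (intro disjI2 exI[of _ "y - 1"]) (auto simp: shift_def)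
    moreover have "y < i \<or> y > i + 1 \<or> y \<in> {i, i + 1}" by auto
    ultimately show ?thesis using uw'(2) by blast
  qed
  have filt: "filter (\<lambda>j. col' j = k) (map (shift i) L) = map (shift i) (filter (\<lambda>j. cl j = k) L)"
    if "i \<notin> set L" for L k
    using that colsh by (induction L) auto
  have uwin: "2 \<le> u \<and> u < N + 1" "2 \<le> w \<and> w < N + 1" using uw i2 by (auto split: if_splits)
  have memmap: "shift i j \<in> set (map (shift i) L) \<longleftrightarrow> j \<in> set L" for j L
    using shift_eq_iff by auto
  have umap: "u \<notin> set (map (shift i) L)" "w \<notin> set (map (shift i) L)" if "i \<notin> set L" for L
    using shuw that by (metis (no_types, lifting) image_iff list.set_map)+
  have mem: "j \<in> set (Ls' y) \<longleftrightarrow> 2 \<le> j \<and> j < N + 1 \<and> src' j = y" if y: "1 \<le> y" "y \<le> N + 1" for j y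
  proof -
    have iL: "i \<notin> set (Ls i)" "i \<notin> set (Ls r)" using other_i[of i] other_i[of r] i2 p'(3) r rp by auto
    have lm: "j0 \<in> set (Ls p) \<longleftrightarrow> j0 \<in> set l1 \<or> j0 = i \<or> j0 \<in> set l2" for j0 using l by auto
    from split[of y] split[of j] show ?thesis
    proof (elim disjE exE conjE)
      assume "y \<in> {u, w}" "j \<in> {u, w}"
      then show ?thesis using umap[OF nl(2)] umap[OF iL(1)] Lu suw shuw[OF p'(3)] shuw[OF rp(2)] by auto
    next
      fix j0 assume yu: "y \<in> {u, w}" and j0: "j0 \<noteq> i" "j = shift i j0" "2 \<le> j \<and> j < N + 1 \<longleftrightarrow> 2 \<le> j0 \<and> j0 < N"
      have "j0 \<in> set l2 \<longleftrightarrow> 2 \<le> j0 \<and> j0 < N \<and> src j0 = p \<and> j0 \<notin> set l1"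
        using Mm[OF p'(1,2), of j0] lm nl j0 by auto
      moreover have "j0 \<in> set (Ls i) \<longleftrightarrow> 2 \<le> j0 \<and> j0 < N \<and> src j0 = i" using Mm[of i j0] i2 by auto
      moreover have "src' (shift i j0) = u \<longleftrightarrow> src j0 = p \<and> j0 \<notin> set l1"
        using ssh[OF j0(1)] shuw[OF p'(3)] shuw(1)[of "src j0"] uw'(1) by metis
      moreover have "src' (shift i j0) = w \<longleftrightarrow> src j0 = i"
        using ssh[OF j0(1)] shuw[OF p'(3)] shuw(2)[of "src j0"] uw'(1) p'(3) by metis
      moreover have "j \<in> set (Ls' u) \<longleftrightarrow> j0 \<in> set l2" "j \<in> set (Ls' w) \<longleftrightarrow> j0 \<in> set (Ls i)"
        using Lu memmap j0(2) by simp_all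
      ultimately show ?thesis
        using yu j0(2,3) by blast
    next
      fix b assume ju: "j \<in> {u, w}" and b: "b \<noteq> i" "y = shift i b" "1 \<le> y \<longrightarrow> y \<le> N + 1 \<longrightarrow> 1 \<le> b \<and> b \<le> N"
      have "i \<notin> set l1" "b \<noteq> p \<Longrightarrow> i \<notin> set (Ls b)" using nl other_i b y by auto
      then have "u \<notin> set (map (shift i) l1)" "w \<notin> set (map (shift i) l1)"
        "b \<noteq> p \<Longrightarrow> u \<notin> set (map (shift i) (Ls b))" "b \<noteq> p \<Longrightarrow> w \<notin> set (map (shift i) (Ls b))"
        using umap by blast+
      then have "u \<in> set (Ls' y) \<longleftrightarrow> b = p" "w \<in> set (Ls' y) \<longleftrightarrow> b = r"
        using Lsh[OF b(1)] b(2) uw'(1) rp(1) by auto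
      then show ?thesis
        using ju suw b(2) shift_eq_iff uwin by auto
    next
      fix b j0 assume b: "b \<noteq> i" "y = shift i b" "1 \<le> y \<longrightarrow> y \<le> N + 1 \<longrightarrow> 1 \<le> b \<and> b \<le> N"
        and j0: "j0 \<noteq> i" "j = shift i j0" "2 \<le> j \<and> j < N + 1 \<longleftrightarrow> 2 \<le> j0 \<and> j0 < N"
      have bb: "1 \<le> b" "b \<le> N" using b y by auto
      have "j \<in> set (Ls' y) \<longleftrightarrow> (if b = p then j0 \<in> set l1 else j0 \<in> set (Ls b))"
        using Lsh[OF b(1)] b(2) j0(2) memmap shuw[OF j0(1)] by auto
      also have "\<dots> \<longleftrightarrow> 2 \<le> j0 \<and> j0 < N \<and> src' j = y"
        using ssh[OF j0(1)] Mm[OF bb, of j0] b j0 lm shift_eq_iff shuw[OF b(1)] by auto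
      finally show ?thesis using j0(3) by blast
    qed
  qed
  have "marked (N + 1) col' Ls' src' sw'"
    unfolding marked_def
  proof (intro allI impI)
    fix y assume y: "1 \<le> y \<and> y \<le> N + 1"
    have iL: "i \<notin> set (Ls i)" "i \<notin> set (Ls r)" using other_i[of i] other_i[of r] i2 p'(3) r rp by auto
    have Lp: "distinct l1" "distinct l2" "sorted_wrt (<) (filter (\<lambda>j. cl j = Black) l1)"
      "sorted_wrt (<) (filter (\<lambda>j. cl j = Black) l2)" using Md[OF p'(1,2)] Mb[OF p'(1,2)] l by (auto simp: sorted_wrt_append split: if_splits)
    have Lpw: "sorted_wrt (>) (filter (\<lambda>j. cl j = White) l1)" "sorted_wrt (>) (filter (\<lambda>j. cl j = White) l2)" if sw
      using Mw[OF p'(1,2) that] l by (auto simp: sorted_wrt_append split: if_splits)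
    let ?good = "\<lambda>L. distinct L \<and> sorted_wrt (<) (filter (\<lambda>j. col' j = Black) L) \<and>
       (sw' \<longrightarrow> sorted_wrt (>) (filter (\<lambda>j. col' j = White) L))"
    have good_map: "?good (map (shift i) L)" if "i \<notin> set L" "distinct L" "sorted_wrt (<) (filter (\<lambda>j. cl j = Black) L)"
      "sw \<Longrightarrow> sorted_wrt (>) (filter (\<lambda>j. cl j = White) L)" for L
      using that sw' by (simp add: filt sorted_map_shift distinct_map_shift)
    have good_p: "?good (map (shift i) l1 @ [u])"
    proof -
      have a: "\<forall>a\<in>set l1. cl a = c \<longrightarrow> (if c = Black then a < i else a > i)"
      proof (intro ballI impI)
        fix a assume a: "a \<in> set l1" "cl a = c"
        then have "a \<in> set (Ls p)" "a \<noteq> i" using l nl by auto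
        then show "if c = Black then a < i else a > i" using order a by simp
      qed
      show ?thesis
      proof (cases "c = Black")
        case True
        then have u: "u = i" using uw by simp
        have "\<forall>a\<in>set (map (shift i) (filter (\<lambda>j. cl j = Black) l1)). a < i" using a True by (auto simp: shift_def)
        then show ?thesis using good_map[OF nl(1) Lp(1,3) Lpw(1)] umap(1)[OF nl(1)] u coluw
          by (auto simp: filt[OF nl(1)] sorted_wrt_append)
      next
        case False
        then have u: "u = i + 1" "c = White" using uw by (auto, cases c, auto)
        have "\<forall>a\<in>set (map (shift i) (filter (\<lambda>j. cl j = White) l1)). a > i + 1" using a u by (auto simp: shift_def)
        then show ?thesis using good_map[OF nl(1) Lp(1,3) Lpw(1)] umap(1)[OF nl(1)] u coluw
          by (auto simp: filt[OF nl(1)] sorted_wrt_append)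
      qed
    qed
    have good_r: "?good (map (shift i) (Ls r) @ [w])"
    proof -
      note g = good_map[OF iL(2) Md[OF r(1,2)] Mb[OF r(1,2)] Mw[OF r(1,2)]]
      show ?thesis
      proof (cases "c = Black")
        case True
        then have w: "w = i + 1" using uw by simp
        have "a > i" if "sw'" "a \<in> set (Ls r)" "cl a = White" for a
          using hw[OF True, of a] Mm[OF r(1,2), of a] that by simp
        then have "\<forall>a\<in>set (map (shift i) (filter (\<lambda>j. cl j = White) (Ls r))). a > i + 1" if sw'
          using that by (fastforce simp: shift_def)
        then show ?thesis using g umap(2)[OF iL(2)] w coluw
          by (auto simp: filt[OF iL(2)] sorted_wrt_append)
      next
        case False
        then have w: "w = i" "c = White" using uw by (auto, cases c, auto)
        have "a < i" if "a \<in> set (Ls r)" "cl a = Black" for a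
          using hb[OF w(2), of a] Mm[OF r(1,2), of a] that by simp
        then have "\<forall>a\<in>set (map (shift i) (filter (\<lambda>j. cl j = Black) (Ls r))). a < i"
          by (fastforce simp: shift_def)
        then show ?thesis using g umap(2)[OF iL(2)] w coluw
          by (auto simp: filt[OF iL(2)] sorted_wrt_append)
      qed
    qed
    have "?good (Ls' y)"
      using split[of y]
    proof (elim disjE exE conjE)
      assume "y \<in> {u, w}"
      then consider "y = u" | "y = w" by blast
      then show ?thesis
      proof cases
        case 1
        show ?thesis unfolding 1 Lu by (rule good_map[OF nl(2) Lp(2,4) Lpw(2)])
      next
        case 2
        have "1 \<le> i" "i \<le> N" using i2 by auto
        then show ?thesis unfolding 2 Lu by (intro good_map[OF iL(1)] Md Mb Mw)
      qed
    next
      fix b assume b: "b \<noteq> i" "y = shift i b" "1 \<le> y \<longrightarrow> y \<le> N + 1 \<longrightarrow> 1 \<le> b \<and> b \<le> N"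
      then have bb: "1 \<le> b" "b \<le> N" using y by auto
      consider "b = p" | "b = r" "b \<noteq> p" | "b \<noteq> p" "b \<noteq> r" by blast
      then show ?thesis
      proof cases
        case 1
        then show ?thesis using good_p Lsh[OF b(1)] b(2) by simp
      next
        case 2
        then show ?thesis using good_r Lsh[OF b(1)] b(2) by simp
      next
        case 3
        then have "Ls' y = map (shift i) (Ls b)" using Lsh[OF b(1)] b(2) by simp
        then show ?thesis using good_map[OF other_i[OF bb 3(1)] Md[OF bb] Mb[OF bb] Mw[OF bb]] by simp
      qed
    qed
    then show "distinct (Ls' y) \<and> (\<forall>j. (j \<in> set (Ls' y)) = (2 \<le> j \<and> j < N + 1 \<and> src' j = y)) \<and>
      sorted_wrt (<) (filter (\<lambda>j. col' j = Black) (Ls' y)) \<and>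
      (sw' \<longrightarrow> sorted_wrt (>) (filter (\<lambda>j. col' j = White) (Ls' y)))"
      using mem y by blast
  qed
  then have "trip_state H (N + 1) col' src' \<pi>' sw'" using TH unfolding trip_state_def by blast
  moreover have "src' (shift i j) = (if src j = src i then (if (if c = Black then j < i else j > i) then shift i (src i) else u)
       else if src j = i then w else shift i (src j))" if "2 \<le> j" "j < N" "j \<noteq> i" "cl j = c \<or> src j \<noteq> src i" for j
  proof (cases "src j = p")
    case True
    then have "j \<in> set (Ls p)" "cl j = c" using Mm[OF p'(1,2), of j] that by (auto simp: p_def)
    then show ?thesis using order[of j] ssh[OF that(3)] True that(3) by (simp add: p_def)
  next
    case False
    then show ?thesis using ssh[OF that(3)] by (simp add: p_def)
  qed
  ultimately show ?thesis using suw unfolding col'_def p_def by blast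
qed

section \<open>The effect of blowing up on the permutation\<close>

text \<open>On \<open>1, ..., n\<close> this is the inverse of the square of
  \<open>long_cycle n\<close>. Trip permutations are kept as \<open>up2 n\<close> after the
  permutation of the cell.\<close>

definition up2 :: "nat \<Rightarrow> nat \<Rightarrow> nat" where
  "up2 n y = (if y + 2 \<le> n then y + 2 else y + 2 - n)"
text \<open>The analogue of \<open>perm_S\<close> and \<open>perm_N\<close> for a single chord
  \<open>(i, j)\<close>; with no chord the permutation is the identity.\<close>

definition perm_1 :: "nat \<Rightarrow> nat \<Rightarrow> nat \<Rightarrow> nat \<Rightarrow> nat" where
  "perm_1 n i j x = (if x = i then i + 1 else if x = i + 1 then j else if x = j then j + 1
     else if x = j + 1 then n else if x = n then i else x)"

lemma perm_1_fix: "x \<notin> {i, i + 1, j, j + 1, n} \<Longrightarrow> perm_1 n i j x = x"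
  by (simp add: perm_1_def)

lemma perm_S_fix: "x \<notin> {i, i + 1, j, j + 1, k, k + 1, l, l + 1, n} \<Longrightarrow> perm_S n i j k l x = x"
  by (simp add: perm_S_def)

lemma perm_N_fix: "x \<notin> {i, i + 1, j, j + 1, k, k + 1, l, l + 1, n} \<Longrightarrow> perm_N n i j k l x = x"
  by (simp add: perm_N_def)

text \<open>How the trip permutation \<open>\<pi>\<close> of a graph changes to \<open>\<pi>'\<close> when the graph is blown up at \<open>i\<close>,
  where \<open>p\<close> is the start of the trip through the vertex at \<open>i\<close>, and \<open>r\<close> that of the trip to \<open>i\<close>.\<close>

definition perm_step_at where
  "perm_step_at n i \<pi> p r \<pi>' b \<longleftrightarrow>
     (\<pi> b = i \<longrightarrow> b = r) \<and> (b \<noteq> i \<longrightarrow> b \<noteq> p \<longrightarrow> b \<noteq> r \<longrightarrow> \<pi>' (shift i b) = shift i (\<pi> b))"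

definition perm_step :: "nat \<Rightarrow> nat \<Rightarrow> color \<Rightarrow> (nat \<Rightarrow> nat) \<Rightarrow> nat \<Rightarrow> nat \<Rightarrow> (nat \<Rightarrow> nat) \<Rightarrow> bool" where
  "perm_step n i c \<pi> p r \<pi>' \<longleftrightarrow>
    (let u = (if c = Black then i else i + 1); w = (if c = Black then i + 1 else i) in
      1 \<le> p \<and> p \<le> n \<and> p \<noteq> i \<and> 1 \<le> r \<and> r \<le> n \<and> \<pi> r = i \<and> \<pi> i \<noteq> i \<and> \<pi> p \<noteq> i \<and>
      \<pi>' (shift i p) = w \<and> \<pi>' (shift i r) = u \<and> \<pi>' u = shift i (\<pi> p) \<and> \<pi>' w = shift i (\<pi> i) \<and>
      (\<forall>b. 1 \<le> b \<and> b \<le> n \<longrightarrow> perm_step_at n i \<pi> p r \<pi>' b))"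

lemma perm_stepI:
  assumes "1 \<le> p" "p \<le> n" "p \<noteq> i" "1 \<le> r" "r \<le> n" "\<pi> r = i" "\<pi> i \<noteq> i" "\<pi> p \<noteq> i"
    "\<pi>' (shift i p) = (if c = Black then i + 1 else i)" "\<pi>' (shift i r) = (if c = Black then i else i + 1)"
    "\<pi>' (if c = Black then i else i + 1) = shift i (\<pi> p)" "\<pi>' (if c = Black then i + 1 else i) = shift i (\<pi> i)"
    "\<And>b. 1 \<le> b \<Longrightarrow> b \<le> n \<Longrightarrow> perm_step_at n i \<pi> p r \<pi>' b"
  shows "perm_step n i c \<pi> p r \<pi>'"
  using assms unfolding perm_step_def Let_def by blast

text \<open>At fixed points of the cell permutation only \<open>up2\<close> acts, and it commutes
  with the relabelling unless its jump lands on \<open>i\<close> or crosses it.\<close>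

lemma step_at_other:
  assumes "2 \<le> i" "i < n" "1 \<le> b" "b \<le> n" "b \<noteq> i" "b + 1 \<noteq> i" "b + 2 \<noteq> i" "i = 2 \<Longrightarrow> b \<noteq> n"
    "\<pi> b = up2 n b" "\<pi>' (shift i b) = up2 (n + 1) (shift i b)"
  shows "perm_step_at n i \<pi> p r \<pi>' b"
proof -
  have "up2 n b \<noteq> i" using assms(1-8) by (cases "i = 2") (auto simp: up2_def)
  moreover have "up2 (n + 1) (shift i b) = shift i (up2 n b)"
    using assms(1-6) by (cases "b < i") (auto simp: up2_def shift_def)
  ultimately show ?thesis using assms(9,10) by (simp add: perm_step_at_def)
qed

lemma perm_step_0_black:
  assumes "n \<ge> 4"
  shows "perm_step n 2 Black (up2 n) 1 n (up2 (n + 1))"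
proof -
  have at: "perm_step_at n 2 (up2 n) 1 n (up2 (n + 1)) b" if b: "1 \<le> b" "b \<le> n" for b
  proof -
    consider "b = n" | "b = 1" | "b = 2" | "b = n - 1" |
      (o) "b \<notin> {n, 1, 2, n - 1}" by blast
    then show ?thesis
    proof cases
      case o
      show ?thesis by (rule step_at_other) (use assms b o in \<open>simp_all\<close>)
    qed (insert assms b, simp_all add: perm_step_at_def  up2_def shift_def, (arith+)?)
  qed
  show ?thesis by (rule perm_stepI; (rule at; assumption)?)
    (insert assms, simp_all add:  up2_def shift_def, (arith+)?)
qed

text \<open>A white blow-up at \<open>a + 2\<close> creates a chord of the shortest length,
  \<open>(a, a + 2)\<close>.\<close>

lemma perm_step_0_white:
  assumes "1 \<le> a" "a + 3 \<le> n"
  shows "perm_step n (a + 2) White (up2 n) n a (up2 (n + 1) \<circ> perm_1 (n + 1) a (a + 2))"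
proof -
  have at: "perm_step_at n (a + 2) (up2 n) n a (up2 (n + 1) \<circ> perm_1 (n + 1) a (a + 2)) b" if b: "1 \<le> b" "b \<le> n" for b
  proof -
    consider "b = a" | "b = a + 1" | "b = a + 2" | "b = n" | "b = n - 1" |
      (o) "b \<notin> {a, a + 1, a + 2, n, n - 1}" by blast
    then show ?thesis
    proof cases
      case o
      have g: "perm_1 (n + 1) a (a + 2) (shift (a + 2) b) = shift (a + 2) b" using assms b o by (intro perm_1_fix) (auto simp: shift_def)
      show ?thesis by (rule step_at_other) (use assms b o g in \<open>simp_all\<close>)
    qed (insert assms b, simp_all add: perm_step_at_def perm_1_def up2_def shift_def, (arith+)?)
  qed
  show ?thesis by (rule perm_stepI; (rule at; assumption)?)
    (insert assms, simp_all add: perm_1_def up2_def shift_def, (arith+)?)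
qed

text \<open>Blowing up at 2 moves all chords one place to the right.\<close>

lemma perm_step_1_black2:
  assumes "1 \<le> i" "i + 2 \<le> j" "j + 2 \<le> n"
  shows "perm_step n 2 Black (up2 n \<circ> perm_1 n i j) 1 (j + 1) (up2 (n + 1) \<circ> perm_1 (n + 1) (i + 1) (j + 1))"
proof -
  have at: "perm_step_at n 2 (up2 n \<circ> perm_1 n i j) 1 (j + 1) (up2 (n + 1) \<circ> perm_1 (n + 1) (i + 1) (j + 1)) b" if b: "1 \<le> b" "b \<le> n" for b
  proof -
    consider "b = i" | "b = i + 1" | "b = j" | "b = j + 1" | "b = n" | "b = 1" | "b = 2" |
      (o) "b \<notin> {i, i + 1, j, j + 1, n, 1, 2}" by blast
    then show ?thesis
    proof cases
      case o
      then have f: "perm_1 n i j b = b" by (intro perm_1_fix) auto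
      have g: "perm_1 (n + 1) (i + 1) (j + 1) (shift 2 b) = shift 2 b" using assms b o by (intro perm_1_fix) (auto simp: shift_def)
      show ?thesis by (rule step_at_other) (use assms b o f g in \<open>simp_all\<close>)
    qed (insert assms b, simp_all add: perm_step_at_def perm_1_def up2_def shift_def, (arith+)?)
  qed
  show ?thesis by (rule perm_stepI; (rule at; assumption)?)
    (insert assms, simp_all add: perm_1_def up2_def shift_def, (arith+)?)
qed

text \<open>Blowing up at the black place \<open>i + 2\<close> lengthens the chord that starts at
  \<open>i\<close>.\<close>

lemma perm_step_1_black_i:
  assumes "1 \<le> i" "i + 2 \<le> j" "j + 2 \<le> n"
  shows "perm_step n (i + 2) Black (up2 n \<circ> perm_1 n i j) i n (up2 (n + 1) \<circ> perm_1 (n + 1) i (j + 1))"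
proof -
  have at: "perm_step_at n (i + 2) (up2 n \<circ> perm_1 n i j) i n (up2 (n + 1) \<circ> perm_1 (n + 1) i (j + 1)) b" if b: "1 \<le> b" "b \<le> n" for b
  proof -
    consider "b = i" | "b = i + 1" | "b = j" | "b = j + 1" | "b = n" | "b = i + 2" |
      (o) "b \<notin> {i, i + 1, j, j + 1, n, i + 2}" by blast
    then show ?thesis
    proof cases
      case o
      then have f: "perm_1 n i j b = b" by (intro perm_1_fix) auto
      have g: "perm_1 (n + 1) i (j + 1) (shift (i + 2) b) = shift (i + 2) b" using assms b o by (intro perm_1_fix) (auto simp: shift_def)
      show ?thesis by (rule step_at_other) (use assms b o f g in \<open>simp_all\<close>)
    qed (insert assms b, simp_all add: perm_step_at_def perm_1_def up2_def shift_def, (arith+)?)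
  qed
  show ?thesis by (rule perm_stepI; (rule at; assumption)?)
    (insert assms, simp_all add: perm_1_def up2_def shift_def, (arith+)?)
qed

text \<open>The new chord lies to the left of the old one.\<close>

lemma perm_step_1_white_low:
  assumes "1 \<le> i" "i + 2 \<le> j" "j + 2 \<le> n" "1 \<le> a" "a + 1 \<le> i"
  shows "perm_step n (a + 2) White (up2 n \<circ> perm_1 n i j) (j + 1) a (up2 (n + 1) \<circ> perm_S (n + 1) a (a + 2) (i + 1) (j + 1))"
proof -
  have at: "perm_step_at n (a + 2) (up2 n \<circ> perm_1 n i j) (j + 1) a (up2 (n + 1) \<circ> perm_S (n + 1) a (a + 2) (i + 1) (j + 1)) b" if b: "1 \<le> b" "b \<le> n" for b
  proof -
    consider "b = i" | "b = i + 1" | "b = j" | "b = j + 1" | "b = n" | "b = a" | "b = a + 1" | "b = a + 2" |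
      (o) "b \<notin> {i, i + 1, j, j + 1, n, a, a + 1, a + 2}" by blast
    then show ?thesis
    proof cases
      case o
      then have f: "perm_1 n i j b = b" by (intro perm_1_fix) auto
      have g: "perm_S (n + 1) a (a + 2) (i + 1) (j + 1) (shift (a + 2) b) = shift (a + 2) b" using assms b o by (intro perm_S_fix) (auto simp: shift_def)
      show ?thesis by (rule step_at_other) (use assms b o f g in \<open>simp_all\<close>)
    qed (insert assms b, simp_all add: perm_step_at_def perm_1_def perm_S_def up2_def shift_def, (arith+)?)
  qed
  show ?thesis by (rule perm_stepI; (rule at; assumption)?)
    (insert assms, simp_all add: perm_1_def perm_S_def up2_def shift_def, (arith+)?)
qed

text \<open>The new chord lies inside the old one, which grows by one place.\<close>

lemma perm_step_1_white_mid:
  assumes "1 \<le> i" "i + 2 \<le> j" "j + 2 \<le> n" "i + 1 \<le> a" "a + 1 \<le> j"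
  shows "perm_step n (a + 2) White (up2 n \<circ> perm_1 n i j) n (if a = i + 1 then i else a) (up2 (n + 1) \<circ> perm_N (n + 1) i (j + 1) a (a + 2))"
proof -
  have at: "perm_step_at n (a + 2) (up2 n \<circ> perm_1 n i j) n (if a = i + 1 then i else a) (up2 (n + 1) \<circ> perm_N (n + 1) i (j + 1) a (a + 2)) b" if b: "1 \<le> b" "b \<le> n" for b
  proof -
    consider "b = i" | "b = i + 1" | "b = j" | "b = j + 1" | "b = n" | "b = a" | "b = a + 1" | "b = a + 2" |
      (o) "b \<notin> {i, i + 1, j, j + 1, n, a, a + 1, a + 2}" by blast
    then show ?thesis
    proof cases
      case o
      then have f: "perm_1 n i j b = b" by (intro perm_1_fix) auto
      have g: "perm_N (n + 1) i (j + 1) a (a + 2) (shift (a + 2) b) = shift (a + 2) b" using assms b o by (intro perm_N_fix) (auto simp: shift_def)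
      show ?thesis by (rule step_at_other) (use assms b o f g in \<open>simp_all\<close>)
    qed (insert assms b, simp_all add: perm_step_at_def perm_1_def perm_N_def up2_def shift_def, (arith+)?)
  qed
  show ?thesis by (rule perm_stepI; (rule at; assumption)?)
    (insert assms, simp_all add: perm_1_def perm_N_def up2_def shift_def, (arith+)?)
qed

text \<open>The new chord lies to the right. For \<open>a = j\<close> and \<open>a = j + 1\<close>
  it overlaps the old one, which changes the start of the trip to \<open>a + 2\<close>.\<close>

lemma perm_step_1_white_high:
  assumes "1 \<le> i" "i + 2 \<le> j" "j + 2 \<le> n" "j \<le> a" "a + 3 \<le> n"
  shows "perm_step n (a + 2) White (up2 n \<circ> perm_1 n i j) n (if a = j then i + 1 else if a = j + 1 then j else a) (up2 (n + 1) \<circ> perm_S (n + 1) i j a (a + 2))"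
proof -
  have at: "perm_step_at n (a + 2) (up2 n \<circ> perm_1 n i j) n (if a = j then i + 1 else if a = j + 1 then j else a) (up2 (n + 1) \<circ> perm_S (n + 1) i j a (a + 2)) b" if b: "1 \<le> b" "b \<le> n" for b
  proof -
    consider "b = i" | "b = i + 1" | "b = j" | "b = j + 1" | "b = n" | "b = a" | "b = a + 1" | "b = a + 2" |
      (o) "b \<notin> {i, i + 1, j, j + 1, n, a, a + 1, a + 2}" by blast
    then show ?thesis
    proof cases
      case o
      then have f: "perm_1 n i j b = b" by (intro perm_1_fix) auto
      have g: "perm_S (n + 1) i j a (a + 2) (shift (a + 2) b) = shift (a + 2) b" using assms b o by (intro perm_S_fix) (auto simp: shift_def)
      show ?thesis by (rule step_at_other) (use assms b o f g in \<open>simp_all\<close>)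
    qed (insert assms b, simp_all add: perm_step_at_def perm_1_def perm_S_def up2_def shift_def, (arith+)?)
  qed
  show ?thesis by (rule perm_stepI; (rule at; assumption)?)
    (insert assms, simp_all add: perm_1_def perm_S_def up2_def shift_def, (arith+)?)
qed

lemma perm_step_S_black2:
  assumes "1 \<le> i" "i + 2 \<le> j" "j \<le> k" "k + 2 \<le> l" "l + 2 \<le> n"
  shows "perm_step n 2 Black (up2 n \<circ> perm_S n i j k l) 1 (j + 1) (up2 (n + 1) \<circ> perm_S (n + 1) (i + 1) (j + 1) (k + 1) (l + 1))"
proof -
  have at: "perm_step_at n 2 (up2 n \<circ> perm_S n i j k l) 1 (j + 1) (up2 (n + 1) \<circ> perm_S (n + 1) (i + 1) (j + 1) (k + 1) (l + 1)) b" if b: "1 \<le> b" "b \<le> n" for b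
  proof -
    consider "b = i" | "b = i + 1" | "b = j" | "b = j + 1" | "b = k" | "b = k + 1" | "b = l" | "b = l + 1" | "b = n" | "b = 1" | "b = 2" |
      (o) "b \<notin> {i, i + 1, j, j + 1, k, k + 1, l, l + 1, n, 1, 2}" by blast
    then show ?thesis
    proof cases
      case o
      then have f: "perm_S n i j k l b = b" by (intro perm_S_fix) auto
      have g: "perm_S (n + 1) (i + 1) (j + 1) (k + 1) (l + 1) (shift 2 b) = shift 2 b" using assms b o by (intro perm_S_fix) (auto simp: shift_def)
      show ?thesis by (rule step_at_other) (use assms b o f g in \<open>simp_all\<close>)
    qed (insert assms b, simp_all add: perm_step_at_def perm_S_def up2_def shift_def, (arith+)?)
  qed
  show ?thesis by (rule perm_stepI; (rule at; assumption)?)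
    (insert assms, simp_all add: perm_S_def up2_def shift_def, (arith+)?)
qed

lemma perm_step_S_black_i:
  assumes "1 \<le> i" "i + 2 \<le> j" "j \<le> k" "k + 2 \<le> l" "l + 2 \<le> n"
  shows "perm_step n (i + 2) Black (up2 n \<circ> perm_S n i j k l) i (l + 1) (up2 (n + 1) \<circ> perm_S (n + 1) i (j + 1) (k + 1) (l + 1))"
proof -
  have at: "perm_step_at n (i + 2) (up2 n \<circ> perm_S n i j k l) i (l + 1) (up2 (n + 1) \<circ> perm_S (n + 1) i (j + 1) (k + 1) (l + 1)) b" if b: "1 \<le> b" "b \<le> n" for b
  proof -
    consider "b = i" | "b = i + 1" | "b = j" | "b = j + 1" | "b = k" | "b = k + 1" | "b = l" | "b = l + 1" | "b = n" | "b = i + 2" |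
      (o) "b \<notin> {i, i + 1, j, j + 1, k, k + 1, l, l + 1, n, i + 2}" by blast
    then show ?thesis
    proof cases
      case o
      then have f: "perm_S n i j k l b = b" by (intro perm_S_fix) auto
      have g: "perm_S (n + 1) i (j + 1) (k + 1) (l + 1) (shift (i + 2) b) = shift (i + 2) b" using assms b o by (intro perm_S_fix) (auto simp: shift_def)
      show ?thesis by (rule step_at_other) (use assms b o f g in \<open>simp_all\<close>)
    qed (insert assms b, simp_all add: perm_step_at_def perm_S_def up2_def shift_def, (arith+)?)
  qed
  show ?thesis by (rule perm_stepI; (rule at; assumption)?)
    (insert assms, simp_all add: perm_S_def up2_def shift_def, (arith+)?)
qed

lemma perm_step_S_black_k:
  assumes "1 \<le> i" "i + 2 \<le> j" "j \<le> k" "k + 2 \<le> l" "l + 2 \<le> n"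
  shows "perm_step n (k + 2) Black (up2 n \<circ> perm_S n i j k l) (if k = j + 1 then j else if k = j then i + 1 else k) n (up2 (n + 1) \<circ> perm_S (n + 1) i j k (l + 1))"
proof -
  have at: "perm_step_at n (k + 2) (up2 n \<circ> perm_S n i j k l) (if k = j + 1 then j else if k = j then i + 1 else k) n (up2 (n + 1) \<circ> perm_S (n + 1) i j k (l + 1)) b" if b: "1 \<le> b" "b \<le> n" for b
  proof -
    consider "b = i" | "b = i + 1" | "b = j" | "b = j + 1" | "b = k" | "b = k + 1" | "b = l" | "b = l + 1" | "b = n" | "b = k + 2" |
      (o) "b \<notin> {i, i + 1, j, j + 1, k, k + 1, l, l + 1, n, k + 2}" by blast
    then show ?thesis
    proof cases
      case o
      then have f: "perm_S n i j k l b = b" by (intro perm_S_fix) auto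
      have g: "perm_S (n + 1) i j k (l + 1) (shift (k + 2) b) = shift (k + 2) b" using assms b o by (intro perm_S_fix) (auto simp: shift_def)
      show ?thesis by (rule step_at_other) (use assms b o f g in \<open>simp_all\<close>)
    qed (insert assms b, simp_all add: perm_step_at_def perm_S_def up2_def shift_def, (arith+)?)
  qed
  show ?thesis by (rule perm_stepI; (rule at; assumption)?)
    (insert assms, simp_all add: perm_S_def up2_def shift_def, (arith+)?)
qed

lemma perm_step_N_black2:
  assumes "1 \<le> i" "i + 1 \<le> k" "k + 2 \<le> l" "l \<le> j" "j + 2 \<le> n"
  shows "perm_step n 2 Black (up2 n \<circ> perm_N n i j k l) 1 (if l = j then j else j + 1) (up2 (n + 1) \<circ> perm_N (n + 1) (i + 1) (j + 1) (k + 1) (l + 1))"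
proof -
  have at: "perm_step_at n 2 (up2 n \<circ> perm_N n i j k l) 1 (if l = j then j else j + 1) (up2 (n + 1) \<circ> perm_N (n + 1) (i + 1) (j + 1) (k + 1) (l + 1)) b" if b: "1 \<le> b" "b \<le> n" for b
  proof -
    consider "b = i" | "b = i + 1" | "b = j" | "b = j + 1" | "b = k" | "b = k + 1" | "b = l" | "b = l + 1" | "b = n" | "b = 1" | "b = 2" |
      (o) "b \<notin> {i, i + 1, j, j + 1, k, k + 1, l, l + 1, n, 1, 2}" by blast
    then show ?thesis
    proof cases
      case o
      then have f: "perm_N n i j k l b = b" by (intro perm_N_fix) auto
      have g: "perm_N (n + 1) (i + 1) (j + 1) (k + 1) (l + 1) (shift 2 b) = shift 2 b" using assms b o by (intro perm_N_fix) (auto simp: shift_def)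
      show ?thesis by (rule step_at_other) (use assms b o f g in \<open>simp_all\<close>)
    qed (insert assms b, simp_all add: perm_step_at_def perm_N_def up2_def shift_def, (arith+)?)
  qed
  show ?thesis by (rule perm_stepI; (rule at; assumption)?)
    (insert assms, simp_all add: perm_N_def up2_def shift_def, (arith+)?)
qed

text \<open>The inner chord moves even for \<open>k = i + 1\<close>, so an overlap of the left
  dominoes is undone.\<close>

lemma perm_step_N_black_i:
  assumes "1 \<le> i" "i + 1 \<le> k" "k + 2 \<le> l" "l \<le> j" "j + 2 \<le> n"
  shows "perm_step n (i + 2) Black (up2 n \<circ> perm_N n i j k l) i (l + 1) (up2 (n + 1) \<circ> perm_N (n + 1) i (j + 1) (k + 1) (l + 1))"
proof -
  have at: "perm_step_at n (i + 2) (up2 n \<circ> perm_N n i j k l) i (l + 1) (up2 (n + 1) \<circ> perm_N (n + 1) i (j + 1) (k + 1) (l + 1)) b" if b: "1 \<le> b" "b \<le> n" for b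
  proof -
    consider "b = i" | "b = i + 1" | "b = j" | "b = j + 1" | "b = k" | "b = k + 1" | "b = l" | "b = l + 1" | "b = n" | "b = i + 2" |
      (o) "b \<notin> {i, i + 1, j, j + 1, k, k + 1, l, l + 1, n, i + 2}" by blast
    then show ?thesis
    proof cases
      case o
      then have f: "perm_N n i j k l b = b" by (intro perm_N_fix) auto
      have g: "perm_N (n + 1) i (j + 1) (k + 1) (l + 1) (shift (i + 2) b) = shift (i + 2) b" using assms b o by (intro perm_N_fix) (auto simp: shift_def)
      show ?thesis by (rule step_at_other) (use assms b o f g in \<open>simp_all\<close>)
    qed (insert assms b, simp_all add: perm_step_at_def perm_N_def up2_def shift_def, (arith+)?)
  qed
  show ?thesis by (rule perm_stepI; (rule at; assumption)?)
    (insert assms, simp_all add: perm_N_def up2_def shift_def, (arith+)?)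
qed

lemma perm_step_N_black_k:
  assumes "1 \<le> i" "i + 1 \<le> k" "k + 2 \<le> l" "l \<le> j" "j + 2 \<le> n"
  shows "perm_step n (k + 2) Black (up2 n \<circ> perm_N n i j k l) (if k = i + 1 then i else k) n (up2 (n + 1) \<circ> perm_N (n + 1) i (j + 1) k (l + 1))"
proof -
  have at: "perm_step_at n (k + 2) (up2 n \<circ> perm_N n i j k l) (if k = i + 1 then i else k) n (up2 (n + 1) \<circ> perm_N (n + 1) i (j + 1) k (l + 1)) b" if b: "1 \<le> b" "b \<le> n" for b
  proof -
    consider "b = i" | "b = i + 1" | "b = j" | "b = j + 1" | "b = k" | "b = k + 1" | "b = l" | "b = l + 1" | "b = n" | "b = k + 2" |
      (o) "b \<notin> {i, i + 1, j, j + 1, k, k + 1, l, l + 1, n, k + 2}" by blast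
    then show ?thesis
    proof cases
      case o
      then have f: "perm_N n i j k l b = b" by (intro perm_N_fix) auto
      have g: "perm_N (n + 1) i (j + 1) k (l + 1) (shift (k + 2) b) = shift (k + 2) b" using assms b o by (intro perm_N_fix) (auto simp: shift_def)
      show ?thesis by (rule step_at_other) (use assms b o f g in \<open>simp_all\<close>)
    qed (insert assms b, simp_all add: perm_step_at_def perm_N_def up2_def shift_def, (arith+)?)
  qed
  show ?thesis by (rule perm_stepI; (rule at; assumption)?)
    (insert assms, simp_all add: perm_N_def up2_def shift_def, (arith+)?)
qed

section \<open>The initial graph\<close>

definition blacks :: "nat set \<Rightarrow> nat \<Rightarrow> color" where
  "blacks B b = (if b \<in> B then Black else White)"

lemma halves_base_iff: "h \<in> halves bcfw_base \<longleftrightarrow> h \<in> set [1, 2, 3, 4, 5, 6, 7, 8, 9, 10, 11, 12, 13, 14, 15, 16]"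
proof -
  have "[1..<17] = [1, 2, 3, 4, 5, 6, 7, 8, 9, 10, 11, 12, 13, 14, 15, 16]" by code_simp
  moreover have "h \<in> {1..16} \<longleftrightarrow> h \<in> set [1..<17]" by auto
  ultimately show ?thesis by (simp add: bcfw_base_def)
qed

lemma base_tables:
  "\<forall>h \<in> set [1, 2, 3, 4, 5, 6, 7, 8, 9, 10, 11, 12, 13, 14, 15, 16].
    (opp bcfw_base h \<in> set [1, 2, 3, 4, 5, 6, 7, 8, 9, 10, 11, 12, 13, 14, 15, 16] \<and> opp bcfw_base (opp bcfw_base h) = h) \<and>
    cw bcfw_base h \<in> set [1, 2, 3, 4, 5, 6, 7, 8, 9, 10, 11, 12, 13, 14, 15, 16] \<and>
    vert bcfw_base (cw bcfw_base h) = vert bcfw_base h"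
  by (simp add: bcfw_base_def)

text \<open>Half-edges 10 and 15 are \<open>thr 2\<close> and \<open>thr 3\<close> of the initial
  graph, where internal vertex 2 is black and 3 is white.\<close>

definition base_marks :: "nat \<Rightarrow> nat list" where
  "base_marks = (\<lambda>h. if h = 10 then [2] else if h = 15 then [3] else [])"

lemma base_data: "plabic_data bcfw_base 4 (\<lambda>b. b) (blacks {2}) base_marks"
proof
  show "num_boundary bcfw_base = 4" by (simp add: bcfw_base_def)
  show "inj_on (cw bcfw_base) (halves bcfw_base)"
  proof (rule inj_onI)
    fix g h assume "g \<in> halves bcfw_base" "h \<in> halves bcfw_base" "cw bcfw_base g = cw bcfw_base h"
    then show "g = h" by (auto simp: bcfw_base_def split: if_splits)
  qed
  show "1 \<le> b \<and> b \<le> 4 \<and> h = b" if "h \<in> halves bcfw_base" "vert bcfw_base h = Boundary b" for h b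
    using that by (auto simp: bcfw_base_def Let_def split: if_splits)
  show "b \<in> halves bcfw_base \<and> vert bcfw_base b = Boundary b" if "1 \<le> b" "b \<le> 4" for b
    using that by (auto simp: bcfw_base_def)
  have two: "b = 2 \<or> b = 3" if "2 \<le> b" "b < 4" for b :: nat using that by auto
  show "\<exists>t. vert bcfw_base (opp bcfw_base b) = Internal t (blacks {2} b)" if "2 \<le> b" "b < 4" for b
    using two[OF that] by (auto simp: bcfw_base_def blacks_def)
  show "b = b'" if "2 \<le> b" "b < 4" "2 \<le> b'" "b' < 4"
    "vert bcfw_base (opp bcfw_base b) = vert bcfw_base (opp bcfw_base b')" for b b'
    using two[OF that(1,2)] two[OF that(3,4)] that(5) by (auto simp: bcfw_base_def)
  show "base_marks (if blacks {2} b = Black then cw bcfw_base (opp bcfw_base b)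
      else cw bcfw_base (cw bcfw_base (opp bcfw_base b))) = [b]" if "2 \<le> b" "b < 4" for b
    using two[OF that] by (auto simp: bcfw_base_def blacks_def base_marks_def)
  show "base_marks g = []" if "\<And>b. 2 \<le> b \<Longrightarrow> b < 4 \<Longrightarrow> g \<noteq> (if blacks {2} b = Black
      then cw bcfw_base (opp bcfw_base b) else cw bcfw_base (cw bcfw_base (opp bcfw_base b)))" for g
    using that[of 2] that[of 3] by (simp add: bcfw_base_def blacks_def base_marks_def)
qed (use base_tables halves_base_iff in blast)+

lemma run_stop': "opp G h = a \<Longrightarrow> run G mk h [] a"
  using run.stop by blast

lemma run_step': "turn G (opp G h) g \<Longrightarrow> run G mk g L a \<Longrightarrow> M = mk g @ L \<Longrightarrow> run G mk h M a"
  using run.step by blast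

lemma base_trip_data:
  "trip_data bcfw_base 4 (blacks {2}) (\<lambda>b. if b = 1 then [2] else if b = 4 then [3] else []) (up2 4)"
proof -
  let ?run = "run bcfw_base base_marks"
  have "?run 1 [2] 3"
    by (rule run_step'[of _ _ 9 _ "[2]"], simp add: turn_def bcfw_base_def,
      rule run_step'[of _ _ 10 _ "[]"], simp add: turn_def bcfw_base_def,
      rule run_step'[of _ _ 7 _ "[]"], simp add: turn_def bcfw_base_def,
      rule run_stop') (simp_all add: bcfw_base_def base_marks_def)
  moreover have "?run 2 [] 4"
    by (rule run_step'[of _ _ 14 _ "[]"], simp add: turn_def bcfw_base_def,
      rule run_step'[of _ _ 13 _ "[]"], simp add: turn_def bcfw_base_def,
      rule run_step'[of _ _ 8 _ "[]"], simp add: turn_def bcfw_base_def,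
      rule run_stop') (simp_all add: bcfw_base_def base_marks_def)
  moreover have "?run 3 [] 1"
    by (rule run_step'[of _ _ 11 _ "[]"], simp add: turn_def bcfw_base_def,
      rule run_step'[of _ _ 12 _ "[]"], simp add: turn_def bcfw_base_def,
      rule run_step'[of _ _ 5 _ "[]"], simp add: turn_def bcfw_base_def,
      rule run_stop') (simp_all add: bcfw_base_def base_marks_def)
  moreover have "?run 4 [3] 2"
    by (rule run_step'[of _ _ 16 _ "[3]"], simp add: turn_def bcfw_base_def,
      rule run_step'[of _ _ 15 _ "[]"], simp add: turn_def bcfw_base_def,
      rule run_step'[of _ _ 6 _ "[]"], simp add: turn_def bcfw_base_def,
      rule run_stop') (simp_all add: bcfw_base_def base_marks_def)
  ultimately have "1 \<le> up2 4 b \<and> up2 4 b \<le> 4 \<and>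
      ?run b (if b = 1 then [2] else if b = 4 then [3] else []) (up2 4 b)" if "1 \<le> b \<and> b \<le> 4" for b
  proof -
    have "b = 1 \<or> b = 2 \<or> b = 3 \<or> b = 4" using that by auto
    moreover have "up2 4 1 = 3" "up2 4 2 = 4" "up2 4 3 = 1" "up2 4 4 = 2" by (simp_all add: up2_def)
    ultimately show ?thesis using \<open>?run 1 [2] 3\<close> \<open>?run 2 [] 4\<close> \<open>?run 3 [] 1\<close> \<open>?run 4 [3] 2\<close>
      by (elim disjE) simp_all
  qed
  then show ?thesis unfolding trip_data_def using base_data by blast
qed

section \<open>Black and white blow-ups of a marked state\<close>

lemma state_step:
  fixes cl :: "nat \<Rightarrow> color"
  assumes S: "trip_state G n cl src \<pi> sw" and bu: "blow_up i c G H" and i: "i \<noteq> 1" "i \<noteq> n"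
    and st: "perm_step n i c \<pi> (src i) r \<pi>'" and cw: "c = White \<Longrightarrow> sw" and sw': "sw' \<Longrightarrow> sw"
    and hb: "\<And>j. c = White \<Longrightarrow> 2 \<le> j \<Longrightarrow> j < n \<Longrightarrow> cl j = Black \<Longrightarrow> src j = r \<Longrightarrow> j < i"
    and hw: "\<And>j. c = Black \<Longrightarrow> sw' \<Longrightarrow> 2 \<le> j \<Longrightarrow> j < n \<Longrightarrow> cl j = White \<Longrightarrow> src j = r \<Longrightarrow> j > i"
    and u: "u = (if c = Black then i else i + 1)" and w: "w = (if c = Black then i + 1 else i)"
  obtains src' where "trip_state H (n + 1)
      (\<lambda>b. if b < i then cl b else if b = i then Black else if b = i + 1 then White else cl (b - 1)) src' \<pi>' sw'"
    "src' u = shift i (src i)" "src' w = shift i r"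
    "\<And>j. 2 \<le> j \<Longrightarrow> j < i \<Longrightarrow> cl j = c \<or> src j \<noteq> src i \<Longrightarrow> src' j =
      (if src j = src i then (if c = Black then shift i (src i) else u) else if src j = i then w else shift i (src j))"
    "\<And>j. i < j \<Longrightarrow> j < n \<Longrightarrow> cl j = c \<or> src j \<noteq> src i \<Longrightarrow> src' (j + 1) =
      (if src j = src i then (if c = White then shift i (src i) else u) else if src j = i then w else shift i (src j))"
proof -
  have i2: "2 \<le> i" "i < n" using S trip_data_leaf[OF _ bu i] unfolding trip_state_def by blast+
  have p: "1 \<le> src i" "src i \<le> n" "src i \<noteq> i" "\<pi> (src i) \<noteq> i" and r: "1 \<le> r" "r \<le> n" "\<pi> r = i" "\<pi> i \<noteq> i"
    and \<pi>': "\<pi>' (shift i (src i)) = w" "\<pi>' (shift i r) = u" "\<pi>' u = shift i (\<pi> (src i))" "\<pi>' w = shift i (\<pi> i)"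
    and o: "\<And>b. 1 \<le> b \<Longrightarrow> b \<le> n \<Longrightarrow> (\<pi> b = i \<longrightarrow> b = r) \<and>
      (b \<noteq> i \<longrightarrow> b \<noteq> src i \<longrightarrow> b \<noteq> r \<longrightarrow> \<pi>' (shift i b) = shift i (\<pi> b))"
    using st by (auto simp only: perm_step_def perm_step_at_def Let_def u w)
  have uw: "(u, w) = (if c = Black then (i, i + 1) else (i + 1, i))" by (simp add: u w)
  obtain src' where s: "trip_state H (n + 1)
      (\<lambda>b. if b < i then cl b else if b = i then Black else if b = i + 1 then White else cl (b - 1)) src' \<pi>' sw'"
    "src' u = shift i (src i)" "src' w = shift i r"
    and F: "\<And>j. 2 \<le> j \<Longrightarrow> j < n \<Longrightarrow> j \<noteq> i \<Longrightarrow> cl j = c \<or> src j \<noteq> src i \<Longrightarrow> src' (shift i j) =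
      (if src j = src i then (if (if c = Black then j < i else j > i) then shift i (src i) else u)
       else if src j = i then w else shift i (src j))"
    using trip_state_blow_up[OF S bu i uw p r cw \<pi>' o hb hw sw'] by blast
  show ?thesis
  proof (rule that[OF s])
    fix j assume "2 \<le> j" "j < i" "cl j = c \<or> src j \<noteq> src i"
    then show "src' j = (if src j = src i then (if c = Black then shift i (src i) else u)
        else if src j = i then w else shift i (src j))"
      using F[of j] i2 by (simp add: shift_def)
  next
    fix j assume "i < j" "j < n" "cl j = c \<or> src j \<noteq> src i"
    moreover have "c = White \<longleftrightarrow> c \<noteq> Black" by (cases c) auto
    ultimately show "src' (j + 1) = (if src j = src i then (if c = White then shift i (src i) else u)
        else if src j = i then w else shift i (src j))"
      using F[of j] i2 by (simp add: shift_def)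
  qed
qed

lemma state_leaf:
  assumes S: "trip_state G n (blacks B) src \<pi> sw" and bu: "blow_up i c G H" and i: "i \<noteq> 1" "i \<noteq> n"
  shows "2 \<le> i \<and> i < n \<and> (c = Black \<longleftrightarrow> i \<in> B)"
proof -
  obtain Ls where T: "trip_data G n (blacks B) Ls \<pi>" using S unfolding trip_state_def by blast
  have "2 \<le> i \<and> i < n \<and> blacks B i = c" by (rule trip_data_leaf[OF T bu i])
  then show ?thesis by (auto simp: blacks_def split: if_splits)
qed

text \<open>The new sources after a black blow-up. Vertices on the cut trip are covered only if they
  are black, as their order decides the piece.\<close>

definition black_src where
  "black_src n i r B src src' \<longleftrightarrow> src' i = shift i (src i) \<and> src' (i + 1) = shift i r \<and>
    (\<forall>j. 2 \<le> j \<longrightarrow> j < i \<longrightarrow> j \<in> B \<or> src j \<noteq> src i \<longrightarrow>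
       src' j = (if src j = i then i + 1 else shift i (src j))) \<and>
    (\<forall>j. i < j \<longrightarrow> j < n \<longrightarrow> j \<in> B \<or> src j \<noteq> src i \<longrightarrow>
       src' (j + 1) = (if src j = src i then i else if src j = i then i + 1 else shift i (src j)))"

lemma black_srcD:
  assumes "black_src n i r B src src'"
  shows "src' i = shift i (src i)" "src' (i + 1) = shift i r"
    "2 \<le> j \<Longrightarrow> j < i \<Longrightarrow> j \<in> B \<or> src j \<noteq> src i \<Longrightarrow> src' j = (if src j = i then i + 1 else shift i (src j))"
    "i < j \<Longrightarrow> j < n \<Longrightarrow> j \<in> B \<or> src j \<noteq> src i \<Longrightarrow>
       src' (j + 1) = (if src j = src i then i else if src j = i then i + 1 else shift i (src j))"
  using assms unfolding black_src_def by blast+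

definition white_src where
  "white_src n i r B src src' \<longleftrightarrow> src' i = shift i r \<and> src' (i + 1) = shift i (src i) \<and>
    (\<forall>j. 2 \<le> j \<longrightarrow> j < i \<longrightarrow> j \<notin> B \<or> src j \<noteq> src i \<longrightarrow>
       src' j = (if src j = src i then i + 1 else if src j = i then i else shift i (src j))) \<and>
    (\<forall>j. i < j \<longrightarrow> j < n \<longrightarrow> j \<notin> B \<or> src j \<noteq> src i \<longrightarrow>
       src' (j + 1) = (if src j = i then i else shift i (src j)))"

lemma white_srcD:
  assumes "white_src n i r B src src'"
  shows "src' i = shift i r" "src' (i + 1) = shift i (src i)"
    "2 \<le> j \<Longrightarrow> j < i \<Longrightarrow> j \<notin> B \<or> src j \<noteq> src i \<Longrightarrow>
       src' j = (if src j = src i then i + 1 else if src j = i then i else shift i (src j))"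
    "i < j \<Longrightarrow> j < n \<Longrightarrow> j \<notin> B \<or> src j \<noteq> src i \<Longrightarrow> src' (j + 1) = (if src j = i then i else shift i (src j))"
  using assms unfolding white_src_def by blast+

lemma blacks_eq_iff: "blacks B j = Black \<longleftrightarrow> j \<in> B" "blacks B j = White \<longleftrightarrow> j \<notin> B"
  by (simp_all add: blacks_def)

lemma mem_shift_image: "b \<in> shift i ` B \<longleftrightarrow> (if b \<le> i then b \<in> B else i + 1 < b \<and> b - 1 \<in> B)"
proof
  assume "b \<in> shift i ` B"
  then obtain a where "a \<in> B" "b = shift i a" by blast
  then show "if b \<le> i then b \<in> B else i + 1 < b \<and> b - 1 \<in> B" by (cases "a \<le> i") (auto simp: shift_def)
next
  assume R: "if b \<le> i then b \<in> B else i + 1 < b \<and> b - 1 \<in> B"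
  show "b \<in> shift i ` B"
  proof (cases "b \<le> i")
    case True
    then have "b = shift i b" "b \<in> B" using R by (simp_all add: shift_def)
    then show ?thesis by (rule image_eqI)
  next
    case False
    then have "b = shift i (b - 1)" "b - 1 \<in> B" using R by (auto simp: shift_def)
    then show ?thesis by (rule image_eqI)
  qed
qed

text \<open>The new vertices are black at \<open>i\<close> and white at \<open>i + 1\<close>. As
  \<open>i\<close> was black before, the number of black places stays the same, whereas in
  \<open>state_white\<close> it grows by one.\<close>

lemma state_black:
  assumes S: "trip_state G n (blacks B) src \<pi> sw" and bu: "blow_up i Black G H" and i: "i \<noteq> 1" "i \<noteq> n"
    and st: "perm_step n i Black \<pi> (src i) r \<pi>'" and sw': "sw' \<Longrightarrow> sw"
    and hw: "\<And>j. sw' \<Longrightarrow> 2 \<le> j \<Longrightarrow> j < n \<Longrightarrow> j \<notin> B \<Longrightarrow> src j = r \<Longrightarrow> j > i"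
    and B': "B' = shift i ` B"
  obtains src' where "trip_state H (n + 1) (blacks B') src' \<pi>' sw'" "black_src n i r B src src'"
proof -
  have p: "src i \<noteq> i" using st by (simp add: perm_step_def Let_def)
  have iB: "i \<in> B" using state_leaf[OF S bu i] by simp
  have c: "(\<lambda>b. if b < i then blacks B b else if b = i then Black else if b = i + 1 then White else blacks B (b - 1))
      = blacks B'"
    using iB by (auto simp: fun_eq_iff blacks_def B' mem_shift_image)
  show ?thesis
  proof (rule state_step[OF S bu i st, of sw' i "i + 1"])
    fix src'
    assume s': "trip_state H (n + 1) (\<lambda>b. if b < i then blacks B b else if b = i then Black
        else if b = i + 1 then White else blacks B (b - 1)) src' \<pi>' sw'"
      "src' i = shift i (src i)" "src' (i + 1) = shift i r"
      "\<And>j. 2 \<le> j \<Longrightarrow> j < i \<Longrightarrow> blacks B j = Black \<or> src j \<noteq> src i \<Longrightarrow> src' j =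
        (if src j = src i then (if Black = Black then shift i (src i) else i) else if src j = i then i + 1 else shift i (src j))"
      "\<And>j. i < j \<Longrightarrow> j < n \<Longrightarrow> blacks B j = Black \<or> src j \<noteq> src i \<Longrightarrow> src' (j + 1) =
        (if src j = src i then (if Black = White then shift i (src i) else i) else if src j = i then i + 1 else shift i (src j))"
    show thesis
    proof (rule that)
      show "trip_state H (n + 1) (blacks B') src' \<pi>' sw'" using s'(1) unfolding c .
      show "black_src n i r B src src'"
        unfolding black_src_def
      proof (intro conjI allI impI s'(2,3))
        fix j assume "2 \<le> j" "j < i" "j \<in> B \<or> src j \<noteq> src i"
        then show "src' j = (if src j = i then i + 1 else shift i (src j))"
          using s'(4)[unfolded blacks_eq_iff, of j] p by (cases "src j = src i") simp_all
      next
        fix j assume "i < j" "j < n" "j \<in> B \<or> src j \<noteq> src i"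
        then show "src' (j + 1) = (if src j = src i then i else if src j = i then i + 1 else shift i (src j))"
          using s'(5)[unfolded blacks_eq_iff, of j] by simp
      qed
    qed
  qed (use sw' hw in \<open>simp_all add: blacks_eq_iff\<close>)
qed

lemma state_white:
  assumes S: "trip_state G n (blacks B) src \<pi> True" and bu: "blow_up i White G H" and i: "i \<noteq> 1" "i \<noteq> n"
    and st: "perm_step n i White \<pi> (src i) r \<pi>'"
    and hb: "\<And>j. 2 \<le> j \<Longrightarrow> j < n \<Longrightarrow> j \<in> B \<Longrightarrow> src j = r \<Longrightarrow> j < i"
    and B': "B' = insert i (shift i ` B)"
  obtains src' where "trip_state H (n + 1) (blacks B') src' \<pi>' sw'" "white_src n i r B src src'"
proof -
  have p: "src i \<noteq> i" using st by (simp add: perm_step_def Let_def)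
  have c: "(\<lambda>b. if b < i then blacks B b else if b = i then Black else if b = i + 1 then White else blacks B (b - 1))
      = blacks B'"
    by (auto simp: fun_eq_iff blacks_def B' mem_shift_image)
  show ?thesis
  proof (rule state_step[OF S bu i st, of sw' "i + 1" i])
    fix src'
    assume s': "trip_state H (n + 1) (\<lambda>b. if b < i then blacks B b else if b = i then Black
        else if b = i + 1 then White else blacks B (b - 1)) src' \<pi>' sw'"
      "src' (i + 1) = shift i (src i)" "src' i = shift i r"
      "\<And>j. 2 \<le> j \<Longrightarrow> j < i \<Longrightarrow> blacks B j = White \<or> src j \<noteq> src i \<Longrightarrow> src' j =
        (if src j = src i then (if White = Black then shift i (src i) else i + 1) else if src j = i then i else shift i (src j))"
      "\<And>j. i < j \<Longrightarrow> j < n \<Longrightarrow> blacks B j = White \<or> src j \<noteq> src i \<Longrightarrow> src' (j + 1) =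
        (if src j = src i then (if White = White then shift i (src i) else i + 1) else if src j = i then i else shift i (src j))"
    show thesis
    proof (rule that)
      show "trip_state H (n + 1) (blacks B') src' \<pi>' sw'" using s'(1) unfolding c .
      show "white_src n i r B src src'"
        unfolding white_src_def
      proof (intro conjI allI impI s'(2,3))
        fix j assume "2 \<le> j" "j < i" "j \<notin> B \<or> src j \<noteq> src i"
        then show "src' j = (if src j = src i then i + 1 else if src j = i then i else shift i (src j))"
          using s'(4)[unfolded blacks_eq_iff, of j] by simp
      next
        fix j assume "i < j" "j < n" "j \<notin> B \<or> src j \<noteq> src i"
        then show "src' (j + 1) = (if src j = i then i else shift i (src j))"
          using s'(5)[unfolded blacks_eq_iff, of j] p by (cases "src j = src i") simp_all
      qed
    qed
  qed (use hb in \<open>simp_all add: blacks_eq_iff\<close>)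
qed

section \<open>Graphs with zero, one and two chords\<close>

text \<open>Levels count chords. The black places are 2 and, for each chord, two places after its
  start. All sources are recorded while a white blow-up is still to come; at level 2 those of the
  black places are kept.\<close>

definition level_0 :: "nat \<Rightarrow> plabic \<Rightarrow> bool" where
  "level_0 n G \<longleftrightarrow> 4 \<le> n \<and> (\<exists>src. trip_state G n (blacks {2}) src (up2 n) True \<and> src 2 = 1 \<and>
     (\<forall>b. 3 \<le> b \<and> b < n \<longrightarrow> src b = n))"

definition level_1 :: "nat \<Rightarrow> nat \<Rightarrow> nat \<Rightarrow> plabic \<Rightarrow> bool" where
  "level_1 n i j G \<longleftrightarrow> 1 \<le> i \<and> i + 2 \<le> j \<and> j + 2 \<le> n \<and>
     (\<exists>src. trip_state G n (blacks {2, i + 2}) src (up2 n \<circ> perm_1 n i j) True \<and> src 2 = 1 \<and> src (i + 2) = i \<and>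
       (\<forall>b. 3 \<le> b \<and> b \<le> i + 1 \<longrightarrow> src b = j + 1) \<and> (\<forall>b. i + 3 \<le> b \<and> b < n \<longrightarrow> src b = n))"

definition level_2 :: "nat \<Rightarrow> (nat \<Rightarrow> nat) \<Rightarrow> nat \<Rightarrow> nat \<Rightarrow> nat \<Rightarrow> plabic \<Rightarrow> bool" where
  "level_2 n d i k s G \<longleftrightarrow>
     (\<exists>src. trip_state G n (blacks {2, i + 2, k + 2}) src (up2 n \<circ> d) False \<and> src 2 = 1 \<and> src (i + 2) = i \<and>
        src (k + 2) = s)"

definition level_S :: "nat \<Rightarrow> nat \<Rightarrow> nat \<Rightarrow> nat \<Rightarrow> nat \<Rightarrow> plabic \<Rightarrow> bool" where
  "level_S n i j k l G \<longleftrightarrow> 1 \<le> i \<and> i + 2 \<le> j \<and> j \<le> k \<and> k + 2 \<le> l \<and> l + 2 \<le> n \<and>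
     level_2 n (perm_S n i j k l) i k (if k = j + 1 then j else if k = j then i + 1 else k) G"

definition level_N :: "nat \<Rightarrow> nat \<Rightarrow> nat \<Rightarrow> nat \<Rightarrow> nat \<Rightarrow> plabic \<Rightarrow> bool" where
  "level_N n i j k l G \<longleftrightarrow> 1 \<le> i \<and> i + 1 \<le> k \<and> k + 2 \<le> l \<and> l \<le> j \<and> j + 2 \<le> n \<and>
     level_2 n (perm_N n i j k l) i k (if k = i + 1 then i else k) G"

lemma level_0_base: "level_0 4 bcfw_base"
proof -
  let ?L = "\<lambda>b::nat. if b = 1 then [2] else if b = 4 then [3] else []"
  have "marked 4 (blacks {2}) ?L (\<lambda>b. if b = 2 then 1 else 4) True"
    unfolding marked_def by (auto simp: blacks_def)
  then have "trip_state bcfw_base 4 (blacks {2}) (\<lambda>b. if b = 2 then 1 else 4) (up2 4) True"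
    using base_trip_data unfolding trip_state_def by blast
  then show ?thesis unfolding level_0_def by (intro conjI exI[of _ "\<lambda>b. if b = 2 then 1 else 4"]) auto
qed

lemma level_0_black:
  assumes L: "level_0 n G" and bu: "blow_up i Black G H" and i: "i \<noteq> 1" "i \<noteq> n"
  shows "level_0 (n + 1) H"
proof -
  obtain src where n: "4 \<le> n" and S: "trip_state G n (blacks {2}) src (up2 n) True" and s: "src 2 = 1"
    "\<And>b. 3 \<le> b \<Longrightarrow> b < n \<Longrightarrow> src b = n" using L unfolding level_0_def by blast
  have i2: "i = 2" using state_leaf[OF S bu i] by simp
  have st: "perm_step n i Black (up2 n) (src i) n (up2 (n + 1))" using perm_step_0_black[OF n] by (simp add: i2 s)
  have B': "{2} = shift i ` {2}" by (simp add: i2 shift_def)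
  obtain src' where S': "trip_state H (n + 1) (blacks {2}) src' (up2 (n + 1)) True"
    and bs: "black_src n i n {2} src src'"
    by (rule state_black[OF S bu i st _ _ B', of True]; (rule that; assumption)?) (auto simp: i2)
  note s' = black_srcD[OF bs, unfolded i2]
  have f1: "src' 2 = 1" using s'(1) s(1) by (simp add: shift_def)
  have f2: "src' b = n + 1" if "3 \<le> b" "b < n + 1" for b
  proof (cases "b = 3")
    case True
    then show ?thesis using s'(2) n by (simp add: shift_def)
  next
    case False
    then show ?thesis using s'(4)[of "b - 1"] s(1) s(2)[of "b - 1"] n that by (simp add: shift_def)
  qed
  have f3: "\<forall>b. 3 \<le> b \<and> b < n + 1 \<longrightarrow> src' b = n + 1" using f2 by blast
  show ?thesis unfolding level_0_def by (intro conjI exI[of _ src'] S' f1 f3) (use n in linarith)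
qed

lemma level_0_white:
  assumes L: "level_0 n G" and bu: "blow_up b White G H" and b: "b \<noteq> 1" "b \<noteq> n"
  shows "\<exists>i j. level_1 (n + 1) i j H"
proof -
  obtain src where n: "4 \<le> n" and S: "trip_state G n (blacks {2}) src (up2 n) True" and s: "src 2 = 1"
    "\<And>b. 3 \<le> b \<Longrightarrow> b < n \<Longrightarrow> src b = n" using L unfolding level_0_def by blast
  have b3: "3 \<le> b" "b < n" using state_leaf[OF S bu b] by auto
  define a where "a = b - 2"
  have a: "b = a + 2" "1 \<le> a" "a + 3 \<le> n" using b3 by (auto simp: a_def)
  have sb: "src b = n" using s(2) b3 by blast
  let ?\<pi> = "up2 (n + 1) \<circ> perm_1 (n + 1) a (a + 2)"
  have st: "perm_step n b White (up2 n) (src b) a ?\<pi>" unfolding sb unfolding a(1) by (rule perm_step_0_white[OF a(2,3)])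
  have B': "{2, a + 2} = insert b (shift b ` {2})" using a by (auto simp: shift_def)
  obtain src' where S': "trip_state H (n + 1) (blacks {2, a + 2}) src' ?\<pi> True"
    and ws: "white_src n b a {2} src src'"
    by (rule state_white[OF S bu b st _ B', of True]; (rule that; assumption)?) (use b3 in auto)
  note s' = white_srcD[OF ws, unfolded sb]
  have f1: "src' 2 = 1" using s'(3)[of 2] s(1) b3 by (simp add: shift_def)
  have f2: "src' (a + 2) = a" using s'(1) by (simp add: shift_def a)
  have f3: "src' x = a + 2 + 1" if "3 \<le> x" "x \<le> a + 1" for x
    using s'(3)[of x] s(2)[of x] that a by simp
  have f4: "src' x = n + 1" if "a + 3 \<le> x" "x < n + 1" for x
  proof (cases "x = b + 1")
    case True
    then show ?thesis using s'(2) b3 by (simp add: shift_def)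
  next
    case False
    then show ?thesis using s'(4)[of "x - 1"] s(2)[of "x - 1"] that a by (simp add: shift_def)
  qed
  have g3: "\<forall>x. 3 \<le> x \<and> x \<le> a + 1 \<longrightarrow> src' x = a + 2 + 1" using f3 by blast
  have g4: "\<forall>x. a + 3 \<le> x \<and> x < n + 1 \<longrightarrow> src' x = n + 1" using f4 by blast
  have "level_1 (n + 1) a (a + 2) H" unfolding level_1_def
    by (intro conjI exI[of _ src'] S' f1 f2 g3 g4) (use a in linarith)+
  then show ?thesis by blast
qed

lemma level_1_black:
  assumes L: "level_1 n i j G" and bu: "blow_up b Black G H" and b: "b \<noteq> 1" "b \<noteq> n"
  shows "\<exists>i j. level_1 (n + 1) i j H"
proof -
  obtain src where ij: "1 \<le> i" "i + 2 \<le> j" "j + 2 \<le> n"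
    and S: "trip_state G n (blacks {2, i + 2}) src (up2 n \<circ> perm_1 n i j) True"
    and s: "src 2 = 1" "src (i + 2) = i" "\<And>b. 3 \<le> b \<Longrightarrow> b \<le> i + 1 \<Longrightarrow> src b = j + 1"
      "\<And>b. i + 3 \<le> b \<Longrightarrow> b < n \<Longrightarrow> src b = n" using L unfolding level_1_def by blast
  consider (2) "b = 2" | (i) "b = i + 2" using state_leaf[OF S bu b] by auto
  then show ?thesis
  proof cases
    case 2
    have sb: "src b = 1" using s 2 by simp
    let ?\<pi> = "up2 (n + 1) \<circ> perm_1 (n + 1) (i + 1) (j + 1)"
    have st: "perm_step n b Black (up2 n \<circ> perm_1 n i j) (src b) (j + 1) ?\<pi>"
      unfolding sb unfolding 2 by (rule perm_step_1_black2[OF ij])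
    have hw: "x > b" if "2 \<le> x" "x \<notin> {2, i + 2}" for x using that 2 by auto
    have B': "{2, i + 1 + 2} = shift b ` {2, i + 2}" using ij 2 by (auto simp: shift_def)
    obtain src' where S': "trip_state H (n + 1) (blacks {2, i + 1 + 2}) src' ?\<pi> True"
      and bs: "black_src n b (j + 1) {2, i + 2} src src'"
      by (rule state_black[OF S bu b st _ _ B', of True]; (rule that; assumption)?) (use hw in \<open>blast+\<close>)
    note s' = black_srcD[OF bs, unfolded sb, unfolded 2]
    have f1: "src' 2 = 1" using s'(1) by (simp add: shift_def)
    have q: "src' (i + 2 + 1) = (if src (i + 2) = 1 then 2 else if src (i + 2) = 2 then 2 + 1 else shift 2 (src (i + 2)))"
      by (rule s'(4)) (use ij in auto)
    have e: "i + 1 + 2 = i + 2 + 1" by simp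
    have f2: "src' (i + 1 + 2) = i + 1" unfolding e q s(2) using ij by (auto simp: shift_def)
    have f3: "src' x = j + 1 + 1" if "3 \<le> x" "x \<le> i + 1 + 1" for x
    proof (cases "x = 3")
      case True
      then show ?thesis using s'(2) ij by (simp add: shift_def)
    next
      case False
      then show ?thesis using s'(4)[of "x - 1"] s(3)[of "x - 1"] that ij by (simp add: shift_def)
    qed
    have f4: "src' x = n + 1" if "i + 1 + 3 \<le> x" "x < n + 1" for x
      using s'(4)[of "x - 1"] s(4)[of "x - 1"] that ij by (simp add: shift_def)
    have g3: "\<forall>x. 3 \<le> x \<and> x \<le> i + 1 + 1 \<longrightarrow> src' x = j + 1 + 1" using f3 by blast
    have g4: "\<forall>x. i + 1 + 3 \<le> x \<and> x < n + 1 \<longrightarrow> src' x = n + 1" using f4 by blast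
    have "level_1 (n + 1) (i + 1) (j + 1) H" unfolding level_1_def
      by (intro conjI exI[of _ src'] S' f1 f2 g3 g4) (use ij in linarith)+
    then show ?thesis by blast
  next
    case i
    have sb: "src b = i" using s i by simp
    let ?\<pi> = "up2 (n + 1) \<circ> perm_1 (n + 1) i (j + 1)"
    have st: "perm_step n b Black (up2 n \<circ> perm_1 n i j) (src b) n ?\<pi>"
      unfolding sb unfolding i by (rule perm_step_1_black_i[OF ij])
    \<comment> \<open>White places left of \<open>i + 2\<close> lie on the trip from
      \<open>j + 1\<close>, not on the one from \<open>n\<close>.\<close>
    have hw: "x > b" if "2 \<le> x" "x \<notin> {2, i + 2}" "src x = n" for x
      using that s(3)[of x] ij i by (cases "x \<le> i + 1") auto
    have B': "{2, i + 2} = shift b ` {2, i + 2}" using ij i by (auto simp: shift_def)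
    obtain src' where S': "trip_state H (n + 1) (blacks {2, i + 2}) src' ?\<pi> True"
      and bs: "black_src n b n {2, i + 2} src src'"
      by (rule state_black[OF S bu b st _ _ B', of True]; (rule that; assumption)?) (use hw in \<open>blast+\<close>)
    note s' = black_srcD[OF bs, unfolded sb, unfolded i]
    have f1: "src' 2 = 1" using s'(3)[of 2] s(1) ij by (simp add: shift_def)
    have f2: "src' (i + 2) = i" using s'(1) by (simp add: shift_def)
    have f3: "src' x = j + 1 + 1" if "3 \<le> x" "x \<le> i + 1" for x
      using s'(3)[of x] s(3)[of x] that ij by (simp add: shift_def)
    have f4: "src' x = n + 1" if "i + 3 \<le> x" "x < n + 1" for x
    proof (cases "x = i + 2 + 1")
      case True
      then show ?thesis using s'(2) ij by (simp add: shift_def)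
    next
      case False
      then show ?thesis using s'(4)[of "x - 1"] s(4)[of "x - 1"] that ij by (simp add: shift_def)
    qed
    have g3: "\<forall>x. 3 \<le> x \<and> x \<le> i + 1 \<longrightarrow> src' x = j + 1 + 1" using f3 by blast
    have g4: "\<forall>x. i + 3 \<le> x \<and> x < n + 1 \<longrightarrow> src' x = n + 1" using f4 by blast
    have "level_1 (n + 1) i (j + 1) H" unfolding level_1_def
      by (intro conjI exI[of _ src'] S' f1 f2 g3 g4) (use ij in linarith)+
    then show ?thesis by blast
  qed
qed

text \<open>\<open>a = i\<close> is impossible because \<open>i + 2\<close> is black; so the new
  chord lies to the left of, inside or to the right of the old one.\<close>

lemma level_1_white:
  assumes L: "level_1 n i j G" and bu: "blow_up b White G H" and b: "b \<noteq> 1" "b \<noteq> n"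
  shows "(\<exists>i j k l. level_S (n + 1) i j k l H) \<or> (\<exists>i j k l. level_N (n + 1) i j k l H)"
proof -
  obtain src where ij: "1 \<le> i" "i + 2 \<le> j" "j + 2 \<le> n"
    and S: "trip_state G n (blacks {2, i + 2}) src (up2 n \<circ> perm_1 n i j) True"
    and s: "src 2 = 1" "src (i + 2) = i" "\<And>b. 3 \<le> b \<Longrightarrow> b \<le> i + 1 \<Longrightarrow> src b = j + 1"
      "\<And>b. i + 3 \<le> b \<Longrightarrow> b < n \<Longrightarrow> src b = n" using L unfolding level_1_def by blast
  have b3: "3 \<le> b" "b < n" "b \<noteq> i + 2" using state_leaf[OF S bu b] by auto
  define a where "a = b - 2"
  have a: "b = a + 2" "1 \<le> a" "a + 3 \<le> n" "a \<noteq> i" using b3 by (auto simp: a_def)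
  consider (low) "a + 1 \<le> i" | (mid) "i + 1 \<le> a" "a + 1 \<le> j" | (high) "j \<le> a" using a by linarith
  then show ?thesis
  proof cases
    case low
    have sb: "src b = j + 1" using s(3)[of b] b3 low by (simp add: a)
    let ?\<pi> = "up2 (n + 1) \<circ> perm_S (n + 1) a (a + 2) (i + 1) (j + 1)"
    have st: "perm_step n b White (up2 n \<circ> perm_1 n i j) (src b) a ?\<pi>"
      unfolding sb unfolding a(1) by (rule perm_step_1_white_low[OF ij a(2) low])
    \<comment> \<open>The black place \<open>i + 2\<close> is right of \<open>b\<close>, but its
      source is \<open>i\<close>, which differs from \<open>a\<close>.\<close>
    have hb: "x < b" if "x \<in> {2, i + 2}" "src x = a" for x using that s(1,2) b3 low by auto
    have B': "{2, a + 2, i + 1 + 2} = insert b (shift b ` {2, i + 2})" using a low by (auto simp: shift_def)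
    obtain src' where S': "trip_state H (n + 1) (blacks {2, a + 2, i + 1 + 2}) src' ?\<pi> False"
      and ws: "white_src n b a {2, i + 2} src src'"
      by (rule state_white[OF S bu b st _ B', of False]; (rule that; assumption)?) (use hb in blast)
    note s' = white_srcD[OF ws, unfolded sb]
    have f1: "src' 2 = 1" using s'(3)[of 2] s(1) b3 ij by (simp add: shift_def)
    have f2: "src' (a + 2) = a" using s'(1) by (simp add: shift_def a)
    have q: "src' (i + 2 + 1) = (if src (i + 2) = b then b else shift b (src (i + 2)))"
      by (rule s'(4)) (use a low ij s(2) in auto)
    have e: "i + 1 + 2 = i + 2 + 1" by simp
    have f3: "src' (i + 1 + 2) = (if i + 1 = a + 2 + 1 then a + 2 else if i + 1 = a + 2 then a + 1 else i + 1)"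
      unfolding e q s(2) using a low by (auto simp: shift_def)
    have "level_S (n + 1) a (a + 2) (i + 1) (j + 1) H" unfolding level_S_def level_2_def
      by (intro conjI exI[of _ src'] S' f1 f2 f3) (use ij a low in linarith)+
    then show ?thesis by blast
  next
    case mid
    have sb: "src b = n" using s(4)[of b] b3 mid by (simp add: a)
    let ?r = "if a = i + 1 then i else a"
    let ?\<pi> = "up2 (n + 1) \<circ> perm_N (n + 1) i (j + 1) a (a + 2)"
    have st: "perm_step n b White (up2 n \<circ> perm_1 n i j) (src b) ?r ?\<pi>"
      unfolding sb unfolding a(1) by (rule perm_step_1_white_mid[OF ij mid])
    have hb: "x < b" if "x \<in> {2, i + 2}" for x using that a mid by auto
    have B': "{2, i + 2, a + 2} = insert b (shift b ` {2, i + 2})" using a mid by (auto simp: shift_def)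
    obtain src' where S': "trip_state H (n + 1) (blacks {2, i + 2, a + 2}) src' ?\<pi> False"
      and ws: "white_src n b ?r {2, i + 2} src src'"
      by (rule state_white[OF S bu b st _ B', of False]; (rule that; assumption)?) (use hb in blast)
    note s' = white_srcD[OF ws, unfolded sb]
    have f1: "src' 2 = 1" using s'(3)[of 2] s(1) b3 ij by (simp add: shift_def)
    have f2: "src' (i + 2) = i" using s'(3)[of "i + 2"] s(2) mid a ij by (simp add: shift_def)
    have f3: "src' (a + 2) = ?r" using s'(1) mid by (simp add: shift_def a)
    have "level_N (n + 1) i (j + 1) a (a + 2) H" unfolding level_N_def level_2_def
      by (intro conjI exI[of _ src'] S' f1 f2 f3) (use ij a mid in linarith)+
    then show ?thesis by blast
  next
    case high
    have sb: "src b = n" using s(4)[of b] b3 high ij by (simp add: a)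
    let ?r = "if a = j then i + 1 else if a = j + 1 then j else a"
    let ?\<pi> = "up2 (n + 1) \<circ> perm_S (n + 1) i j a (a + 2)"
    have st: "perm_step n b White (up2 n \<circ> perm_1 n i j) (src b) ?r ?\<pi>"
      unfolding sb unfolding a(1) by (rule perm_step_1_white_high[OF ij high a(3)])
    have hb: "x < b" if "x \<in> {2, i + 2}" for x using that a high ij by auto
    have B': "{2, i + 2, a + 2} = insert b (shift b ` {2, i + 2})" using a high ij by (auto simp: shift_def)
    obtain src' where S': "trip_state H (n + 1) (blacks {2, i + 2, a + 2}) src' ?\<pi> False"
      and ws: "white_src n b ?r {2, i + 2} src src'"
      by (rule state_white[OF S bu b st _ B', of False]; (rule that; assumption)?) (use hb in blast)
    note s' = white_srcD[OF ws, unfolded sb]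
    have f1: "src' 2 = 1" using s'(3)[of 2] s(1) b3 ij by (simp add: shift_def)
    have f2: "src' (i + 2) = i" using s'(3)[of "i + 2"] s(2) high a ij by (simp add: shift_def)
    have "?r \<le> b" using high ij by (auto simp: a)
    then have f3: "src' (a + 2) = (if a = j + 1 then j else if a = j then i + 1 else a)" using s'(1) by (simp add: shift_def a)
    have "level_S (n + 1) i j a (a + 2) H" unfolding level_S_def level_2_def
      by (intro conjI exI[of _ src'] S' f1 f2 f3) (use ij a high in linarith)+
    then show ?thesis by blast
  qed
qed

lemma level_2_leaf:
  assumes L: "level_2 n d i k s G" and bu: "blow_up b Black G H" and b: "b \<noteq> 1" "b \<noteq> n"
  shows "b = 2 \<or> b = i + 2 \<or> b = k + 2"
proof -
  obtain src where S: "trip_state G n (blacks {2, i + 2, k + 2}) src (up2 n \<circ> d) False"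
    using L unfolding level_2_def by blast
  show ?thesis using state_leaf[OF S bu b] by simp
qed

lemma level_2_black_first:
  assumes L: "level_2 n d i k s G" and bu: "blow_up 2 Black G H" and n: "2 \<noteq> n"
    and st: "perm_step n 2 Black (up2 n \<circ> d) 1 r (up2 (n + 1) \<circ> d')"
    and ik: "1 \<le> i" "i < k" "k + 2 < n" "1 \<le> s"
  shows "level_2 (n + 1) d' (i + 1) (k + 1) (s + 1) H"
proof -
  obtain src where S: "trip_state G n (blacks {2, i + 2, k + 2}) src (up2 n \<circ> d) False"
    and s: "src 2 = 1" "src (i + 2) = i" "src (k + 2) = s" using L unfolding level_2_def by blast
  have i: "2 \<noteq> (1::nat)" by simp
  have st': "perm_step n 2 Black (up2 n \<circ> d) (src 2) r (up2 (n + 1) \<circ> d')" using st by (simp only: s(1))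
  have B': "{2, i + 1 + 2, k + 1 + 2} = shift 2 ` {2, i + 2, k + 2}" using ik by (auto simp: shift_def)
  obtain src' where S': "trip_state H (n + 1) (blacks {2, i + 1 + 2, k + 1 + 2}) src' (up2 (n + 1) \<circ> d') False"
    and bs: "black_src n 2 r {2, i + 2, k + 2} src src'"
    by (rule state_black[OF S bu i n st' _ _ B', of False]; (rule that; assumption)?) simp_all
  note s' = black_srcD[OF bs, unfolded s(1)]
  have f1: "src' 2 = 1" using s'(1) by (simp add: shift_def)
  have q: "src' (j + 2 + 1) = (if src (j + 2) = 1 then 2 else if src (j + 2) = 2 then 2 + 1 else shift 2 (src (j + 2)))"
    if "j = i \<or> j = k" for j
    by (rule s'(4)) (use ik that in auto)
  have e: "j + 1 + 2 = j + 2 + 1" for j :: nat by simp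
  have f2: "src' (i + 1 + 2) = i + 1"
    unfolding e q[OF disjI1[OF refl]] s(2) using ik by (auto simp: shift_def)
  have f3: "src' (k + 1 + 2) = s + 1"
    unfolding e q[OF disjI2[OF refl]] s(3) using ik by (auto simp: shift_def)
  show ?thesis unfolding level_2_def by (intro exI[of _ src'] conjI S' f1 f2 f3)
qed

text \<open>The case \<open>s = i\<close> occurs for nested chords with \<open>k = i + 1\<close>:
  both black places are on the cut trip, and the one further right ends up on the piece that starts
  at \<open>i + 2\<close>.\<close>

lemma level_2_black_second:
  assumes L: "level_2 n d i k s G" and bu: "blow_up (i + 2) Black G H" and n: "i + 2 \<noteq> n"
    and st: "perm_step n (i + 2) Black (up2 n \<circ> d) i r (up2 (n + 1) \<circ> d')"
    and ik: "1 \<le> i" "i < k" "k + 2 < n"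
    and s'': "s' = (if s = i then i + 2 else if s = i + 2 then i + 2 + 1 else shift (i + 2) s)"
  shows "level_2 (n + 1) d' i (k + 1) s' H"
proof -
  obtain src where S: "trip_state G n (blacks {2, i + 2, k + 2}) src (up2 n \<circ> d) False"
    and s: "src 2 = 1" "src (i + 2) = i" "src (k + 2) = s" using L unfolding level_2_def by blast
  have i: "i + 2 \<noteq> 1" by simp
  have st': "perm_step n (i + 2) Black (up2 n \<circ> d) (src (i + 2)) r (up2 (n + 1) \<circ> d')" using st by (simp only: s(2))
  have B': "{2, i + 2, k + 1 + 2} = shift (i + 2) ` {2, i + 2, k + 2}" using ik by (auto simp: shift_def)
  obtain src' where S': "trip_state H (n + 1) (blacks {2, i + 2, k + 1 + 2}) src' (up2 (n + 1) \<circ> d') False"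
    and bs: "black_src n (i + 2) r {2, i + 2, k + 2} src src'"
    by (rule state_black[OF S bu i n st' _ _ B', of False]; (rule that; assumption)?) simp_all
  note s' = black_srcD[OF bs, unfolded s(2)]
  have f1: "src' 2 = 1" using s'(3)[of 2] s(1) ik by (simp add: shift_def)
  have f2: "src' (i + 2) = i" using s'(1) by (simp add: shift_def)
  have q: "src' (k + 2 + 1) =
      (if src (k + 2) = i then i + 2 else if src (k + 2) = i + 2 then i + 2 + 1 else shift (i + 2) (src (k + 2)))"
    by (rule s'(4)) (use ik in auto)
  have e: "k + 1 + 2 = k + 2 + 1" by simp
  have f3: "src' (k + 1 + 2) = s'" unfolding e q s(3) s'' by (rule refl)
  show ?thesis unfolding level_2_def by (intro exI[of _ src'] conjI S' f1 f2 f3)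
qed

lemma level_2_black_third:
  assumes L: "level_2 n d i k s G" and bu: "blow_up (k + 2) Black G H" and n: "k + 2 \<noteq> n"
    and st: "perm_step n (k + 2) Black (up2 n \<circ> d) s r (up2 (n + 1) \<circ> d')"
    and ik: "1 \<le> i" "i < k" "s \<le> k"
  shows "level_2 (n + 1) d' i k s H"
proof -
  obtain src where S: "trip_state G n (blacks {2, i + 2, k + 2}) src (up2 n \<circ> d) False"
    and s: "src 2 = 1" "src (i + 2) = i" "src (k + 2) = s" using L unfolding level_2_def by blast
  have i: "k + 2 \<noteq> 1" by simp
  have st': "perm_step n (k + 2) Black (up2 n \<circ> d) (src (k + 2)) r (up2 (n + 1) \<circ> d')" using st by (simp only: s(3))
  have B': "{2, i + 2, k + 2} = shift (k + 2) ` {2, i + 2, k + 2}" using ik by (auto simp: shift_def)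
  obtain src' where S': "trip_state H (n + 1) (blacks {2, i + 2, k + 2}) src' (up2 (n + 1) \<circ> d') False"
    and bs: "black_src n (k + 2) r {2, i + 2, k + 2} src src'"
    by (rule state_black[OF S bu i n st' _ _ B', of False]; (rule that; assumption)?) simp_all
  note s' = black_srcD[OF bs, unfolded s(3)]
  have f1: "src' 2 = 1" using s'(3)[of 2] s(1) ik by (simp add: shift_def)
  have f2: "src' (i + 2) = i" using s'(3)[of "i + 2"] s(2) ik by (simp add: shift_def)
  have f3: "src' (k + 2) = s" using s'(1) ik by (simp add: shift_def)
  show ?thesis unfolding level_2_def by (intro exI[of _ src'] conjI S' f1 f2 f3)
qed

lemma level_S_black:
  assumes L: "level_S n i j k l G" and bu: "blow_up b Black G H" and b: "b \<noteq> 1" "b \<noteq> n"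
  shows "\<exists>i j k l. level_S (n + 1) i j k l H"
proof -
  let ?s = "if k = j + 1 then j else if k = j then i + 1 else k"
  have ij: "1 \<le> i" "i + 2 \<le> j" "j \<le> k" "k + 2 \<le> l" "l + 2 \<le> n"
    and L2: "level_2 n (perm_S n i j k l) i k ?s G" using L unfolding level_S_def by blast+
  consider (2) "b = 2" | (i) "b = i + 2" | (k) "b = k + 2" using level_2_leaf[OF L2 bu b] by blast
  then show ?thesis
  proof cases
    case 2
    have L': "level_2 (n + 1) (perm_S (n + 1) (i + 1) (j + 1) (k + 1) (l + 1)) (i + 1) (k + 1) (?s + 1) H"
      by (rule level_2_black_first[OF L2 bu[unfolded 2] b(2)[unfolded 2] perm_step_S_black2[OF ij]]) (use ij in auto)
    have e: "?s + 1 = (if k + 1 = j + 1 + 1 then j + 1 else if k + 1 = j + 1 then i + 1 + 1 else k + 1)" by simp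
    have "level_S (n + 1) (i + 1) (j + 1) (k + 1) (l + 1) H"
      unfolding level_S_def by (intro conjI L'[unfolded e]) (use ij in auto)
    then show ?thesis by blast
  next
    case i
    have L': "level_2 (n + 1) (perm_S (n + 1) i (j + 1) (k + 1) (l + 1)) i (k + 1)
        (if k + 1 = j + 1 + 1 then j + 1 else if k + 1 = j + 1 then i + 1 else k + 1) H"
      by (rule level_2_black_second[OF L2 bu[unfolded i] b(2)[unfolded i] perm_step_S_black_i[OF ij]])
        (use ij in \<open>auto simp: shift_def\<close>)
    have "level_S (n + 1) i (j + 1) (k + 1) (l + 1) H"
      unfolding level_S_def by (intro conjI L') (use ij in auto)
    then show ?thesis by blast
  next
    case k
    have L': "level_2 (n + 1) (perm_S (n + 1) i j k (l + 1)) i k ?s H"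
      by (rule level_2_black_third[OF L2 bu[unfolded k] b(2)[unfolded k] perm_step_S_black_k[OF ij]]) (use ij in auto)
    have "level_S (n + 1) i j k (l + 1) H"
      unfolding level_S_def by (intro conjI L') (use ij in auto)
    then show ?thesis by blast
  qed
qed

lemma level_N_black:
  assumes L: "level_N n i j k l G" and bu: "blow_up b Black G H" and b: "b \<noteq> 1" "b \<noteq> n"
  shows "\<exists>i j k l. level_N (n + 1) i j k l H"
proof -
  let ?s = "if k = i + 1 then i else k"
  have ij: "1 \<le> i" "i + 1 \<le> k" "k + 2 \<le> l" "l \<le> j" "j + 2 \<le> n"
    and L2: "level_2 n (perm_N n i j k l) i k ?s G" using L unfolding level_N_def by blast+
  consider (2) "b = 2" | (i) "b = i + 2" | (k) "b = k + 2" using level_2_leaf[OF L2 bu b] by blast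
  then show ?thesis
  proof cases
    case 2
    have L': "level_2 (n + 1) (perm_N (n + 1) (i + 1) (j + 1) (k + 1) (l + 1)) (i + 1) (k + 1) (?s + 1) H"
      by (rule level_2_black_first[OF L2 bu[unfolded 2] b(2)[unfolded 2] perm_step_N_black2[OF ij]]) (use ij in auto)
    have e: "?s + 1 = (if k + 1 = i + 1 + 1 then i + 1 else k + 1)" by simp
    have "level_N (n + 1) (i + 1) (j + 1) (k + 1) (l + 1) H"
      unfolding level_N_def by (intro conjI L'[unfolded e]) (use ij in auto)
    then show ?thesis by blast
  next
    case i
    have L': "level_2 (n + 1) (perm_N (n + 1) i (j + 1) (k + 1) (l + 1)) i (k + 1) (if k + 1 = i + 1 then i else k + 1) H"
      by (rule level_2_black_second[OF L2 bu[unfolded i] b(2)[unfolded i] perm_step_N_black_i[OF ij]])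
        (use ij in \<open>auto simp: shift_def\<close>)
    have "level_N (n + 1) i (j + 1) (k + 1) (l + 1) H"
      unfolding level_N_def by (intro conjI L') (use ij in auto)
    then show ?thesis by blast
  next
    case k
    have L': "level_2 (n + 1) (perm_N (n + 1) i (j + 1) k (l + 1)) i k ?s H"
      by (rule level_2_black_third[OF L2 bu[unfolded k] b(2)[unfolded k] perm_step_N_black_k[OF ij]]) (use ij in auto)
    have "level_N (n + 1) i (j + 1) k (l + 1) H"
      unfolding level_N_def by (intro conjI L') (use ij in auto)
    then show ?thesis by blast
  qed
qed

text \<open>The index of the graph exceeds the number of chords by two. Blowing up never lowers the
  index, so graphs of index 4 arise from graphs of index 3 and 4 only.\<close>

lemma bcfw_graph_level:
  assumes "bcfw_graph n k G"
  shows "2 \<le> k \<and> (k = 2 \<longrightarrow> level_0 n G) \<and> (k = 3 \<longrightarrow> (\<exists>i j. level_1 n i j G)) \<and>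
    (k = 4 \<longrightarrow> (\<exists>i j k l. level_S n i j k l G) \<or> (\<exists>i j k l. level_N n i j k l G))"
  using assms
proof (induction rule: bcfw_graph.induct)
  case base
  show ?case using level_0_base by simp
next
  case (black n k G i H)
  note bu = black.hyps(4,2,3)
  show ?case using black.IH level_0_black[OF _ bu] level_1_black[OF _ bu] level_S_black[OF _ bu] level_N_black[OF _ bu]
    by blast
next
  case (white n k G i H)
  note bu = white.hyps(4,2,3)
  show ?case
  proof (intro conjI impI)
    show "2 \<le> k + 1" using white.IH by simp
    show "level_0 (n + 1) H" if "k + 1 = 2" using that white.IH by simp
    show "\<exists>i j. level_1 (n + 1) i j H" if "k + 1 = 3"
    proof -
      have "k = 2" using that by simp
      then have "level_0 n G" using white.IH by blast
      then show ?thesis by (rule level_0_white[OF _ bu])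
    qed
    show "(\<exists>i j k l. level_S (n + 1) i j k l H) \<or> (\<exists>i j k l. level_N (n + 1) i j k l H)" if "k + 1 = 4"
    proof -
      have "k = 3" using that by simp
      then obtain i j where "level_1 n i j G" using white.IH by blast
      then show ?thesis by (rule level_1_white[OF _ bu])
    qed
  qed
qed

lemma trip_state_trip_perm:
  assumes "trip_state G n cl src \<pi> sw"
  shows "trip_perm G b = (if 1 \<le> b \<and> b \<le> n then \<pi> b else b)"
proof -
  obtain Ls where T: "trip_data G n cl Ls \<pi>" using assms unfolding trip_state_def by blast
  then have num: "num_boundary G = n" unfolding trip_data_def by (blast dest: plabic_data.num)
  show ?thesis
  proof (cases "1 \<le> b \<and> b \<le> n")
    case True
    then have "trip_perm G b = \<pi> b" by (intro trip_data_trip_perm[OF T]) auto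
    then show ?thesis using True by simp
  next
    case False
    then show ?thesis using num by (auto simp: trip_perm_def)
  qed
qed

lemma bcfw_graph_perm:
  assumes "bcfw_graph n 4 G"
  shows "(\<exists>i j k l. 1 \<le> i \<and> i + 2 \<le> j \<and> j \<le> k \<and> k + 2 \<le> l \<and> l + 2 \<le> n \<and>
      (\<forall>b. trip_perm G b = (if 1 \<le> b \<and> b \<le> n then up2 n (perm_S n i j k l b) else b))) \<or>
    (\<exists>i j k l. 1 \<le> i \<and> i + 1 \<le> k \<and> k + 2 \<le> l \<and> l \<le> j \<and> j + 2 \<le> n \<and>
      (\<forall>b. trip_perm G b = (if 1 \<le> b \<and> b \<le> n then up2 n (perm_N n i j k l b) else b)))"
proof -
  have t: "trip_perm G b = (if 1 \<le> b \<and> b \<le> n then up2 n (d b) else b)" if "level_2 n d i k s G" for d i k s b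
    using that trip_state_trip_perm[of G n _ _ "up2 n \<circ> d"] unfolding level_2_def comp_def by blast
  have "(\<exists>i j k l. level_S n i j k l G) \<or> (\<exists>i j k l. level_N n i j k l G)" using bcfw_graph_level[OF assms] by simp
  then show ?thesis
  proof (elim disjE exE)
    fix i j k l assume "level_S n i j k l G"
    then show ?thesis unfolding level_S_def using t by blast
  next
    fix i j k l assume "level_N n i j k l G"
    then show ?thesis unfolding level_N_def using t by blast
  qed
qed

section \<open>From BCFW cells to normal forms, and the conclusion\<close>

lemma long_cycle_up2:
  assumes "4 \<le> n" "1 \<le> y" "y \<le> n"
  shows "long_cycle n (long_cycle n (up2 n y)) = y"
proof -
  consider "y + 2 \<le> n" | "y = n - 1" | "y = n" using assms by linarith
  then show ?thesis
  proof cases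
    case 1
    then show ?thesis using assms by (simp add: up2_def long_cycle_def)
  next
    case 2
    then have "up2 n y = 1" using assms by (simp add: up2_def)
    then show ?thesis using assms 2 by (simp add: long_cycle_def)
  next
    case 3
    then have "up2 n y = 2" using assms by (simp add: up2_def)
    then show ?thesis using assms 3 by (simp add: long_cycle_def)
  qed
qed

lemma long_cycle_outside: "\<not> (1 \<le> b \<and> b \<le> n) \<Longrightarrow> 1 \<le> n \<Longrightarrow> long_cycle n b = b"
  by (auto simp: long_cycle_def)

lemma long_cycle_perm:
  assumes n: "4 \<le> n" and t: "\<And>b. t b = (if 1 \<le> b \<and> b \<le> n then up2 n (d b) else b)"
    and d: "\<And>b. 1 \<le> b \<Longrightarrow> b \<le> n \<Longrightarrow> 1 \<le> d b \<and> d b \<le> n" "\<And>b. \<not> (1 \<le> b \<and> b \<le> n) \<Longrightarrow> d b = b"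
  shows "long_cycle n \<circ> long_cycle n \<circ> t = d"
proof
  fix b
  show "(long_cycle n \<circ> long_cycle n \<circ> t) b = d b"
  proof (cases "1 \<le> b \<and> b \<le> n")
    case True
    then show ?thesis using t[of b] d(1)[of b] long_cycle_up2[OF n, of "d b"] by simp
  next
    case False
    moreover have "1 \<le> n" using n by simp
    ultimately have "long_cycle n b = b" by (rule long_cycle_outside)
    moreover have "t b = b" using t[of b] False by (simp only: if_False)
    ultimately show ?thesis using d(2)[OF False] by simp
  qed
qed

lemma cell_is_form:
  assumes S: "S \<in> bcfw_cells n 2" and V: "V \<in> S" and n: "n = Suc N" "4 \<le> n"
  shows "is_form N V"
proof -
  obtain G where G: "bcfw_graph n 4 G" and VG: "V \<in> positroid_cell 2 n (long_cycle n \<circ> long_cycle n \<circ> trip_perm G, {})"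
    using S V by (auto simp: bcfw_cells_def bcfw_perms_def)
  define d where "d = long_cycle n \<circ> long_cycle n \<circ> trip_perm G"
  obtain x y where data: "sequence_data n d V x y"
    using positroid_cell_sequence[OF VG] unfolding d_def by blast
  then have loc: "sequences n d V x y" by (rule sequences.intro)
  from bcfw_graph_perm[OF G] show ?thesis
  proof (elim disjE exE conjE)
    fix i j k l
    assume c: "1 \<le> i" "i + 2 \<le> j" "j \<le> k" "k + 2 \<le> l" "l + 2 \<le> n"
      and t: "\<forall>b. trip_perm G b = (if 1 \<le> b \<and> b \<le> n then up2 n (perm_S n i j k l b) else b)"
    have "d = perm_S n i j k l" unfolding d_def
      by (rule long_cycle_perm[OF n(2)]) (use c t in \<open>auto simp: perm_S_def\<close>)
    \<comment> \<open>Permutations act on indices from 1, whereas coordinates of the normal forms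
      are numbered from 0.\<close>
    moreover obtain i' j' k' l' where s: "i = Suc i'" "j = Suc j'" "k = Suc k'" "l = Suc l'"
      using c by (cases i; cases j; cases k; cases l) auto
    ultimately have "d = perm_S n (Suc i') (Suc j') (Suc k') (Suc l')" by simp
    then show ?thesis using c s n by (intro sequences.perm_S_form[OF loc n(1), of i' j' k' l']) auto
  next
    fix i j k l
    assume c: "1 \<le> i" "i + 1 \<le> k" "k + 2 \<le> l" "l \<le> j" "j + 2 \<le> n"
      and t: "\<forall>b. trip_perm G b = (if 1 \<le> b \<and> b \<le> n then up2 n (perm_N n i j k l b) else b)"
    have "d = perm_N n i j k l" unfolding d_def
      by (rule long_cycle_perm[OF n(2)]) (use c t in \<open>auto simp: perm_N_def\<close>)
    moreover obtain i' j' k' l' where s: "i = Suc i'" "j = Suc j'" "k = Suc k'" "l = Suc l'"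
      using c by (cases i; cases j; cases k; cases l) auto
    ultimately have "d = perm_N n (Suc i') (Suc j') (Suc k') (Suc l')" by simp
    then show ?thesis using c s n by (intro sequences.perm_N_form[OF loc n(1), of i' k' l' j']) auto
  qed
qed

theorem theorem11p1:
  fixes n :: nat and Z :: "real mat"
  assumes "n \<ge> 6" and "Z \<in> positive_mat 6 n"
  shows "(\<forall>S \<in> bcfw_cells n 2.
            amplituhedron_map Z ` S \<subseteq> amplituhedron n 2 Z \<and> inj_on (amplituhedron_map Z) S) \<and>
         (\<forall>S \<in> bcfw_cells n 2. \<forall>T \<in> bcfw_cells n 2.
            S \<noteq> T \<longrightarrow> disjnt (amplituhedron_map Z ` S) (amplituhedron_map Z ` T))"
proof -
  obtain N where N: "n = Suc N" using assms(1) by (cases n) auto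
  have Z: "Z \<in> positive_mat 6 (Suc N)" and N5: "5 \<le> N" using assms N by auto
  \<comment> \<open>For \<open>S = T\<close> this is injectivity on a cell; for two cells with
    overlapping images it produces a common point.\<close>
  have inj: "V = W" if "S \<in> bcfw_cells n 2" "T \<in> bcfw_cells n 2" "V \<in> S" "W \<in> T"
    "amplituhedron_map Z V = amplituhedron_map Z W" for S T V W
  proof -
    have "4 \<le> n" using assms(1) by simp
    then have "is_form N V" "is_form N W"
      using cell_is_form[OF that(1,3) N] cell_is_form[OF that(2,4) N] by blast+
    then show ?thesis using amplituhedron_map_forms Z N5 that(5) by blast
  qed
  \<comment> \<open>A point determines its decorated permutation and thereby its cell.\<close>
  have cell: "S = T" if "S \<in> bcfw_cells n 2" "T \<in> bcfw_cells n 2" "V \<in> S" "V \<in> T" for S T V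
    using that by (auto simp: bcfw_cells_def positroid_cell_def)
  have sub: "amplituhedron_map Z ` S \<subseteq> amplituhedron n 2 Z" if "S \<in> bcfw_cells n 2" for S
    using that by (auto simp: bcfw_cells_def positroid_cell_def amplituhedron_def)
  show ?thesis
  proof (intro conjI ballI impI)
    fix S assume "S \<in> bcfw_cells n 2"
    then show "amplituhedron_map Z ` S \<subseteq> amplituhedron n 2 Z" "inj_on (amplituhedron_map Z) S"
      using sub inj by (blast, intro inj_onI) blast
  next
    fix S T assume ST: "S \<in> bcfw_cells n 2" "T \<in> bcfw_cells n 2" "S \<noteq> T"
    show "disjnt (amplituhedron_map Z ` S) (amplituhedron_map Z ` T)"
    proof (rule ccontr)
      assume "\<not> disjnt (amplituhedron_map Z ` S) (amplituhedron_map Z ` T)"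
      then obtain V W where VW: "V \<in> S" "W \<in> T" "amplituhedron_map Z V = amplituhedron_map Z W"
        unfolding disjnt_def by blast
      then have "V = W" using inj[OF ST(1,2)] by blast
      then show False using cell[OF ST(1,2)] VW ST(3) by blast
    qed
  qed
qed

end
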